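(* Let $E$ be a real separable Banach space of M-type 2, $T>0$, and let $A$ be a densely defined closed linear operator on $E$ with $\sigma(A)\subset\Sigma_\varpi=\{\lambda\in\mathbb C:|\arg\lambda|<\varpi\}$ for some $0<\varpi<\pi/2$ and $\|(\lambda-A)^{-1}\|\le M_\varpi/|\lambda|$ for $\lambda\notin\Sigma_\varpi$; let $S(t)=e^{-tA}$ be the analytic semigroup generated by $-A$. Let $F,G:[0,T]\to E$ be non-random and satisfy one of: (a) $F\in\mathcal F^{\beta,\sigma}((0,T];E)$ and $G\in\mathcal F^{\beta+\frac12,\sigma}((0,T];E)$ with $0<\sigma<\beta\le\frac12$; (b) $F\in\mathcal F^{\beta,\sigma}((0,T];E)$ with $0<\sigma<\beta\le1$ and $G\in\mathcal B([0,T];E)$. Assume there exist $\delta\in(0,\frac12)$ and $c_\delta>0$ with $\|AS(t)\|<c_\delta t^{-\delta}$ for every $t\in(0,T]$. Let $\xi$ be an $\mathcal F_0$-measurable $E$-valued random variable. Then $dX+AX\,dt=F(t)dt+G(t)dw_t$, $X(0)=\xi$, has a unique strict solution in the space $\mathcal C((0,T];\mathcal D(A))$.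
   Context: $E$ is of M-type 2 if there is $c(E)$ with $\sup_n\mathbb E|M_n|^2\le c(E)\sum_{n\ge0}\mathbb E|M_n-M_{n-1}|^2$ for every $E$-valued martingale ($M_{-1}=0$). $(\Omega,\mathcal F,\mathbb P)$ is complete with filtration $(\mathcal F_t)$ satisfying the usual conditions and $(w_t)$ a one-dimensional Brownian motion; $\mathcal N^2(0,T)$ is the set of $E$-valued predictable processes $\phi$ with $\mathbb E\int_0^T|\phi|^2dt<\infty$ (Itô-integrable against $w$). $\mathcal B([0,T];E)$ is the space of bounded $E$-valued functions with the sup norm. For $0<\sigma<\beta\le1$, $\mathcal F^{\beta,\sigma}((0,T];E)$ is the space of $E$-valued functions $f$ continuous on $(0,T]$ (on $[0,T]$ if $\beta=1$) such that: if $\beta<1$, $t^{1-\beta}f(t)$ has a limit as $t\to0$; $\sup_{0\le s<t\le T}s^{1-\beta+\sigma}|f(t)-f(s)|/(t-s)^\sigma<\infty$; and $\lim_{t\to0}\sup_{0\le s<t}s^{1-\beta+\sigma}|f(t)-f(s)|/(t-s)^\sigma=0$; norm $|f|_{\mathcal F^{\beta,\sigma}}=\sup_t t^{1-\beta}|f(t)|+\sup_{0\le s<t\le T}s^{1-\beta+\sigma}|f(t)-f(s)|/(t-s)^\sigma$. A strict solution is a predictable continuous $E$-valued process $X$ on $[0,T]$ such that $G\in\mathcal N^2(0,T)$, $|\int_0^tF(s)ds|<\infty$ for $t\in[0,T]$, $X(t)\in\mathcal D(A)$ and $\int_0^t\mathbb E|X(s)|^2_{\mathcal D(A)}ds<\infty$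 for $t\in(0,T]$, and for every $t\in(0,T]$, a.s., $X(t)=\xi-\int_0^tAX(s)ds+\int_0^tF(s)ds+\int_0^tG(s)dw_s$. Uniqueness is up to indistinguishability.
   Formalization: Adds E|ξ|²<∞ (else false: E=ℝ, A=1, F=G=0, ξ not in L² gives X=e^{-t}ξ, violating ∫E|X|²_{D(A)}ds<∞) and, in case (b), Borel measurability of G (a non-measurable bounded G is not in N²(0,T)); both conditions are necessary for a strict solution. *)

theory Defs
  imports "HOL-Probability.Probability"
begin

definition disc_martingale ::
  "real measure \<Rightarrow> (nat \<Rightarrow> real measure) \<Rightarrow> (nat \<Rightarrow> real \<Rightarrow> 'e::{banach,second_countable_topology}) \<Rightarrow> bool" where
  "disc_martingale M Fn Mn \<longleftrightarrow>
     prob_space M \<and> (\<forall>n. subalgebra M (Fn n)) \<and> (\<forall>n. sets (Fn n) \<subseteq> sets (Fn (Suc n))) \<and>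
     (\<forall>n. Mn n \<in> borel_measurable (Fn n) \<and> integrable M (Mn n)) \<and>
     (\<forall>n. \<forall>B\<in>sets (Fn n). set_lebesgue_integral M B (Mn (Suc n)) = set_lebesgue_integral M B (Mn n))"

definition M_type_2 :: "'e::{banach,second_countable_topology} itself \<Rightarrow> bool" where
  "M_type_2 (_::'e itself) \<longleftrightarrow> (\<exists>c::real. \<forall>M Fn (Mn :: nat \<Rightarrow> real \<Rightarrow> 'e). disc_martingale M Fn Mn \<longrightarrow>
     (SUP n. \<integral>\<^sup>+\<omega>. ennreal ((norm (Mn n \<omega>))\<^sup>2) \<partial>M)
       \<le> ennreal c * (\<Sum>n. \<integral>\<^sup>+\<omega>. ennreal ((norm (Mn n \<omega> - (if n = 0 then 0 else Mn (n - 1) \<omega>)))\<^sup>2) \<partial>M))"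

definition closed_dense_linear_op :: "'e::banach set \<Rightarrow> ('e \<Rightarrow> 'e) \<Rightarrow> bool" where
  "closed_dense_linear_op D A \<longleftrightarrow>
     subspace D \<and> closure D = UNIV \<and>
     (\<forall>x\<in>D. \<forall>y\<in>D. A (x + y) = A x + A y) \<and> (\<forall>x\<in>D. \<forall>c. A (c *\<^sub>R x) = c *\<^sub>R A x) \<and>
     (\<forall>xs x y. (\<forall>n. xs n \<in> D) \<longrightarrow> xs \<longlonglongrightarrow> x \<longrightarrow> (\<lambda>n. A (xs n)) \<longlonglongrightarrow> y \<longrightarrow> x \<in> D \<and> A x = y)"

definition sector :: "real \<Rightarrow> complex set" where
  "sector \<omega> = {z. z \<noteq> 0 \<and> \<bar>Arg z\<bar> < \<omega>}"

text \<open>\<open>\<lambda> - A\<close> acting on the complexification \<open>E \<times> E\<close> (pairs (x,y) standing for x + i y),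
  with domain \<open>D \<times> D\<close>.\<close>
definition cplx_shift :: "('e::banach \<Rightarrow> 'e) \<Rightarrow> complex \<Rightarrow> 'e \<times> 'e \<Rightarrow> 'e \<times> 'e" where
  "cplx_shift A z p = (Re z *\<^sub>R fst p - Im z *\<^sub>R snd p - A (fst p),
                       Im z *\<^sub>R fst p + Re z *\<^sub>R snd p - A (snd p))"

text \<open>Complexification norm (Taylor norm): sup over angles.\<close>
definition cnorm :: "'e::banach \<times> 'e \<Rightarrow> real" where
  "cnorm p = (SUP \<theta>\<in>UNIV. norm (cos \<theta> *\<^sub>R fst p + sin \<theta> *\<^sub>R snd p))"

definition sectorial :: "'e::banach set \<Rightarrow> ('e \<Rightarrow> 'e) \<Rightarrow> real \<Rightarrow> real \<Rightarrow> bool" where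
  "sectorial D A \<omega> M \<longleftrightarrow>
     (\<forall>z. z \<notin> sector \<omega> \<longrightarrow>
        bij_betw (cplx_shift A z) (D \<times> D) UNIV \<and>
        (\<forall>p\<in>D \<times> D. cmod z * cnorm p \<le> M * cnorm (cplx_shift A z p)))"

definition generates_neg :: "(real \<Rightarrow> 'e::banach \<Rightarrow> 'e) \<Rightarrow> 'e set \<Rightarrow> ('e \<Rightarrow> 'e) \<Rightarrow> bool" where
  "generates_neg S D A \<longleftrightarrow>
     (\<forall>t\<ge>0. bounded_linear (S t)) \<and> S 0 = id \<and>
     (\<forall>t\<ge>0. \<forall>s\<ge>0. S (t + s) = S t \<circ> S s) \<and>
     (\<forall>x. continuous_on {0..} (\<lambda>t. S t x)) \<and>
     (\<forall>x. x \<in> D \<longleftrightarrow> (\<exists>y. ((\<lambda>h. (1 / h) *\<^sub>R (S h x - x)) \<longlongrightarrow> y) (at_right 0))) \<and>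
     (\<forall>x\<in>D. ((\<lambda>h. (1 / h) *\<^sub>R (S h x - x)) \<longlongrightarrow> - A x) (at_right 0))"

definition F_space :: "real \<Rightarrow> real \<Rightarrow> real \<Rightarrow> (real \<Rightarrow> 'e::real_normed_vector) \<Rightarrow> bool" where
  "F_space \<beta> \<sigma> T f \<longleftrightarrow>
     (if \<beta> = 1 then continuous_on {0..T} f else continuous_on {0<..T} f) \<and>
     (\<beta> < 1 \<longrightarrow> (\<exists>L. ((\<lambda>t. t powr (1 - \<beta>) *\<^sub>R f t) \<longlongrightarrow> L) (at_right 0))) \<and>
     (\<exists>K. \<forall>s t. 0 \<le> s \<and> s < t \<and> t \<le> T \<longrightarrow>
         s powr (1 - \<beta> + \<sigma>) * norm (f t - f s) / (t - s) powr \<sigma> \<le> K) \<and>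
     (\<forall>\<epsilon>>0. \<exists>\<eta>>0. \<forall>s t. 0 \<le> s \<and> s < t \<and> t < \<eta> \<and> t \<le> T \<longrightarrow>
         s powr (1 - \<beta> + \<sigma>) * norm (f t - f s) / (t - s) powr \<sigma> \<le> \<epsilon>)"

definition B_space :: "real \<Rightarrow> (real \<Rightarrow> 'e::real_normed_vector) \<Rightarrow> bool" where
  "B_space T f \<longleftrightarrow> bounded (f ` {0..T})"

definition usual_basis :: "'w measure \<Rightarrow> (real \<Rightarrow> 'w measure) \<Rightarrow> bool" where
  "usual_basis P Fl \<longleftrightarrow>
     prob_space P \<and> complete_measure P \<and>
     (\<forall>t. subalgebra P (Fl t)) \<and> (\<forall>s t. s \<le> t \<longrightarrow> sets (Fl s) \<subseteq> sets (Fl t)) \<and>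
     (\<forall>t. sets (Fl t) = (\<Inter>s\<in>{t<..}. sets (Fl s))) \<and>
     null_sets P \<subseteq> sets (Fl 0)"

definition brownian_motion :: "'w measure \<Rightarrow> (real \<Rightarrow> 'w measure) \<Rightarrow> (real \<Rightarrow> 'w \<Rightarrow> real) \<Rightarrow> bool" where
  "brownian_motion P Fl w \<longleftrightarrow>
     (\<forall>\<omega>\<in>space P. w 0 \<omega> = 0 \<and> continuous_on {0..} (\<lambda>t. w t \<omega>)) \<and>
     (\<forall>t\<ge>0. w t \<in> borel_measurable (Fl t)) \<and>
     (\<forall>s t. 0 \<le> s \<and> s < t \<longrightarrow>
        distributed P lborel (\<lambda>\<omega>. w t \<omega> - w s \<omega>) (normal_density 0 (sqrt (t - s))) \<and>
        (\<forall>A\<in>sets (Fl s). \<forall>B\<in>sets borel.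
           measure P (A \<inter> {\<omega>\<in>space P. w t \<omega> - w s \<omega> \<in> B})
             = measure P A * measure P {\<omega>\<in>space P. w t \<omega> - w s \<omega> \<in> B}))"

definition predictable_sigma :: "'w measure \<Rightarrow> (real \<Rightarrow> 'w measure) \<Rightarrow> real \<Rightarrow> (real \<times> 'w) measure" where
  "predictable_sigma P Fl T = sigma ({0..T} \<times> space P)
     ({{0} \<times> A | A. A \<in> sets (Fl 0)} \<union>
      {{s<..t} \<times> A | s t A. 0 \<le> s \<and> s < t \<and> t \<le> T \<and> A \<in> sets (Fl s)})"

definition predictable :: "'w measure \<Rightarrow> (real \<Rightarrow> 'w measure) \<Rightarrow> real \<Rightarrow> (real \<Rightarrow> 'w \<Rightarrow> 'e::{banach,second_countable_topology}) \<Rightarrow> bool" where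
  "predictable P Fl T X \<longleftrightarrow> (\<lambda>(t, \<omega>). X t \<omega>) \<in> borel_measurable (predictable_sigma P Fl T)"

definition N2 :: "'w measure \<Rightarrow> (real \<Rightarrow> 'w measure) \<Rightarrow> real \<Rightarrow> (real \<Rightarrow> 'w \<Rightarrow> 'e::{banach,second_countable_topology}) \<Rightarrow> bool" where
  "N2 P Fl T \<phi> \<longleftrightarrow> predictable P Fl T \<phi> \<and>
     (\<integral>\<^sup>+\<omega>. (\<integral>\<^sup>+t\<in>{0..T}. ennreal ((norm (\<phi> t \<omega>))\<^sup>2) \<partial>lborel) \<partial>P) < \<infinity>"

definition elementary :: "'w measure \<Rightarrow> (real \<Rightarrow> 'w measure) \<Rightarrow> real \<Rightarrow> nat \<Rightarrow> (nat \<Rightarrow> real) \<Rightarrow> (nat \<Rightarrow> 'w \<Rightarrow> 'e::{banach,second_countable_topology}) \<Rightarrow> bool" where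
  "elementary P Fl T n tk xk \<longleftrightarrow> tk 0 = 0 \<and> tk n = T \<and> (\<forall>k<n. tk k < tk (Suc k)) \<and>
     (\<forall>k<n. xk k \<in> borel_measurable (Fl (tk k)) \<and> (\<integral>\<^sup>+\<omega>. ennreal ((norm (xk k \<omega>))\<^sup>2) \<partial>P) < \<infinity>)"

definition elem_val :: "nat \<Rightarrow> (nat \<Rightarrow> real) \<Rightarrow> (nat \<Rightarrow> 'w \<Rightarrow> 'e::real_normed_vector) \<Rightarrow> real \<Rightarrow> 'w \<Rightarrow> 'e" where
  "elem_val n tk xk t \<omega> = (\<Sum>k<n. indicator {tk k<..tk (Suc k)} t *\<^sub>R xk k \<omega>)"

definition elem_int :: "(real \<Rightarrow> 'w \<Rightarrow> real) \<Rightarrow> nat \<Rightarrow> (nat \<Rightarrow> real) \<Rightarrow> (nat \<Rightarrow> 'w \<Rightarrow> 'e::real_normed_vector) \<Rightarrow> real \<Rightarrow> 'w \<Rightarrow> 'e" where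
  "elem_int w n tk xk t \<omega> = (\<Sum>k<n. (w (min (tk (Suc k)) t) \<omega> - w (min (tk k) t) \<omega>) *\<^sub>R xk k \<omega>)"

definition ito_integral :: "'w measure \<Rightarrow> (real \<Rightarrow> 'w measure) \<Rightarrow> (real \<Rightarrow> 'w \<Rightarrow> real) \<Rightarrow> real \<Rightarrow>
    (real \<Rightarrow> 'w \<Rightarrow> 'e::{banach,second_countable_topology}) \<Rightarrow> real \<Rightarrow> ('w \<Rightarrow> 'e) \<Rightarrow> bool" where
  "ito_integral P Fl w T \<phi> t I \<longleftrightarrow> I \<in> borel_measurable P \<and>
     (\<exists>ns tks xks. (\<forall>j. elementary P Fl T (ns j) (tks j) (xks j)) \<and>
       ((\<lambda>j. \<integral>\<^sup>+\<omega>. (\<integral>\<^sup>+s\<in>{0..T}. ennreal ((norm (\<phi> s \<omega> - elem_val (ns j) (tks j) (xks j) s \<omega>))\<^sup>2) \<partial>lborel) \<partial>P)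
          \<longlongrightarrow> 0) sequentially \<and>
       ((\<lambda>j. \<integral>\<^sup>+\<omega>. ennreal ((norm (I \<omega> - elem_int w (ns j) (tks j) (xks j) t \<omega>))\<^sup>2) \<partial>P)
          \<longlongrightarrow> 0) sequentially)"

definition strict_solution :: "'w measure \<Rightarrow> (real \<Rightarrow> 'w measure) \<Rightarrow> (real \<Rightarrow> 'w \<Rightarrow> real) \<Rightarrow> real \<Rightarrow>
    'e::{banach,second_countable_topology} set \<Rightarrow> ('e \<Rightarrow> 'e) \<Rightarrow> (real \<Rightarrow> 'e) \<Rightarrow> (real \<Rightarrow> 'e) \<Rightarrow> ('w \<Rightarrow> 'e) \<Rightarrow>
    (real \<Rightarrow> 'w \<Rightarrow> 'e) \<Rightarrow> bool" where
  "strict_solution P Fl w T D A F G \<xi> X \<longleftrightarrow>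
     predictable P Fl T X \<and> (\<forall>\<omega>\<in>space P. continuous_on {0..T} (\<lambda>t. X t \<omega>)) \<and>
     N2 P Fl T (\<lambda>t \<omega>. G t) \<and>
     (\<forall>t\<in>{0..T}. integrable (lebesgue_on {0..t}) F) \<and>
     (\<forall>t\<in>{0<..T}. \<forall>\<omega>\<in>space P. X t \<omega> \<in> D) \<and>
     (\<forall>t\<in>{0<..T}. (\<integral>\<^sup>+s\<in>{0<..t}. (\<integral>\<^sup>+\<omega>. ennreal ((norm (X s \<omega>) + norm (A (X s \<omega>)))\<^sup>2) \<partial>P) \<partial>lborel) < \<infinity>) \<and>
     (\<forall>t\<in>{0<..T}. \<exists>I. ito_integral P Fl w T (\<lambda>s \<omega>. G s) t I \<and>
        (AE \<omega> in P. integrable (lebesgue_on {0..t}) (\<lambda>s. A (X s \<omega>)) \<and>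
           X t \<omega> = \<xi> \<omega> - integral\<^sup>L (lebesgue_on {0..t}) (\<lambda>s. A (X s \<omega>))
                   + integral\<^sup>L (lebesgue_on {0..t}) F + I \<omega>))"

text \<open>Paths in \<open>C((0,T];D(A))\<close> (graph norm).\<close>
definition in_C_DA :: "'w measure \<Rightarrow> real \<Rightarrow> 'e::banach set \<Rightarrow> ('e \<Rightarrow> 'e) \<Rightarrow> (real \<Rightarrow> 'w \<Rightarrow> 'e) \<Rightarrow> bool" where
  "in_C_DA P T D A X \<longleftrightarrow> (\<forall>\<omega>\<in>space P. (\<forall>t\<in>{0<..T}. X t \<omega> \<in> D) \<and>
      continuous_on {0<..T} (\<lambda>t. X t \<omega>) \<and> continuous_on {0<..T} (\<lambda>t. A (X t \<omega>)))"

end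

theory Submission
  imports Defs
begin

text \<open>Since \<open>\<delta> < 1\<close>, the bound \<open>\<parallel>A S(t)\<parallel> < c t\<^sup>-\<^sup>\<delta>\<close> is integrable at \<open>0\<close>, so \<open>S(t) \<rightarrow> I\<close> in operator norm and
  \<open>A\<close> is bounded with domain \<open>E\<close>. The equation becomes \<open>X(t) = Z(t) - \<integral>\<^sub>0\<^sup>t A X ds\<close> with
  \<open>Z(t) = \<xi> + \<integral>\<^sub>0\<^sup>t F ds + \<integral>\<^sub>0\<^sup>t G dw\<close>, and it is solved path by path with Picard iteration once the stochastic
  integral has a continuous version. That version is the almost sure uniform limit of integrals of step
  functions: M-type 2 bounds their second moments by the square norm of the integrand, and Doob's maximal
  inequality makes the bound uniform in time. The same second moment bound identifies any two stochastic
  integrals of \<open>G\<close>, after which Gronwall's argument gives uniqueness.\<close>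

section \<open>Semigroups whose generator is bounded\<close>

text \<open>What the alternatives for \<open>F\<close> and \<open>G\<close> supply is integrability:
  |f(t)| \<le> C t^(\<gamma>-1) makes \<open>F\<close> integrable when \<gamma> = \<beta> > 0, and
  \<open>G\<close> square integrable when \<gamma> = \<beta> + 1/2, as 2(\<gamma> - 1) > -1. The
  obstacle is the stochastic integral. The relation \<open>ito_integral\<close> fixes it at each
  time only up to a null set, whereas a pathwise solution needs one process, continuous in time and
  adapted. Since \<open>G\<close> is non-random, the approximants can have non-random coefficients;
  their integrals combine stopped Brownian motions. The j-th approximant has squared error 16^-j,
  which pays for two losses: going from second to first moments, and dividing by the threshold 2^-j
  in the maximal inequality. A strict solution must also have a square integrable graph norm. The
  pathwise estimates are therefore kept linear in the forcing term, so that the second moments of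
  \<open>\<xi>\<close> and of the stochastic integral carry over to the solution. Exponential
  weights with rate 2K make the Volterra map contract by 1/2 on all of [0,T], without cutting the
  interval.\<close>

lemma uniform_boundedness:
  fixes f :: "'i \<Rightarrow> 'a::banach \<Rightarrow> 'b::real_normed_vector"
  assumes lin: "\<And>i. i \<in> I \<Longrightarrow> bounded_linear (f i)"
    and bdd: "\<And>x. bounded ((\<lambda>i. f i x) ` I)"
  shows "\<exists>K\<ge>0. \<forall>i\<in>I. \<forall>x. norm (f i x) \<le> K * norm x"
proof -
  define V where "V n = {x. \<forall>i\<in>I. norm (f i x) \<le> real n}" for n
  have V_eq: "V n = (\<Inter>i\<in>I. {x. norm (f i x) \<le> real n})" for n
    by (auto simp: V_def)
  have cl: "closed (V n)" for n
    unfolding V_eq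
    by (intro closed_INT ballI closed_Collect_le continuous_on_norm continuous_on_const
        linear_continuous_on lin)
  have "x \<in> (\<Union>n. V n)" for x
  proof -
    obtain b where "\<forall>i\<in>I. norm (f i x) \<le> b"
      using bdd[of x] by (auto simp: bounded_iff)
    moreover obtain n where "b \<le> real n" using real_arch_simple by blast
    ultimately have "x \<in> V n" by (auto simp: V_def intro: order_trans)
    thus ?thesis by blast
  qed
  hence U: "(\<Union>n. V n) = UNIV" by auto
  \<comment> \<open>Baire category: countably many closed sets with empty interior cannot cover a
    complete space, so some \<open>V n\<close> contains a closed ball. Differences of two points of
    that ball reach every direction, which is the origin of the constant
    \<open>2 * real n / r\<close>.\<close>
  have "\<exists>n. interior (V n) \<noteq> {}"
  proof (rule ccontr)
    assume "\<not> ?thesis"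
    then have "Met_TC.mtopology interior_of \<Union>(range V) = {}"
      by (intro Met_TC.metric_Baire_category_alt)
         (auto simp: cl complete_UNIV)
    with U show False by simp
  qed
  then obtain n x0 r where r: "r > 0" "cball x0 r \<subseteq> V n"
    by (auto simp: interior_def open_contains_cball) blast
  have "norm (f i x) \<le> 2 * real n / r * norm x" if i: "i \<in> I" for i x
  proof (cases "x = 0")
    case True
    then show ?thesis using linear_simps(3)[OF lin[OF i]] by simp
  next
    case False
    interpret f: bounded_linear "f i" by (rule lin[OF i])
    define y where "y = x0 + (r / norm x) *\<^sub>R x"
    have "y \<in> V n" "x0 \<in> V n" using r False by (auto simp: y_def dist_norm subset_iff)
    hence "norm (f i y) \<le> n" "norm (f i x0) \<le> n" using i by (auto simp: V_def)
    hence "norm (f i y - f i x0) \<le> 2 * real n" using norm_triangle_ineq4[of "f i y" "f i x0"] by linarith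
    moreover have "f i y - f i x0 = (r / norm x) *\<^sub>R f i x"
      by (simp add: y_def f.add f.scaleR)
    ultimately have "r / norm x * norm (f i x) \<le> 2 * real n" using r by simp
    thus ?thesis using r False by (simp add: field_simps)
  qed
  moreover have "2 * real n / r \<ge> 0" using r by simp
  ultimately show ?thesis by blast
qed

section \<open>Orbits of a strongly continuous semigroup\<close>

lemma generates_negD:
  assumes "generates_neg S D A"
  shows "t \<ge> 0 \<Longrightarrow> bounded_linear (S t)" "S 0 x = x"
    "t \<ge> 0 \<Longrightarrow> s \<ge> 0 \<Longrightarrow> S (t + s) x = S t (S s x)"
    "continuous_on {0..} (\<lambda>t. S t x)"
    "((\<lambda>h. (1 / h) *\<^sub>R (S h x - x)) \<longlongrightarrow> y) (at_right 0) \<Longrightarrow> x \<in> D"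
    "x \<in> D \<Longrightarrow> ((\<lambda>h. (1 / h) *\<^sub>R (S h x - x)) \<longlongrightarrow> - A x) (at_right 0)"
  using assms by (auto simp: generates_neg_def)

text \<open>A continuous orbit over a compact interval is bounded, so the uniform boundedness
  principle applies. The bound later controls left difference quotients, where the operator in front
  varies with the step.\<close>

lemma semigroup_locally_bounded:
  assumes "generates_neg S D A"
  shows "\<exists>K\<ge>0. \<forall>s\<in>{0..t}. \<forall>x. norm (S s x) \<le> K * norm x"
proof (rule uniform_boundedness)
  show "bounded_linear (S i)" if "i \<in> {0..t}" for i
    using that generates_negD(1)[OF assms] by auto
  show "bounded ((\<lambda>s. S s x) ` {0..t})" for x
    by (intro compact_imp_bounded compact_continuous_image continuous_on_subset[OF generates_negD(4)[OF assms]]) auto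
qed

text \<open>\<open>S t\<close> is continuous and commutes with every \<open>S h\<close>, hence
  passes through the limit of difference quotients that defines \<open>A\<close>.\<close>

lemma semigroup_domain_invariant:
  assumes g: "generates_neg S D A" and x: "x \<in> D" and t: "t \<ge> 0"
  shows "S t x \<in> D" "A (S t x) = S t (A x)"
proof -
  interpret St: bounded_linear "S t" using generates_negD(1)[OF g t] .
  have "((\<lambda>h. S t ((1 / h) *\<^sub>R (S h x - x))) \<longlongrightarrow> S t (- A x)) (at_right 0)"
    by (intro St.tendsto generates_negD(6)[OF g x])
  moreover have "\<forall>\<^sub>F h in at_right 0. S t ((1 / h) *\<^sub>R (S h x - x)) = (1 / h) *\<^sub>R (S h (S t x) - S t x)"
    by (rule eventually_at_right_less[of 0, THEN eventually_mono])
       (simp add: St.scaleR St.diff generates_negD(3)[OF g, symmetric] t add.commute)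
  ultimately have L: "((\<lambda>h. (1 / h) *\<^sub>R (S h (S t x) - S t x)) \<longlongrightarrow> S t (- A x)) (at_right 0)"
    by (rule Lim_transform_eventually)
  thus D: "S t x \<in> D" by (rule generates_negD(5)[OF g])
  have "S t (- A x) = - A (S t x)"
    by (rule tendsto_unique[OF _ L generates_negD(6)[OF g D]]) simp
  thus "A (S t x) = S t (A x)" by (simp add: St.neg)
qed

text \<open>The generator provides only a right derivative at 0. To the right of \<open>t\<close>
  the quotient is \<open>S t\<close> applied to the quotient \<open>q h\<close> at 0. To the left it
  involves \<open>S (t - h)\<close> instead, and the local bound \<open>K\<close> together with
  strong continuity makes up for the varying operator.\<close>

lemma semigroup_has_vector_derivative:
  assumes g: "generates_neg S D A" and x: "x \<in> D" and t: "t > 0"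
  shows "((\<lambda>s. S s x) has_vector_derivative - S t (A x)) (at t)"
proof -
  define q where "q h = (1 / h) *\<^sub>R (S h x - x)" for h
  have q: "(q \<longlongrightarrow> - A x) (at_right 0)"
    using generates_negD(6)[OF g x] by (simp add: q_def[abs_def])
  obtain K where K: "K \<ge> 0" "\<And>s y. s \<in> {0..t} \<Longrightarrow> norm (S s y) \<le> K * norm y"
    using semigroup_locally_bounded[OF g, of t] by blast
  interpret St: bounded_linear "S t" using generates_negD(1)[OF g] t by simp
  have hq: "h *\<^sub>R q h = S h x - x" if "h > 0" for h using that by (simp add: q_def)
  have R: "((\<lambda>h. norm (S (t + h) x - S t x - h *\<^sub>R (- S t (A x))) / norm h) \<longlongrightarrow> 0) (at_right 0)"
  proof (rule Lim_transform_eventually)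
    show "((\<lambda>h. norm (S t (q h) - S t (- A x))) \<longlongrightarrow> 0) (at_right 0)"
      by (intro tendsto_norm_zero LIM_zero St.tendsto q)
    show "\<forall>\<^sub>F h in at_right 0. norm (S t (q h) - S t (- A x)) = norm (S (t + h) x - S t x - h *\<^sub>R (- S t (A x))) / norm h"
    proof (rule eventually_at_right_less[of 0, THEN eventually_mono])
      fix h :: real assume h: "0 < h"
      have "S (t + h) x - S t x - h *\<^sub>R (- S t (A x)) = S t (h *\<^sub>R q h) - h *\<^sub>R S t (- A x)"
        using h t by (simp add: hq generates_negD(3)[OF g] St.diff St.neg)
      also have "\<dots> = h *\<^sub>R (S t (q h) - S t (- A x))"
        by (simp add: St.scaleR algebra_simps)
      finally show "norm (S t (q h) - S t (- A x)) = norm (S (t + h) x - S t x - h *\<^sub>R (- S t (A x))) / norm h"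
        using h by simp
    qed
  qed
  have Lf: "((\<lambda>h. norm (S (t - h) x - S t x + h *\<^sub>R (- S t (A x))) / norm h) \<longlongrightarrow> 0) (at_right 0)"
  proof (rule Lim_null_comparison)
    have "((\<lambda>h. t - h) \<longlongrightarrow> t - 0) (at_right 0)" by (intro tendsto_intros)
    hence lim: "((\<lambda>h. t - h) \<longlongrightarrow> t) (at_right 0)" by simp
    have "continuous (at t within {0..}) (\<lambda>s. S s (A x))"
      using generates_negD(4)[OF g, of "A x"] t by (auto simp: continuous_on_eq_continuous_within)
    hence "isCont (\<lambda>s. S s (A x)) t" using t
      by (simp add: at_within_interior[of t "{0..}"])
    hence "((\<lambda>h. S (t - h) (A x)) \<longlongrightarrow> S t (A x)) (at_right 0)"
      using lim isCont_tendsto_compose by blast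
    hence "((\<lambda>h. norm (S (t - h) (A x) - S t (A x))) \<longlongrightarrow> 0) (at_right 0)"
      by (intro tendsto_norm_zero LIM_zero)
    moreover have "((\<lambda>h. K * norm (q h - - A x)) \<longlongrightarrow> 0) (at_right 0)"
      by (intro tendsto_mult_right_zero tendsto_norm_zero LIM_zero q)
    ultimately show "((\<lambda>h. norm (S (t - h) (A x) - S t (A x)) + K * norm (q h - - A x)) \<longlongrightarrow> 0) (at_right 0)"
      using tendsto_add_zero by blast
    show "\<forall>\<^sub>F h in at_right 0. norm (norm (S (t - h) x - S t x + h *\<^sub>R (- S t (A x))) / norm h)
        \<le> norm (S (t - h) (A x) - S t (A x)) + K * norm (q h - - A x)"
    proof (rule eventually_at_right[THEN iffD2, OF t], intro exI[of _ t] conjI t allI impI)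
      fix h assume h: "0 < h" "h < t"
      interpret Sh: bounded_linear "S (t - h)" using generates_negD(1)[OF g] h by simp
      have "S t x = S (t - h) (S h x)" using generates_negD(3)[OF g, of "t - h" h x] h by simp
      also have "S h x = x + h *\<^sub>R q h" using hq[OF h(1)] by simp
      finally have "S (t - h) x - S t x + h *\<^sub>R (- S t (A x)) = h *\<^sub>R ((S (t - h) (A x) - S t (A x)) - S (t - h) (q h - - A x))"
        by (simp add: Sh.add Sh.scaleR algebra_simps)
      hence "norm (S (t - h) x - S t x + h *\<^sub>R (- S t (A x))) / norm h
          = norm ((S (t - h) (A x) - S t (A x)) - S (t - h) (q h - - A x))" using h by simp
      also have "\<dots> \<le> norm (S (t - h) (A x) - S t (A x)) + norm (S (t - h) (q h - - A x))"
        by (rule norm_triangle_ineq4)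
      also have "\<dots> \<le> norm (S (t - h) (A x) - S t (A x)) + K * norm (q h - - A x)"
        using K(2) h by auto
      finally show "norm (norm (S (t - h) x - S t x + h *\<^sub>R (- S t (A x))) / norm h)
        \<le> norm (S (t - h) (A x) - S t (A x)) + K * norm (q h - - A x)" by simp
    qed
  qed
  have "((\<lambda>h. norm (S (t + h) x - S t x - h *\<^sub>R (- S t (A x))) / norm h) \<longlongrightarrow> 0) (at 0)"
    unfolding filterlim_split_at filterlim_at_split
    using R Lf by (auto simp: filterlim_at_left_to_right)
  thus ?thesis
    unfolding has_vector_derivative_def has_derivative_at
    by (intro conjI bounded_linear_scaleR_left)
qed

text \<open>The bound on \<^const>\<open>onorm\<close> says something only once \<open>A S(t)\<close> is known to be bounded, since otherwise
  \<^const>\<open>onorm\<close> is a junk value. Boundedness holds because \<open>- A S(t)\<close> is the pointwise limit of the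
  difference quotients.\<close>

theorem integrable_singularity_imp_bounded_generator:
  fixes S :: "real \<Rightarrow> 'e::banach \<Rightarrow> 'e"
  assumes op: "closed_dense_linear_op D A" and g: "generates_neg S D A"
    and T: "T > 0" and \<delta>: "\<delta> < 1" and c: "c > 0"
    and AS: "\<And>t x. t \<in> {0<..T} \<Longrightarrow> S t x \<in> D"
      "\<And>t. t \<in> {0<..T} \<Longrightarrow> onorm (\<lambda>x. A (S t x)) < c * t powr (- \<delta>)"
  shows "D = UNIV" "bounded_linear A"
proof -
  have add: "A (x + y) = A x + A y" and scale: "A (r *\<^sub>R x) = r *\<^sub>R A x" if "x \<in> D" "y \<in> D" for x y r
    using op that by (auto simp: closed_dense_linear_op_def)
  have ASbl: "bounded_linear (\<lambda>x. A (S t x))" if t: "t \<in> {0<..T}" for t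
  proof -
    interpret St: bounded_linear "S t" using generates_negD(1)[OF g] t by auto
    define B where "B n x = real (Suc n) *\<^sub>R (S (inverse (real (Suc n))) (S t x) - S t x)" for n x
    have lim: "(\<lambda>n. B n x) \<longlonglongrightarrow> - A (S t x)" for x
    proof -
      have "filterlim (\<lambda>n. inverse (real (Suc n))) (at_right 0) sequentially"
        unfolding filterlim_at using LIMSEQ_inverse_real_of_nat by (auto intro!: always_eventually)
      from filterlim_compose[OF generates_negD(6)[OF g AS(1)[OF t, of x]] this]
      show ?thesis by (simp add: B_def divide_inverse)
    qed
    have "\<exists>K\<ge>0. \<forall>n\<in>UNIV. \<forall>x. norm (B n x) \<le> K * norm x"
    proof (rule uniform_boundedness)
      show "bounded_linear (B n)" for n
        unfolding B_def by (intro bounded_linear_compose[OF bounded_linear_scaleR_right] bounded_linear_sub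
            bounded_linear_compose[OF generates_negD(1)[OF g]] St.bounded_linear_axioms) auto
      show "bounded (range (\<lambda>n. B n x))" for x
        by (rule convergent_imp_bounded[OF lim])
    qed
    then obtain K where "\<And>n x. norm (B n x) \<le> K * norm x" by blast
    hence "norm (- A (S t x)) \<le> K * norm x" for x
      by (intro LIMSEQ_le_const2[OF tendsto_norm[OF lim]]) auto
    thus ?thesis
      by (intro bounded_linear_intro[of _ K]) (simp_all add: St.add St.scaleR add[OF AS(1)[OF t] AS(1)[OF t]]
          scale[OF AS(1)[OF t] AS(1)[OF t]] mult.commute)
  qed
  have ASb: "norm (A (S t x)) \<le> c * t powr (- \<delta>) * norm x" if "t \<in> {0<..T}" for t x
    using onorm[OF ASbl[OF that], of x] AS(2)[OF that] mult_right_mono[OF _ norm_ge_zero[of x]]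
    by (meson less_eq_real_def order_trans)
  \<comment> \<open>The orbit of an arbitrary \<open>x\<close> is differentiable at positive times:
    \<open>S (s / 2) x\<close> already lies in \<open>D\<close>, and the remaining time
    \<open>s / 2\<close> is run from that point.\<close>
  have der: "((\<lambda>u. S u x) has_vector_derivative - A (S s x)) (at s)" if s: "s \<in> {0<..T}" for s x
  proof -
    have s2: "s / 2 \<in> {0<..T}" "s / 2 > 0" using s by auto
    define y where "y = S (s / 2) x"
    have y: "y \<in> D" using AS(1)[OF s2(1)] by (simp add: y_def)
    have "((\<lambda>u. S u y) has_vector_derivative - S (s / 2) (A y)) (at (s - s / 2))"
      using semigroup_has_vector_derivative[OF g y s2(2)] by simp
    moreover have "((\<lambda>u. u - s / 2) has_vector_derivative 1) (at s)"
      by (auto intro!: derivative_eq_intros)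
    ultimately have "((\<lambda>u. S u y) \<circ> (\<lambda>u. u - s / 2) has_vector_derivative 1 *\<^sub>R - S (s / 2) (A y)) (at s)"
      by (intro vector_diff_chain_at)
    hence "((\<lambda>u. S (u - s / 2) y) has_vector_derivative - S (s / 2) (A y)) (at s)"
      by (simp add: o_def)
    moreover have "S (s / 2) (A y) = A (S s x)"
      using semigroup_domain_invariant(2)[OF g y, of "s/2"] s2 generates_negD(3)[OF g, of "s/2" "s/2" x]
      by (simp add: y_def)
    ultimately have d: "((\<lambda>u. S (u - s / 2) y) has_vector_derivative - A (S s x)) (at s)" by simp
    have e: "S (u - s / 2) y = S u x" if "u \<in> {s/2<..}" for u
      using generates_negD(3)[OF g, of "u - s/2" "s/2" x] that s by (simp add: y_def)
    show ?thesis
      by (rule has_vector_derivative_transform_within_open[OF d, of "{s/2<..}"]) (use s e in auto)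
  qed
  \<comment> \<open>The mean value inequality against the primitive of
    \<open>c * s powr (- \<delta>)\<close>, which is continuous at 0 because \<delta> < 1. The bound
    is proportional to |x|, so it is convergence of \<open>S t\<close> to the identity in operator
    norm.\<close>
  have Sx: "norm (S t x - x) \<le> c / (1 - \<delta>) * t powr (1 - \<delta>) * norm x" if t: "t \<in> {0<..T}" for t x
  proof -
    have "norm (S t x - S 0 x) \<le> c / (1 - \<delta>) * t powr (1 - \<delta>) * norm x - c / (1 - \<delta>) * 0 powr (1 - \<delta>) * norm x"
    proof (rule differentiable_bound_general[of 0 t "\<lambda>t. S t x" "\<lambda>t. c / (1 - \<delta>) * t powr (1 - \<delta>) * norm x"
          "\<lambda>s. - A (S s x)" "\<lambda>s. c * s powr (- \<delta>) * norm x"])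
      show "0 < t" using t by auto
      show "continuous_on {0..t} (\<lambda>t. S t x)" by (rule continuous_on_subset[OF generates_negD(4)[OF g]]) auto
      show "continuous_on {0..t} (\<lambda>t. c / (1 - \<delta>) * t powr (1 - \<delta>) * norm x)"
        using \<delta> by (intro continuous_intros continuous_on_powr') auto
      fix s assume s: "0 < s" "s < t"
      show "((\<lambda>t. S t x) has_vector_derivative - A (S s x)) (at s)" using der s t by auto
      have "((\<lambda>t. c / (1 - \<delta>) * t powr (1 - \<delta>) * norm x) has_real_derivative
          c / (1 - \<delta>) * ((1 - \<delta>) * s powr (1 - \<delta> - 1)) * norm x) (at s)"
        by (intro DERIV_cmult_right DERIV_cmult has_real_derivative_powr s)
      thus "((\<lambda>t. c / (1 - \<delta>) * t powr (1 - \<delta>) * norm x) has_vector_derivative c * s powr - \<delta> * norm x) (at s)"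
        using \<delta> by (simp add: has_real_derivative_iff_has_vector_derivative)
      show "norm (- A (S s x)) \<le> c * s powr - \<delta> * norm x" using ASb s t by auto
    qed
    thus ?thesis using \<delta> by (simp add: generates_negD(2)[OF g])
  qed
  have "((\<lambda>t. c / (1 - \<delta>) * t powr (1 - \<delta>)) \<longlongrightarrow> c / (1 - \<delta>) * 0 powr (1 - \<delta>)) (at_right 0)"
    using \<delta> by (intro tendsto_intros tendsto_powr') (auto intro!: eventually_mono[OF eventually_at_right_less[of 0]])
  hence "((\<lambda>t. c / (1 - \<delta>) * t powr (1 - \<delta>)) \<longlongrightarrow> 0) (at_right 0)" using \<delta> by simp
  hence "\<forall>\<^sub>F t in at_right 0. c / (1 - \<delta>) * t powr (1 - \<delta>) < 1/2"
    by (rule order_tendstoD) simp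
  then obtain b where b: "b > 0" "\<And>t. 0 < t \<Longrightarrow> t < b \<Longrightarrow> c / (1 - \<delta>) * t powr (1 - \<delta>) < 1/2"
    unfolding eventually_at_right[OF zero_less_one] by auto
  define \<tau> where "\<tau> = min T (b / 2)"
  have \<tau>: "\<tau> > 0" "\<tau> \<le> T" "\<tau> < b" using T b by (auto simp: \<tau>_def)
  have half: "norm (S t x - x) \<le> 1/2 * norm x" if "0 < t" "t \<le> \<tau>" for t x
  proof -
    have "norm (S t x - x) \<le> c / (1 - \<delta>) * t powr (1 - \<delta>) * norm x" using Sx that \<tau> by auto
    also have "\<dots> \<le> 1/2 * norm x" using b(2)[of t] that \<tau> by (intro mult_right_mono) auto
    finally show ?thesis .
  qed
  \<comment> \<open>The curve \<open>S t x + t *\<^sub>R A x\<close> has derivative (1 - S(s)) A x,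
    of norm at most |A x|/2 before \<tau>. So \<tau> A x differs from x - S(\<tau>) x by at most
    \<tau> |A x|/2, and this half is absorbed on the left.\<close>
  have Ab: "norm (A x) \<le> 1 / \<tau> * norm x" if x: "x \<in> D" for x
  proof -
    have "norm ((S \<tau> x + \<tau> *\<^sub>R A x) - (S 0 x + 0 *\<^sub>R A x)) \<le> \<tau> * (1/2 * norm (A x)) - 0 * (1/2 * norm (A x))"
    proof (rule differentiable_bound_general[of 0 \<tau> "\<lambda>t. S t x + t *\<^sub>R A x" "\<lambda>t. t * (1/2 * norm (A x))"
          "\<lambda>s. - S s (A x) + A x" "\<lambda>s. 1/2 * norm (A x)"])
      show "0 < \<tau>" by fact
      show "continuous_on {0..\<tau>} (\<lambda>t. S t x + t *\<^sub>R A x)"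
        by (intro continuous_intros continuous_on_subset[OF generates_negD(4)[OF g]]) auto
      show "continuous_on {0..\<tau>} (\<lambda>t. t * (1/2 * norm (A x)))" by (intro continuous_intros)
      fix s assume s: "0 < s" "s < \<tau>"
      show "((\<lambda>t. S t x + t *\<^sub>R A x) has_vector_derivative - S s (A x) + A x) (at s)"
        using semigroup_has_vector_derivative[OF g x s(1)] by (auto intro!: derivative_eq_intros)
      show "((\<lambda>t. t * (1/2 * norm (A x))) has_vector_derivative 1/2 * norm (A x)) (at s)"
        unfolding has_real_derivative_iff_has_vector_derivative[symmetric]
        by (auto intro!: derivative_eq_intros)
      show "norm (- S s (A x) + A x) \<le> 1/2 * norm (A x)"
        using half[of s "A x"] s by (simp add: norm_minus_commute)
    qed
    hence "norm (\<tau> *\<^sub>R A x - (x - S \<tau> x)) \<le> \<tau> * (1/2 * norm (A x))"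
      by (simp add: generates_negD(2)[OF g] algebra_simps)
    moreover have "norm (x - S \<tau> x) \<le> 1/2 * norm x" using half[of \<tau> x] \<tau> by (simp add: norm_minus_commute)
    moreover have "norm (\<tau> *\<^sub>R A x) = \<tau> * norm (A x)" using \<tau> by simp
    ultimately have "\<tau> * norm (A x) \<le> norm x"
      using norm_triangle_ineq2[of "\<tau> *\<^sub>R A x" "x - S \<tau> x"] by linarith
    thus ?thesis using \<tau> by (simp add: field_simps)
  qed
  have sub: "subspace D" and dense: "closure D = UNIV" using op by (auto simp: closed_dense_linear_op_def)
  have diff: "A (x - y) = A x - A y" if "x \<in> D" "y \<in> D" for x y
    using add[of "x" "(-1) *\<^sub>R y"] scale[of y y "-1"] that subspace_scale[OF sub, of y "-1"] by simp
  have "x \<in> D" for x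
  proof -
    obtain X where X: "\<And>n. X n \<in> D" "X \<longlonglongrightarrow> x" using dense closure_sequential[of x D] by auto
    \<comment> \<open>Boundedness of \<open>A\<close> on \<open>D\<close> makes the images of an
      approximating sequence Cauchy; closedness of the graph then puts the limit of the sequence
      into \<open>D\<close>.\<close>
    have "Cauchy (\<lambda>n. A (X n))"
    proof (rule CauchyI)
      fix e :: real assume e: "e > 0"
      hence "e * \<tau> > 0" using \<tau> by simp
      from CauchyD[OF LIMSEQ_imp_Cauchy[OF X(2)] this]
      obtain M where M: "\<And>m n. m \<ge> M \<Longrightarrow> n \<ge> M \<Longrightarrow> norm (X m - X n) < e * \<tau>" by blast
      have "norm (A (X m) - A (X n)) < e" if "m \<ge> M" "n \<ge> M" for m n
        using M[OF that] Ab[of "X m - X n"] subspace_diff[OF sub X(1) X(1)] \<tau>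
        by (simp add: diff X field_simps) (metis le_less_trans mult_less_cancel_left_pos)
      thus "\<exists>M. \<forall>m\<ge>M. \<forall>n\<ge>M. norm (A (X m) - A (X n)) < e" by blast
    qed
    then obtain y where "(\<lambda>n. A (X n)) \<longlonglongrightarrow> y" using Cauchy_convergent_iff convergent_def by blast
    thus ?thesis using op X unfolding closed_dense_linear_op_def by blast
  qed
  thus D: "D = UNIV" by blast
  show "bounded_linear A"
    by (rule bounded_linear_intro[of _ "1/\<tau>"]) (use add scale Ab D in \<open>auto simp: mult.commute\<close>)
qed

section \<open>Martingales in spaces of M-type 2\<close>

text \<open>The final sigma-algebra of \<open>\<phi>\<close>: the largest one on the target that
  makes \<open>\<phi>\<close> measurable. It only records sets; a measure on it is supplied by
  \<open>distr\<close>. Preimages respect complements and countable unions, so the generating family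
  is already a sigma-algebra.\<close>

definition push_algebra :: "'a measure \<Rightarrow> ('a \<Rightarrow> 'b) \<Rightarrow> 'b measure" where
  "push_algebra M \<phi> = sigma UNIV {B. \<phi> -` B \<inter> space M \<in> sets M}"

lemma space_push_algebra [simp]: "space (push_algebra M \<phi>) = UNIV"
  by (simp add: push_algebra_def space_measure_of_conv)

lemma sets_push_algebra: "sets (push_algebra M \<phi>) = {B. \<phi> -` B \<inter> space M \<in> sets M}"
proof -
  have "sigma_algebra UNIV {B. \<phi> -` B \<inter> space M \<in> sets M}"
    unfolding sigma_algebra_iff2
  proof (intro conjI ballI allI impI)
    fix B assume "B \<in> {B. \<phi> -` B \<inter> space M \<in> sets M}"
    moreover have "\<phi> -` (UNIV - B) \<inter> space M = space M - \<phi> -` B \<inter> space M" by auto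
    ultimately show "UNIV - B \<in> {B. \<phi> -` B \<inter> space M \<in> sets M}"
      by (auto simp del: vimage_Diff)
  next
    fix A :: "nat \<Rightarrow> _" assume "range A \<subseteq> {B. \<phi> -` B \<inter> space M \<in> sets M}"
    moreover have "\<phi> -` (\<Union>i. A i) \<inter> space M = (\<Union>i. \<phi> -` A i \<inter> space M)" by auto
    moreover have "(\<Union>i. \<phi> -` A i \<inter> space M) \<in> sets M"
      using calculation by (intro sets.countable_UN) auto
    ultimately show "(\<Union>i. A i) \<in> {B. \<phi> -` B \<inter> space M \<in> sets M}"
      by (simp del: vimage_UN)
  qed auto
  then show ?thesis
    unfolding push_algebra_def by (rule sigma_algebra.sets_measure_of_eq)
qed

text \<open>A point of a second countable T1 space is determined by the basic open sets that contain
  it. A sequence is therefore determined by the set of codes of the pairs (n, i) whose n-th term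
  lies in the i-th basic set, and sets of naturals are equinumerous with the reals.\<close>

lemma ex_inj_seq_real:
  "\<exists>\<iota> :: (nat \<Rightarrow> 'e::{second_countable_topology, t1_space}) \<Rightarrow> real. inj \<iota>"
proof -
  obtain \<B> :: "'e set set" where B: "countable \<B>" "topological_basis \<B>"
    using ex_countable_basis by blast
  define U where "U = from_nat_into \<B>"
  have ne: "\<B> \<noteq> {}"
    using topological_basisE[OF B(2) open_UNIV UNIV_I] by blast
  have rU: "range U = \<B>" unfolding U_def using range_from_nat_into[OF ne B(1)] .
  define \<kappa> where "\<kappa> f = {prod_encode (n, i) | n i. f n \<in> U i}" for f :: "nat \<Rightarrow> 'e"
  have "inj \<kappa>"
  proof (rule injI, rule ext, rule ccontr)
    fix f g n assume eq: "\<kappa> f = \<kappa> g" and "f n \<noteq> g n"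
    then obtain O' where "open O'" "f n \<in> O'" "g n \<notin> O'" using t1_space by blast
    then obtain i where i: "f n \<in> U i" "U i \<subseteq> O'"
      using topological_basisE[OF B(2), of O' "f n"] rU by (metis rangeE)
    have "prod_encode (n, i) \<in> \<kappa> f" using i by (auto simp: \<kappa>_def)
    hence "g n \<in> U i" unfolding eq by (auto simp: \<kappa>_def)
    with i \<open>g n \<notin> O'\<close> show False by blast
  qed
  moreover obtain b :: "nat set \<Rightarrow> real" where "bij_betw b UNIV UNIV"
    using nat_sets_eqpoll_reals unfolding eqpoll_def by blast
  ultimately have "inj (b \<circ> \<kappa>)" by (intro inj_compose) (auto simp: bij_betw_def)
  thus ?thesis by blast
qed

text \<open>The defining inequality of M-type 2 only speaks about measures on the reals. A sequence of random
  variables factors through an injection of the (at most continuum sized) sequence space into the reals,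
  and pushing forward the whole \<open>\<sigma>\<close>-algebra keeps every factor measurable.\<close>

lemma M_type_2_martingale:
  assumes "M_type_2 TYPE('e::{banach,second_countable_topology})"
  shows "\<exists>C. \<forall>(P :: 'w measure) H (M :: nat \<Rightarrow> 'w \<Rightarrow> 'e). prob_space P \<longrightarrow>
     (\<forall>n. subalgebra P (H n)) \<longrightarrow> (\<forall>n. sets (H n) \<subseteq> sets (H (Suc n))) \<longrightarrow>
     (\<forall>n. M n \<in> borel_measurable (H n) \<and> integrable P (M n)) \<longrightarrow>
     (\<forall>n. \<forall>B\<in>sets (H n). set_lebesgue_integral P B (M (Suc n)) = set_lebesgue_integral P B (M n)) \<longrightarrow>
     (SUP n. \<integral>\<^sup>+\<omega>. ennreal ((norm (M n \<omega>))\<^sup>2) \<partial>P)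
       \<le> ennreal C * (\<Sum>n. \<integral>\<^sup>+\<omega>. ennreal ((norm (M n \<omega> - (if n = 0 then 0 else M (n - 1) \<omega>)))\<^sup>2) \<partial>P)"
proof -
  obtain C where C: "\<And>R Fn (Mn :: nat \<Rightarrow> real \<Rightarrow> 'e). disc_martingale R Fn Mn \<Longrightarrow>
     (SUP n. \<integral>\<^sup>+\<omega>. ennreal ((norm (Mn n \<omega>))\<^sup>2) \<partial>R)
       \<le> ennreal C * (\<Sum>n. \<integral>\<^sup>+\<omega>. ennreal ((norm (Mn n \<omega> - (if n = 0 then 0 else Mn (n - 1) \<omega>)))\<^sup>2) \<partial>R)"
    using assms unfolding M_type_2_def by blast
  show ?thesis
  proof (intro exI[of _ C] allI impI)
    fix P :: "'w measure" and H and M :: "nat \<Rightarrow> 'w \<Rightarrow> 'e"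
    assume "prob_space P" and sub: "\<forall>n. subalgebra P (H n)" and mono: "\<forall>n. sets (H n) \<subseteq> sets (H (Suc n))"
      and M: "\<forall>n. M n \<in> borel_measurable (H n) \<and> integrable P (M n)"
      and mart: "\<forall>n. \<forall>B\<in>sets (H n). set_lebesgue_integral P B (M (Suc n)) = set_lebesgue_integral P B (M n)"
    interpret prob_space P by fact
    have spH: "space (H n) = space P" and seH: "sets (H n) \<subseteq> sets P" for n
      using sub by (auto simp: subalgebra_def)
    obtain \<iota> :: "(nat \<Rightarrow> 'e) \<Rightarrow> real" where \<iota>: "inj \<iota>" using ex_inj_seq_real by blast
    define \<phi> where "\<phi> \<omega> = \<iota> (\<lambda>n. M n \<omega>)" for \<omega>
    define R where "R = distr P (push_algebra P \<phi>) \<phi>"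
    \<comment> \<open>\<open>f n\<close> is \<open>M n\<close> read through a chosen preimage. The
      choice is harmless: two outcomes with the same \<open>\<phi>\<close> share the values of every
      \<open>M n\<close>, because \<open>\<iota>\<close> is injective.\<close>
    define f where "f n x = M n (inv_into (space P) \<phi> x)" for n x
    have f\<phi>: "f n (\<phi> \<omega>) = M n \<omega>" if "\<omega> \<in> space P" for n \<omega>
    proof -
      have "\<phi> (inv_into (space P) \<phi> (\<phi> \<omega>)) = \<phi> \<omega>" using that by (simp add: f_inv_into_f)
      hence "(\<lambda>n. M n (inv_into (space P) \<phi> (\<phi> \<omega>))) = (\<lambda>n. M n \<omega>)"
        using injD[OF \<iota>] by (auto simp: \<phi>_def)
      thus ?thesis unfolding f_def by meson
    qed
    have \<phi>[measurable]: "\<phi> \<in> measurable P (push_algebra P \<phi>)"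
      by (auto simp: measurable_def sets_push_algebra)
    \<comment> \<open>Membership in a final sigma-algebra is a statement about preimages under
      \<open>\<phi>\<close>, and those of the sets in question are just preimages under
      \<open>M n\<close>.\<close>
    have fH: "f n \<in> borel_measurable (push_algebra (H n) \<phi>)" for n
    proof (rule measurableI)
      fix A :: "'e set" assume "A \<in> sets borel"
      moreover have "\<phi> -` (f n -` A) \<inter> space (H n) = M n -` A \<inter> space (H n)"
        using f\<phi> by (auto simp: spH)
      ultimately show "f n -` A \<inter> space (push_algebra (H n) \<phi>) \<in> sets (push_algebra (H n) \<phi>)"
        using M by (auto simp: sets_push_algebra intro: measurable_sets)
    qed auto
    have subP: "sets (push_algebra (H n) \<phi>) \<subseteq> sets (push_algebra P \<phi>)" for n
      using seH[of n] by (auto simp: sets_push_algebra spH)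
    have f[measurable]: "f n \<in> borel_measurable (push_algebra P \<phi>)" for n
      using fH[of n] by (rule measurable_mono[THEN subsetD, rotated -1]) (use subP in auto)
    have MP: "integrable P (M n)" for n using M by blast
    have MmP[measurable]: "M n \<in> borel_measurable P" for n using MP by (rule borel_measurable_integrable)
    have int_eq: "set_lebesgue_integral R B (f n) = set_lebesgue_integral P (\<phi> -` B \<inter> space P) (M n)"
      if [measurable]: "B \<in> sets (push_algebra P \<phi>)" for B n
    proof -
      have "set_lebesgue_integral R B (f n) = (\<integral>\<omega>. indicator B (\<phi> \<omega>) *\<^sub>R f n (\<phi> \<omega>) \<partial>P)"
        unfolding set_lebesgue_integral_def R_def by (subst integral_distr) measurable
      also have "\<dots> = set_lebesgue_integral P (\<phi> -` B \<inter> space P) (M n)"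
        unfolding set_lebesgue_integral_def
        by (intro Bochner_Integration.integral_cong) (auto simp: f\<phi> split: split_indicator)
      finally show ?thesis .
    qed
    have "disc_martingale R (\<lambda>n. push_algebra (H n) \<phi>) f"
      unfolding disc_martingale_def
    proof (intro conjI allI ballI)
      show "prob_space R" unfolding R_def by (rule prob_space_distr[OF \<phi>])
      show "subalgebra R (push_algebra (H n) \<phi>)" for n
        using subP by (auto simp: subalgebra_def R_def)
      show "sets (push_algebra (H n) \<phi>) \<subseteq> sets (push_algebra (H (Suc n)) \<phi>)" for n
        using mono by (auto simp: sets_push_algebra spH)
      show "f n \<in> borel_measurable (push_algebra (H n) \<phi>)" for n by (rule fH)
      show "integrable R (f n)" for n
        unfolding R_def by (subst integrable_distr_eq) (auto simp: f\<phi> MP cong: Bochner_Integration.integrable_cong)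
      fix n B assume B: "B \<in> sets (push_algebra (H n) \<phi>)"
      hence "\<phi> -` B \<inter> space P \<in> sets (H n)" by (simp add: sets_push_algebra spH)
      moreover have "B \<in> sets (push_algebra P \<phi>)" using B subP by auto
      ultimately show "set_lebesgue_integral R B (f (Suc n)) = set_lebesgue_integral R B (f n)"
        using mart by (simp add: int_eq)
    qed
    from C[OF this]
    have *: "(SUP n. \<integral>\<^sup>+\<omega>. ennreal ((norm (f n \<omega>))\<^sup>2) \<partial>R)
       \<le> ennreal C * (\<Sum>n. \<integral>\<^sup>+\<omega>. ennreal ((norm (f n \<omega> - (if n = 0 then 0 else f (n - 1) \<omega>)))\<^sup>2) \<partial>R)" .
    have 1: "(\<integral>\<^sup>+\<omega>. ennreal ((norm (f n \<omega>))\<^sup>2) \<partial>R) = (\<integral>\<^sup>+\<omega>. ennreal ((norm (M n \<omega>))\<^sup>2) \<partial>P)" for n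
      unfolding R_def by (subst nn_integral_distr) (auto simp: f\<phi> cong: nn_integral_cong)
    have 2: "(\<integral>\<^sup>+\<omega>. ennreal ((norm (f n \<omega> - (if n = 0 then 0 else f (n - 1) \<omega>)))\<^sup>2) \<partial>R)
       = (\<integral>\<^sup>+\<omega>. ennreal ((norm (M n \<omega> - (if n = 0 then 0 else M (n - 1) \<omega>)))\<^sup>2) \<partial>P)" for n
      unfolding R_def by (subst nn_integral_distr) (auto simp: f\<phi> intro!: nn_integral_cong)
    show "(SUP n. \<integral>\<^sup>+\<omega>. ennreal ((norm (M n \<omega>))\<^sup>2) \<partial>P)
       \<le> ennreal C * (\<Sum>n. \<integral>\<^sup>+\<omega>. ennreal ((norm (M n \<omega> - (if n = 0 then 0 else M (n - 1) \<omega>)))\<^sup>2) \<partial>P)"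
      using * unfolding 1 2 .
  qed
qed

text \<open>The form in which M-type 2 is applied: finitely many martingale differences,
  \<open>d n\<close> being known at stage \<open>Suc n\<close> and having zero integral over the
  events of stage \<open>n\<close>. Padded with zeros they give a full martingale whose series of
  squares is a finite sum and whose supremum dominates the total sum.\<close>

lemma M_type_2_increments:
  assumes "M_type_2 TYPE('e::{banach,second_countable_topology})"
  shows "\<exists>C\<ge>0. \<forall>(P :: 'w measure) H (d :: nat \<Rightarrow> 'w \<Rightarrow> 'e) N. prob_space P \<longrightarrow>
     (\<forall>n. subalgebra P (H n)) \<longrightarrow> (\<forall>n. sets (H n) \<subseteq> sets (H (Suc n))) \<longrightarrow>
     (\<forall>n<N. d n \<in> borel_measurable (H (Suc n)) \<and> integrable P (d n)) \<longrightarrow>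
     (\<forall>n<N. \<forall>B\<in>sets (H n). set_lebesgue_integral P B (d n) = 0) \<longrightarrow>
     (\<integral>\<^sup>+\<omega>. ennreal ((norm (\<Sum>k<N. d k \<omega>))\<^sup>2) \<partial>P) \<le> ennreal C * (\<Sum>k<N. \<integral>\<^sup>+\<omega>. ennreal ((norm (d k \<omega>))\<^sup>2) \<partial>P)"
proof -
  from M_type_2_martingale[OF assms] obtain C where C: "\<forall>(P :: 'w measure) H (M :: nat \<Rightarrow> 'w \<Rightarrow> 'e). prob_space P \<longrightarrow>
     (\<forall>n. subalgebra P (H n)) \<longrightarrow> (\<forall>n. sets (H n) \<subseteq> sets (H (Suc n))) \<longrightarrow>
     (\<forall>n. M n \<in> borel_measurable (H n) \<and> integrable P (M n)) \<longrightarrow>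
     (\<forall>n. \<forall>B\<in>sets (H n). set_lebesgue_integral P B (M (Suc n)) = set_lebesgue_integral P B (M n)) \<longrightarrow>
     (SUP n. \<integral>\<^sup>+\<omega>. ennreal ((norm (M n \<omega>))\<^sup>2) \<partial>P)
       \<le> ennreal C * (\<Sum>n. \<integral>\<^sup>+\<omega>. ennreal ((norm (M n \<omega> - (if n = 0 then 0 else M (n - 1) \<omega>)))\<^sup>2) \<partial>P)"
    by (rule exE)
  show ?thesis
  proof (intro exI[of _ "max C 0"] conjI allI impI)
    fix P :: "'w measure" and H and d :: "nat \<Rightarrow> 'w \<Rightarrow> 'e" and N
    assume "prob_space P" and sub: "\<forall>n. subalgebra P (H n)" and mono: "\<forall>n. sets (H n) \<subseteq> sets (H (Suc n))"
      and d: "\<forall>n<N. d n \<in> borel_measurable (H (Suc n)) \<and> integrable P (d n)"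
      and mart: "\<forall>n<N. \<forall>B\<in>sets (H n). set_lebesgue_integral P B (d n) = 0"
    interpret prob_space P by fact
    have spH: "space (H n) = space P" and seH: "sets (H n) \<subseteq> sets P" for n
      using sub by (auto simp: subalgebra_def)
    define e where "e k = (if k < N then d k else (\<lambda>_. 0))" for k
    define M where "M n \<omega> = (\<Sum>k<n. e k \<omega>)" for n \<omega>
    have emeas: "e k \<in> borel_measurable (H n)" if "k < n" for k n
    proof -
      have "sets (H (Suc k)) \<subseteq> sets (H n)" using lift_Suc_mono_le[of "\<lambda>n. sets (H n)"] mono that by (simp add: Suc_leI)
      moreover have "e k \<in> borel_measurable (H (Suc k))" using d by (auto simp: e_def)
      ultimately show ?thesis by (intro measurable_from_subalg[of "H n" "H (Suc k)"]) (auto simp: subalgebra_def spH)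
    qed
    have eint: "integrable P (e k)" for k using d by (auto simp: e_def)
    have eset: "set_lebesgue_integral P B (e k) = 0" if "B \<in> sets (H k)" for B k
      using mart that by (auto simp: e_def set_lebesgue_integral_def)
    have le: "(SUP n. \<integral>\<^sup>+\<omega>. ennreal ((norm (M n \<omega>))\<^sup>2) \<partial>P)
       \<le> ennreal C * (\<Sum>n. \<integral>\<^sup>+\<omega>. ennreal ((norm (M n \<omega> - (if n = 0 then 0 else M (n - 1) \<omega>)))\<^sup>2) \<partial>P)"
    proof (rule C[THEN spec, THEN spec, THEN spec, THEN mp, THEN mp, THEN mp, THEN mp, THEN mp])
      show "\<forall>n. M n \<in> borel_measurable (H n) \<and> integrable P (M n)"
        unfolding M_def using emeas eint by auto
      show "\<forall>n. \<forall>B\<in>sets (H n). set_lebesgue_integral P B (M (Suc n)) = set_lebesgue_integral P B (M n)"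
      proof (intro allI ballI)
        fix n B assume B: "B \<in> sets (H n)"
        hence "B \<in> sets P" using seH by auto
        hence "set_integrable P B (M n)" "set_integrable P B (e n)" unfolding set_integrable_def M_def
          by (auto intro!: integrable_mult_indicator eint Bochner_Integration.integrable_sum)
        hence "set_lebesgue_integral P B (\<lambda>\<omega>. M n \<omega> + e n \<omega>) = set_lebesgue_integral P B (M n) + set_lebesgue_integral P B (e n)"
          by (rule set_integral_add)
        moreover have "M (Suc n) = (\<lambda>\<omega>. M n \<omega> + e n \<omega>)" by (auto simp: M_def)
        ultimately show "set_lebesgue_integral P B (M (Suc n)) = set_lebesgue_integral P B (M n)"
          using eset[OF B] by simp
      qed
    qed fact+
    have "(\<Sum>n. \<integral>\<^sup>+\<omega>. ennreal ((norm (M n \<omega> - (if n = 0 then 0 else M (n - 1) \<omega>)))\<^sup>2) \<partial>P)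
       = (\<Sum>n<Suc N. \<integral>\<^sup>+\<omega>. ennreal ((norm (M n \<omega> - (if n = 0 then 0 else M (n - 1) \<omega>)))\<^sup>2) \<partial>P)"
    proof (rule suminf_finite)
      fix n assume "n \<notin> {..<Suc N}"
      then obtain k where "n = Suc k" "k \<ge> N" by (cases n) auto
      thus "(\<integral>\<^sup>+\<omega>. ennreal ((norm (M n \<omega> - (if n = 0 then 0 else M (n - 1) \<omega>)))\<^sup>2) \<partial>P) = 0"
        by (simp add: M_def e_def)
    qed simp
    \<comment> \<open>Since \<open>M 0\<close> is zero, the term at index 0 vanishes, and the term
      at \<open>Suc n\<close> is the square of \<open>e n\<close>; hence the shift by one.\<close>
    also have "\<dots> = (\<Sum>n<N. \<integral>\<^sup>+\<omega>. ennreal ((norm (e n \<omega>))\<^sup>2) \<partial>P)"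
      by (subst sum.lessThan_Suc_shift) (simp add: M_def)
    also have "\<dots> = (\<Sum>n<N. \<integral>\<^sup>+\<omega>. ennreal ((norm (d n \<omega>))\<^sup>2) \<partial>P)"
      by (intro sum.cong) (auto simp: e_def)
    finally have eq: "(\<Sum>n. \<integral>\<^sup>+\<omega>. ennreal ((norm (M n \<omega> - (if n = 0 then 0 else M (n - 1) \<omega>)))\<^sup>2) \<partial>P)
       = (\<Sum>n<N. \<integral>\<^sup>+\<omega>. ennreal ((norm (d n \<omega>))\<^sup>2) \<partial>P)" .
    have "(\<integral>\<^sup>+\<omega>. ennreal ((norm (\<Sum>k<N. d k \<omega>))\<^sup>2) \<partial>P) = (\<integral>\<^sup>+\<omega>. ennreal ((norm (M N \<omega>))\<^sup>2) \<partial>P)"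
      by (simp add: M_def e_def)
    also have "\<dots> \<le> (SUP n. \<integral>\<^sup>+\<omega>. ennreal ((norm (M n \<omega>))\<^sup>2) \<partial>P)" by (rule SUP_upper) simp
    also note le
    also note eq
    also have "ennreal C * (\<Sum>n<N. \<integral>\<^sup>+\<omega>. ennreal ((norm (d n \<omega>))\<^sup>2) \<partial>P)
        \<le> ennreal (max C 0) * (\<Sum>n<N. \<integral>\<^sup>+\<omega>. ennreal ((norm (d n \<omega>))\<^sup>2) \<partial>P)"
      by (intro mult_right_mono ennreal_leI) auto
    finally show "(\<integral>\<^sup>+\<omega>. ennreal ((norm (\<Sum>k<N. d k \<omega>))\<^sup>2) \<partial>P)
      \<le> ennreal (max C 0) * (\<Sum>k<N. \<integral>\<^sup>+\<omega>. ennreal ((norm (d k \<omega>))\<^sup>2) \<partial>P)" .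
  qed auto
qed

text \<open>A countable partition into sets on which \<open>X\<close> is nearly constant replaces conditional Jensen.\<close>

lemma nn_set_integral_norm_le:
  fixes X Y :: "'w \<Rightarrow> 'e::{banach,second_countable_topology}"
  assumes "finite_measure P" and sub: "subalgebra P H"
    and XH: "X \<in> borel_measurable H" and X: "integrable P X" and Y: "integrable P Y"
    and eq: "\<And>B. B \<in> sets H \<Longrightarrow> set_lebesgue_integral P B X = set_lebesgue_integral P B Y"
    and B: "B \<in> sets H"
  shows "(\<integral>\<^sup>+\<omega>. ennreal (norm (X \<omega>)) * indicator B \<omega> \<partial>P) \<le> (\<integral>\<^sup>+\<omega>. ennreal (norm (Y \<omega>)) * indicator B \<omega> \<partial>P)"
proof (rule ennreal_le_epsilon)
  interpret finite_measure P by fact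
  have spH: "space H = space P" and seH: "sets H \<subseteq> sets P"
    using sub by (auto simp: subalgebra_def)
  note [measurable] = borel_measurable_integrable[OF X] borel_measurable_integrable[OF Y]
  have BP[measurable]: "B \<in> sets P" using B seH by auto
  fix \<epsilon>' :: real assume "\<epsilon>' > 0"
  \<comment> \<open>Two errors of size \<epsilon> have to integrate to at most \<epsilon>', hence
    the halving; the summand 1 guards against a space of measure zero.\<close>
  define \<epsilon> where "\<epsilon> = \<epsilon>' / 2 / (measure P (space P) + 1)"
  have \<epsilon>: "\<epsilon> > 0" using \<open>\<epsilon>' > 0\<close> by (simp add: \<epsilon>_def add_nonneg_pos)
  obtain D :: "'e set" where D: "countable D" "\<And>U. open U \<Longrightarrow> U \<noteq> {} \<Longrightarrow> \<exists>d\<in>D. d \<in> U"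
    using countable_dense_setE by metis
  have "D \<noteq> {}" using D(2)[of UNIV] by auto
  define e where "e = from_nat_into D"
  have re: "range e = D" unfolding e_def using range_from_nat_into[OF \<open>D \<noteq> {}\<close> D(1)] .
  define C where "C i = X -` ball (e i) \<epsilon> \<inter> space H" for i
  define Bi where "Bi i = B \<inter> disjointed C i" for i
  have "range C \<subseteq> sets H" unfolding C_def using XH by (auto intro!: measurable_sets)
  hence BiH: "Bi i \<in> sets H" for i
    unfolding Bi_def using sets.range_disjointed_sets[of C H] B by auto
  hence BiP[measurable]: "Bi i \<in> sets P" for i using seH by auto
  have "(\<Union>i. C i) = space H"
  proof -
    have "\<exists>i. \<omega> \<in> C i" if "\<omega> \<in> space H" for \<omega>
    proof -
      obtain d where "d \<in> D" "d \<in> ball (X \<omega>) \<epsilon>" using D(2)[of "ball (X \<omega>) \<epsilon>"] \<epsilon> by auto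
      then obtain i where "e i \<in> ball (X \<omega>) \<epsilon>" using re by (metis rangeE)
      thus ?thesis using that by (auto simp: C_def dist_commute)
    qed
    thus ?thesis by (auto simp: C_def)
  qed
  hence UBi: "(\<Union>i. Bi i) = B"
    using sets.sets_into_space[OF B] by (auto simp: Bi_def UN_disjointed_eq simp flip: Int_UN_distrib)
  have disj: "disjoint_family Bi"
    using disjoint_family_disjointed[of C] by (auto simp: disjoint_family_on_def Bi_def)
  have close: "norm (X \<omega> - e i) \<le> \<epsilon>" if "\<omega> \<in> Bi i" for \<omega> i
    using that disjointed_subset[of C i] by (auto simp: Bi_def C_def dist_norm norm_minus_commute)
  \<comment> \<open>On a piece \<open>X\<close> is within \<epsilon> of the constant
    \<open>e i\<close>, so the integral of its norm is nearly the norm of its integral. That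
    integral equals the one of \<open>Y\<close>, because the piece belongs to \<open>H\<close>.
    Entering and leaving the constant each costs \<epsilon> times the measure of the piece.\<close>
  have piece: "(\<integral>\<omega>. indicator (Bi i) \<omega> * norm (X \<omega>) \<partial>P)
      \<le> (\<integral>\<omega>. indicator (Bi i) \<omega> * (norm (Y \<omega>) + 2 * \<epsilon>) \<partial>P)" for i
  proof -
    define p where "p = measure P (Bi i)"
    have ind: "integrable P (indicator (Bi i) :: 'w \<Rightarrow> real)"
      by (rule integrable_real_indicator) (auto simp: less_top[symmetric])
    have p: "(\<integral>\<omega>. indicator (Bi i) \<omega> * r \<partial>P) = p * r" "integrable P (\<lambda>\<omega>. indicator (Bi i) \<omega> * r)" for r :: real
      using ind by (simp_all add: p_def)
    have iX: "integrable P (\<lambda>\<omega>. indicator (Bi i) \<omega> * norm (X \<omega>))"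
      using integrable_mult_indicator[OF BiP integrable_norm[OF X]] by simp
    have iY: "integrable P (\<lambda>\<omega>. indicator (Bi i) \<omega> * norm (Y \<omega>))"
      using integrable_mult_indicator[OF BiP integrable_norm[OF Y]] by simp
    have iXv: "integrable P (\<lambda>\<omega>. indicator (Bi i) \<omega> *\<^sub>R X \<omega>)"
      by (rule integrable_mult_indicator[OF BiP X])
    have ie: "integrable P (\<lambda>\<omega>. indicator (Bi i) \<omega> *\<^sub>R e i)" using ind by simp
    have "(\<integral>\<omega>. indicator (Bi i) \<omega> * norm (X \<omega>) \<partial>P) \<le> (\<integral>\<omega>. indicator (Bi i) \<omega> * (norm (e i) + \<epsilon>) \<partial>P)"
    proof (rule integral_mono[OF iX p(2)])
      fix \<omega> show "indicator (Bi i) \<omega> * norm (X \<omega>) \<le> indicator (Bi i) \<omega> * (norm (e i) + \<epsilon>)"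
        using close[of \<omega> i] norm_triangle_sub[of "X \<omega>" "e i"] by (auto split: split_indicator)
    qed
    also have "\<dots> = norm (p *\<^sub>R e i) + \<epsilon> * p" unfolding p(1) by (simp add: p_def algebra_simps)
    also have "p *\<^sub>R e i = (\<integral>\<omega>. indicator (Bi i) \<omega> *\<^sub>R X \<omega> \<partial>P) - (\<integral>\<omega>. indicator (Bi i) \<omega> *\<^sub>R X \<omega> - indicator (Bi i) \<omega> *\<^sub>R e i \<partial>P)"
      by (subst Bochner_Integration.integral_diff[OF iXv ie]) (use ind in \<open>simp add: p_def\<close>)
    also have "norm \<dots> \<le> norm (\<integral>\<omega>. indicator (Bi i) \<omega> *\<^sub>R X \<omega> \<partial>P) + norm (\<integral>\<omega>. indicator (Bi i) \<omega> *\<^sub>R X \<omega> - indicator (Bi i) \<omega> *\<^sub>R e i \<partial>P)"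
      by (rule norm_triangle_ineq4)
    also have "norm (\<integral>\<omega>. indicator (Bi i) \<omega> *\<^sub>R X \<omega> - indicator (Bi i) \<omega> *\<^sub>R e i \<partial>P) \<le> (\<integral>\<omega>. indicator (Bi i) \<omega> * \<epsilon> \<partial>P)"
    proof (rule order_trans[OF integral_norm_bound integral_mono])
      show "integrable P (\<lambda>\<omega>. norm (indicator (Bi i) \<omega> *\<^sub>R X \<omega> - indicator (Bi i) \<omega> *\<^sub>R e i))"
        by (intro integrable_norm Bochner_Integration.integrable_diff iXv ie)
      fix \<omega> show "norm (indicator (Bi i) \<omega> *\<^sub>R X \<omega> - indicator (Bi i) \<omega> *\<^sub>R e i) \<le> indicator (Bi i) \<omega> * \<epsilon>"
        using close[of \<omega> i] by (auto split: split_indicator)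
    qed (rule p)
    also have "\<dots> = \<epsilon> * p" unfolding p(1) by simp
    also have "(\<integral>\<omega>. indicator (Bi i) \<omega> *\<^sub>R X \<omega> \<partial>P) = (\<integral>\<omega>. indicator (Bi i) \<omega> *\<^sub>R Y \<omega> \<partial>P)"
      using eq[OF BiH[of i]] by (simp add: set_lebesgue_integral_def)
    also have "norm \<dots> \<le> (\<integral>\<omega>. indicator (Bi i) \<omega> * norm (Y \<omega>) \<partial>P)"
      by (rule order_trans[OF integral_norm_bound]) simp
    finally have "(\<integral>\<omega>. indicator (Bi i) \<omega> * norm (X \<omega>) \<partial>P)
      \<le> (\<integral>\<omega>. indicator (Bi i) \<omega> * norm (Y \<omega>) \<partial>P) + (\<integral>\<omega>. indicator (Bi i) \<omega> * (2 * \<epsilon>) \<partial>P)"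
      unfolding p(1) by (simp add: algebra_simps)
    also have "\<dots> = (\<integral>\<omega>. indicator (Bi i) \<omega> * norm (Y \<omega>) + indicator (Bi i) \<omega> * (2 * \<epsilon>) \<partial>P)"
      by (rule Bochner_Integration.integral_add[OF iY p(2), symmetric])
    finally show ?thesis by (simp add: algebra_simps)
  qed
  \<comment> \<open>With both sides viewed as measures given by densities, countable additivity
    turns the comparison on the pieces into one on \<open>B\<close>.\<close>
  define \<mu> where "\<mu> = density P (\<lambda>\<omega>. ennreal (norm (X \<omega>)))"
  define \<nu> where "\<nu> = density P (\<lambda>\<omega>. ennreal (norm (Y \<omega>) + 2 * \<epsilon>))"
  have le: "emeasure \<mu> (Bi i) \<le> emeasure \<nu> (Bi i)" for i
  proof -
    have "emeasure \<mu> (Bi i) = (\<integral>\<^sup>+\<omega>. ennreal (indicator (Bi i) \<omega> * norm (X \<omega>)) \<partial>P)"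
      unfolding \<mu>_def by (subst emeasure_density) (auto intro!: nn_integral_cong split: split_indicator)
    also have "\<dots> = ennreal (\<integral>\<omega>. indicator (Bi i) \<omega> * norm (X \<omega>) \<partial>P)"
      using integrable_mult_indicator[OF BiP integrable_norm[OF X]] by (intro nn_integral_eq_integral) auto
    also have "\<dots> \<le> ennreal (\<integral>\<omega>. indicator (Bi i) \<omega> * (norm (Y \<omega>) + 2 * \<epsilon>) \<partial>P)"
      by (intro ennreal_leI piece)
    also have "\<dots> = (\<integral>\<^sup>+\<omega>. ennreal (indicator (Bi i) \<omega> * (norm (Y \<omega>) + 2 * \<epsilon>)) \<partial>P)"
      using integrable_mult_indicator[OF BiP Bochner_Integration.integrable_add[OF integrable_norm[OF Y] integrable_const[of "2 * \<epsilon>"]]] \<epsilon>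
      by (intro nn_integral_eq_integral[symmetric]) auto
    also have "\<dots> = emeasure \<nu> (Bi i)"
      unfolding \<nu>_def by (subst emeasure_density) (auto intro!: nn_integral_cong split: split_indicator)
    finally show ?thesis .
  qed
  have "(\<integral>\<^sup>+\<omega>. ennreal (norm (X \<omega>)) * indicator B \<omega> \<partial>P) = emeasure \<mu> (\<Union>i. Bi i)"
    unfolding \<mu>_def UBi by (subst emeasure_density) auto
  also have "\<dots> = (\<Sum>i. emeasure \<mu> (Bi i))"
    by (rule suminf_emeasure[symmetric]) (auto simp: disj \<mu>_def)
  also have "\<dots> \<le> (\<Sum>i. emeasure \<nu> (Bi i))"
    by (intro suminf_le le) auto
  also have "\<dots> = emeasure \<nu> (\<Union>i. Bi i)"
    by (rule suminf_emeasure) (auto simp: disj \<nu>_def)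
  also have "\<dots> = (\<integral>\<^sup>+\<omega>. ennreal (norm (Y \<omega>) + 2 * \<epsilon>) * indicator B \<omega> \<partial>P)"
    unfolding \<nu>_def UBi by (subst emeasure_density) auto
  also have "\<dots> \<le> (\<integral>\<^sup>+\<omega>. ennreal (norm (Y \<omega>)) * indicator B \<omega> + ennreal (2 * \<epsilon>) \<partial>P)"
    using \<epsilon> by (intro nn_integral_mono) (auto split: split_indicator simp: ennreal_plus)
  also have "\<dots> = (\<integral>\<^sup>+\<omega>. ennreal (norm (Y \<omega>)) * indicator B \<omega> \<partial>P) + ennreal (2 * \<epsilon>) * emeasure P (space P)"
    by (subst nn_integral_add) auto
  also have "ennreal (2 * \<epsilon>) * emeasure P (space P) \<le> ennreal \<epsilon>'"
  proof -
    have "2 * \<epsilon> * measure P (space P) \<le> \<epsilon>'"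
    proof -
      have "measure P (space P) + 1 > 0" by (simp add: add_nonneg_pos)
      hence "\<epsilon> * (measure P (space P) + 1) = \<epsilon>' / 2"
        unfolding \<epsilon>_def by (subst nonzero_eq_divide_eq[symmetric]) auto
      hence "2 * \<epsilon> * (measure P (space P) + 1) = \<epsilon>'" unfolding mult.assoc by linarith
      moreover have "2 * \<epsilon> * measure P (space P) \<le> 2 * \<epsilon> * (measure P (space P) + 1)"
        using \<epsilon> by (intro mult_left_mono) auto
      ultimately show ?thesis by simp
    qed
    thus ?thesis using \<epsilon> by (simp add: emeasure_eq_measure ennreal_leI flip: ennreal_mult)
  qed
  finally show "(\<integral>\<^sup>+\<omega>. ennreal (norm (X \<omega>)) * indicator B \<omega> \<partial>P)
      \<le> (\<integral>\<^sup>+\<omega>. ennreal (norm (Y \<omega>)) * indicator B \<omega> \<partial>P) + ennreal \<epsilon>'"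
    by (simp add: add_left_mono)
qed

text \<open>The event is split by the first index at which the norm exceeds \<epsilon>. That this
  index is \<open>n\<close> is an event of \<open>H n\<close>; on it \<epsilon> is below the norm of
  \<open>M n\<close>, which under the integral is bounded by the norm of the terminal value
  \<open>M N\<close>.\<close>

lemma doob_maximal_inequality:
  fixes M :: "nat \<Rightarrow> 'w \<Rightarrow> 'e::{banach,second_countable_topology}"
  assumes "finite_measure P" and sub: "\<And>n. subalgebra P (H n)"
    and mono: "\<And>m n. m \<le> n \<Longrightarrow> sets (H m) \<subseteq> sets (H n)"
    and M: "\<And>n. M n \<in> borel_measurable (H n)" "\<And>n. integrable P (M n)"
    and mart: "\<And>n B. n \<le> N \<Longrightarrow> B \<in> sets (H n) \<Longrightarrow> set_lebesgue_integral P B (M n) = set_lebesgue_integral P B (M N)"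
    and \<epsilon>: "\<epsilon> > 0"
  shows "ennreal \<epsilon> * emeasure P {\<omega>\<in>space P. \<exists>n\<le>N. norm (M n \<omega>) > \<epsilon>} \<le> (\<integral>\<^sup>+\<omega>. ennreal (norm (M N \<omega>)) \<partial>P)"
proof -
  interpret finite_measure P by fact
  have spH: "space (H n) = space P" and seH: "sets (H n) \<subseteq> sets P" for n
    using sub by (auto simp: subalgebra_def)
  note [measurable] = borel_measurable_integrable[OF M(2)]
  define C where "C n = {\<omega>\<in>space P. norm (M n \<omega>) > \<epsilon>}" for n
  have CH: "C n \<in> sets (H n)" for n
  proof -
    have [measurable]: "M n \<in> borel_measurable (H n)" by (rule M)
    have "{\<omega>\<in>space (H n). norm (M n \<omega>) > \<epsilon>} \<in> sets (H n)" by measurable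
    thus ?thesis by (simp add: C_def spH)
  qed
  have DH: "disjointed C n \<in> sets (H n)" for n
    unfolding disjointed_def using CH mono by (auto intro!: sets.Diff sets.finite_UN) (metis CH less_imp_le subsetD)
  hence DP[measurable]: "disjointed C n \<in> sets P" for n using seH by auto
  have disj: "disjoint_family_on (disjointed C) {..N}"
    using disjoint_family_disjointed[of C] by (auto simp: disjoint_family_on_def)
  have Ueq: "{\<omega>\<in>space P. \<exists>n\<le>N. norm (M n \<omega>) > \<epsilon>} = (\<Union>n\<le>N. disjointed C n)"
  proof -
    have "(\<Union>n\<in>{0..<Suc N}. disjointed C n) = (\<Union>n\<in>{0..<Suc N}. C n)" by (rule finite_UN_disjointed_eq)
    thus ?thesis by (auto simp: C_def atLeast0LessThan lessThan_Suc_atMost)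
  qed
  define \<nu> where "\<nu> = density P (\<lambda>\<omega>. ennreal (norm (M N \<omega>)))"
  have "ennreal \<epsilon> * emeasure P (\<Union>n\<le>N. disjointed C n) = (\<Sum>n\<le>N. ennreal \<epsilon> * emeasure P (disjointed C n))"
    by (subst sum_emeasure[symmetric]) (auto simp: disj sum_distrib_left)
  also have "\<dots> \<le> (\<Sum>n\<le>N. emeasure \<nu> (disjointed C n))"
  proof (rule sum_mono)
    fix n assume n: "n \<in> {..N}"
    have "ennreal \<epsilon> * emeasure P (disjointed C n) = (\<integral>\<^sup>+\<omega>. ennreal \<epsilon> * indicator (disjointed C n) \<omega> \<partial>P)"
      by (rule nn_integral_cmult_indicator[symmetric]) simp
    also have "\<dots> \<le> (\<integral>\<^sup>+\<omega>. ennreal (norm (M n \<omega>)) * indicator (disjointed C n) \<omega> \<partial>P)"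
      using disjointed_subset[of C n]
      by (intro nn_integral_mono) (auto split: split_indicator simp: C_def intro!: ennreal_leI)
    also have "\<dots> \<le> (\<integral>\<^sup>+\<omega>. ennreal (norm (M N \<omega>)) * indicator (disjointed C n) \<omega> \<partial>P)"
      using n by (intro nn_set_integral_norm_le[OF \<open>finite_measure P\<close> sub M(1) M(2) M(2) mart DH]) auto
    also have "\<dots> = emeasure \<nu> (disjointed C n)"
      unfolding \<nu>_def by (subst emeasure_density) auto
    finally show "ennreal \<epsilon> * emeasure P (disjointed C n) \<le> emeasure \<nu> (disjointed C n)" .
  qed
  also have "\<dots> = emeasure \<nu> (\<Union>n\<le>N. disjointed C n)"
    by (rule sum_emeasure) (auto simp: \<nu>_def disj)
  also have "\<dots> \<le> emeasure \<nu> (space \<nu>)" by (rule emeasure_space)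
  also have "\<dots> = (\<integral>\<^sup>+\<omega>. ennreal (norm (M N \<omega>)) \<partial>P)"
    unfolding \<nu>_def by (subst emeasure_density) (auto intro!: nn_integral_cong)
  finally show ?thesis unfolding Ueq .
qed

section \<open>Brownian increments and integrals of elementary processes\<close>

locale brownian_basis =
  fixes P :: "'w measure" and Fl :: "real \<Rightarrow> 'w measure" and w :: "real \<Rightarrow> 'w \<Rightarrow> real"
  assumes basis: "usual_basis P Fl" and bm: "brownian_motion P Fl w"
begin

sublocale prob_space P
  using basis unfolding usual_basis_def by blast

lemma subalgebra_Fl: "subalgebra P (Fl t)"
  using basis unfolding usual_basis_def by blast

lemma space_Fl [simp]: "space (Fl t) = space P"
  using subalgebra_Fl by (simp add: subalgebra_def)

lemma sets_Fl: "sets (Fl t) \<subseteq> sets P"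
  using subalgebra_Fl by (simp add: subalgebra_def)

lemma sets_Fl_mono: "s \<le> t \<Longrightarrow> sets (Fl s) \<subseteq> sets (Fl t)"
  using basis unfolding usual_basis_def by blast

lemma measurable_Fl_mono: "f \<in> measurable (Fl s) N \<Longrightarrow> s \<le> t \<Longrightarrow> f \<in> measurable (Fl t) N"
  by (rule measurable_from_subalg[of _ "Fl s"]) (auto simp: subalgebra_def dest: sets_Fl_mono)

lemma measurable_Fl_P: "f \<in> measurable (Fl s) N \<Longrightarrow> f \<in> measurable P N"
  by (rule measurable_from_subalg[OF subalgebra_Fl])

lemma w_measurable: "0 \<le> s \<Longrightarrow> s \<le> t \<Longrightarrow> w s \<in> borel_measurable (Fl t)"
  using bm measurable_Fl_mono[of "w s" s borel t] by (simp add: brownian_motion_def)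

lemma w_measurable_P [measurable]: "0 \<le> t \<Longrightarrow> w t \<in> borel_measurable P"
  using w_measurable[of t t] measurable_Fl_P by blast

lemma w_0: "\<omega> \<in> space P \<Longrightarrow> w 0 \<omega> = 0"
  using bm by (simp add: brownian_motion_def)

lemma w_continuous: "\<omega> \<in> space P \<Longrightarrow> continuous_on {0..} (\<lambda>t. w t \<omega>)"
  using bm by (simp add: brownian_motion_def)

text \<open>\<open>brownian_motion\<close> states independence as a product rule for events. It says
  that the law of the increment under \<open>P\<close> restricted to \<open>B\<close> is
  \<open>emeasure P B\<close> times its law under \<open>P\<close>. Integrating \<open>g\<close>
  against these equal measures treats all nonnegative Borel functions at once.\<close>

lemma nn_integral_increment_indicator:
  assumes st: "0 \<le> s" "s < t" and B: "B \<in> sets (Fl s)" and g: "g \<in> borel_measurable borel"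
  shows "(\<integral>\<^sup>+\<omega>. g (w t \<omega> - w s \<omega>) * indicator B \<omega> \<partial>P) = emeasure P B * (\<integral>\<^sup>+\<omega>. g (w t \<omega> - w s \<omega>) \<partial>P)"
proof -
  have [measurable]: "w t \<in> borel_measurable P" "w s \<in> borel_measurable P" "g \<in> borel_measurable borel" "B \<in> sets P"
    using st g B sets_Fl by auto
  define \<Delta> where "\<Delta> \<omega> = w t \<omega> - w s \<omega>" for \<omega>
  have [measurable]: "\<Delta> \<in> borel_measurable P" unfolding \<Delta>_def by measurable
  have eq: "distr (density P (indicator B)) borel \<Delta> = scale_measure (emeasure P B) (distr P borel \<Delta>)"
  proof (rule measure_eqI)
    fix A :: "real set" assume "A \<in> sets (distr (density P (indicator B)) borel \<Delta>)"
    hence A[measurable]: "A \<in> sets borel" by simp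
    have "emeasure (distr (density P (indicator B)) borel \<Delta>) A = emeasure P (B \<inter> {\<omega>\<in>space P. \<Delta> \<omega> \<in> A})"
    proof -
      have "emeasure (distr (density P (indicator B)) borel \<Delta>) A = (\<integral>\<^sup>+\<omega>. indicator B \<omega> * indicator (\<Delta> -` A \<inter> space P) \<omega> \<partial>P)"
        by (subst emeasure_distr) (auto simp: emeasure_density)
      also have "\<dots> = (\<integral>\<^sup>+\<omega>. indicator (B \<inter> {\<omega>\<in>space P. \<Delta> \<omega> \<in> A}) \<omega> \<partial>P)"
        by (intro nn_integral_cong) (auto split: split_indicator)
      finally show ?thesis by simp
    qed
    also have "\<dots> = emeasure P B * emeasure P {\<omega>\<in>space P. \<Delta> \<omega> \<in> A}"
      using bm st B A unfolding brownian_motion_def \<Delta>_def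
      by (simp add: emeasure_eq_measure ennreal_mult)
    also have "\<dots> = emeasure (scale_measure (emeasure P B) (distr P borel \<Delta>)) A"
      by (simp add: emeasure_distr vimage_def Int_def conj_commute)
    finally show "emeasure (distr (density P (indicator B)) borel \<Delta>) A = emeasure (scale_measure (emeasure P B) (distr P borel \<Delta>)) A" .
  qed simp
  have "(\<integral>\<^sup>+\<omega>. g (\<Delta> \<omega>) * indicator B \<omega> \<partial>P) = (\<integral>\<^sup>+x. g x \<partial>distr (density P (indicator B)) borel \<Delta>)"
    by (simp add: nn_integral_distr nn_integral_density mult.commute)
  also have "\<dots> = emeasure P B * (\<integral>\<^sup>+\<omega>. g (\<Delta> \<omega>) \<partial>P)"
    unfolding eq by (simp add: nn_integral_scale_measure nn_integral_distr)
  finally show ?thesis by (simp add: \<Delta>_def)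
qed

text \<open>The same argument with the roles exchanged: the measure with density g(w t - w s),
  restricted to \<open>Fl s\<close>, is a constant multiple of \<open>P\<close> there, by the case
  of indicators. Integrating \<open>f\<close> against both gives the product.\<close>

lemma nn_integral_increment_mult:
  assumes st: "0 \<le> s" "s < t" and f: "f \<in> borel_measurable (Fl s)" and g: "g \<in> borel_measurable borel"
  shows "(\<integral>\<^sup>+\<omega>. g (w t \<omega> - w s \<omega>) * f \<omega> \<partial>P) = (\<integral>\<^sup>+\<omega>. g (w t \<omega> - w s \<omega>) \<partial>P) * (\<integral>\<^sup>+\<omega>. f \<omega> \<partial>P)"
proof -
  have [measurable]: "w t \<in> borel_measurable P" "w s \<in> borel_measurable P" "g \<in> borel_measurable borel"
    "f \<in> borel_measurable P"
    using st g measurable_Fl_P[OF f] by auto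
  define c where "c = (\<integral>\<^sup>+\<omega>. g (w t \<omega> - w s \<omega>) \<partial>P)"
  define Q where "Q = density P (\<lambda>\<omega>. g (w t \<omega> - w s \<omega>))"
  have subQ: "subalgebra Q (Fl s)" using subalgebra_Fl[of s] by (simp add: Q_def subalgebra_def)
  have "restr_to_subalg Q (Fl s) = scale_measure c (restr_to_subalg P (Fl s))"
  proof (rule measure_eqI)
    show "sets (restr_to_subalg Q (Fl s)) = sets (scale_measure c (restr_to_subalg P (Fl s)))"
      by (simp add: sets_restr_to_subalg[OF subQ] sets_restr_to_subalg[OF subalgebra_Fl])
    fix B assume "B \<in> sets (restr_to_subalg Q (Fl s))"
    hence B: "B \<in> sets (Fl s)" by (simp add: sets_restr_to_subalg[OF subQ])
    hence [measurable]: "B \<in> sets P" using sets_Fl by auto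
    have "emeasure Q B = emeasure P B * c"
      unfolding Q_def c_def by (subst emeasure_density) (auto simp: nn_integral_increment_indicator[OF st B g])
    thus "emeasure (restr_to_subalg Q (Fl s)) B = emeasure (scale_measure c (restr_to_subalg P (Fl s))) B"
      by (simp add: emeasure_restr_to_subalg[OF subQ B] emeasure_restr_to_subalg[OF subalgebra_Fl B] mult.commute)
  qed
  hence "(\<integral>\<^sup>+\<omega>. f \<omega> \<partial>restr_to_subalg Q (Fl s)) = c * (\<integral>\<^sup>+\<omega>. f \<omega> \<partial>restr_to_subalg P (Fl s))"
    using measurable_in_subalg[OF subalgebra_Fl f] by (simp add: nn_integral_scale_measure)
  hence "(\<integral>\<^sup>+\<omega>. f \<omega> \<partial>Q) = c * (\<integral>\<^sup>+\<omega>. f \<omega> \<partial>P)"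
    by (simp add: nn_integral_subalgebra2[OF subQ f] nn_integral_subalgebra2[OF subalgebra_Fl f])
  thus ?thesis by (simp add: Q_def nn_integral_density c_def)
qed

lemma increment_distributed:
  assumes "0 \<le> s" "s < t"
  shows "distributed P lborel (\<lambda>\<omega>. w t \<omega> - w s \<omega>) (normal_density 0 (sqrt (t - s)))"
  using bm assms by (simp add: brownian_motion_def)

text \<open>The normal density is available for \<open>s < t\<close>; the degenerate case is
  included because the cells of a partition cut off at a given time may shrink to a point.\<close>

lemma increment_integrable:
  assumes "0 \<le> s" "s \<le> t"
  shows "integrable P (\<lambda>\<omega>. w t \<omega> - w s \<omega>)" "(\<integral>\<omega>. w t \<omega> - w s \<omega> \<partial>P) = 0"
    "(\<integral>\<^sup>+\<omega>. ennreal ((w t \<omega> - w s \<omega>)\<^sup>2) \<partial>P) = ennreal (t - s)"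
proof -
  have *: "integrable P (\<lambda>\<omega>. w t \<omega> - w s \<omega>) \<and> (\<integral>\<omega>. w t \<omega> - w s \<omega> \<partial>P) = 0 \<and>
    (\<integral>\<^sup>+\<omega>. ennreal ((w t \<omega> - w s \<omega>)\<^sup>2) \<partial>P) = ennreal (t - s)"
  proof (cases "s = t")
    case False
    hence st: "s < t" using assms by simp
    note dst = increment_distributed[OF assms(1) st]
    have \<sigma>: "0 < sqrt (t - s)" using st by simp
    have i1: "integrable P (\<lambda>\<omega>. w t \<omega> - w s \<omega>)"
      by (rule distributed_integrable_var[OF dst]) (use integrable_normal_moment_nz_1[OF \<sigma>] in auto)
    have i2: "integrable P (\<lambda>\<omega>. (w t \<omega> - w s \<omega>)\<^sup>2)"
      using distributed_integrable[OF dst, of "\<lambda>x. x\<^sup>2"] integrable_normal_moment[OF \<sigma>, of 0 2] by simp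
    have "(\<integral>\<omega>. (w t \<omega> - w s \<omega>)\<^sup>2 \<partial>P) = t - s"
      using distributed_integral[OF dst, of "\<lambda>x. x\<^sup>2"] integral_normal_moment_even[OF \<sigma>, of 0 1] st by (simp add: fact_numeral)
    hence "(\<integral>\<^sup>+\<omega>. ennreal ((w t \<omega> - w s \<omega>)\<^sup>2) \<partial>P) = ennreal (t - s)"
      using nn_integral_eq_integral[OF i2] by simp
    moreover have "(\<integral>\<omega>. w t \<omega> - w s \<omega> \<partial>P) = 0"
      using normal_distributed_expectation[OF \<sigma> dst] by simp
    ultimately show ?thesis using i1 by simp
  qed simp
  show "integrable P (\<lambda>\<omega>. w t \<omega> - w s \<omega>)" "(\<integral>\<omega>. w t \<omega> - w s \<omega> \<partial>P) = 0"
    "(\<integral>\<^sup>+\<omega>. ennreal ((w t \<omega> - w s \<omega>)\<^sup>2) \<partial>P) = ennreal (t - s)" using * by auto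
qed

text \<open>Positive and negative part are nonnegative Borel functions of the increment, so both
  integrals over \<open>B\<close> factor. What remains is \<open>measure P B\<close> times the mean,
  which is zero.\<close>

lemma increment_set_integral_zero:
  assumes st: "0 \<le> s" "s \<le> t" and B: "B \<in> sets (Fl s)"
  shows "(\<integral>\<omega>. indicator B \<omega> * (w t \<omega> - w s \<omega>) \<partial>P) = 0"
proof (cases "s = t")
  case False
  hence lt: "s < t" using st by simp
  have BP[measurable]: "B \<in> sets P" using B sets_Fl by auto
  have [measurable]: "w t \<in> borel_measurable P" "w s \<in> borel_measurable P" using st by auto
  define \<Delta> where "\<Delta> \<omega> = w t \<omega> - w s \<omega>" for \<omega>
  have i: "integrable P \<Delta>" "(\<integral>\<omega>. \<Delta> \<omega> \<partial>P) = 0" using increment_integrable[OF st] by (simp_all add: \<Delta>_def[abs_def])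
  have iB: "integrable P (\<lambda>\<omega>. indicator B \<omega> * \<Delta> \<omega>)" using integrable_mult_indicator[OF BP i(1)] by simp
  have "(\<integral>\<^sup>+\<omega>. ennreal (indicator B \<omega> * \<Delta> \<omega>) \<partial>P) = (\<integral>\<^sup>+\<omega>. ennreal (\<Delta> \<omega>) * indicator B \<omega> \<partial>P)"
    by (intro nn_integral_cong) (auto split: split_indicator)
  also have "\<dots> = emeasure P B * (\<integral>\<^sup>+\<omega>. ennreal (\<Delta> \<omega>) \<partial>P)"
    using nn_integral_increment_indicator[OF st(1) lt B, of ennreal] by (simp add: \<Delta>_def)
  finally have p: "(\<integral>\<^sup>+\<omega>. ennreal (indicator B \<omega> * \<Delta> \<omega>) \<partial>P) = emeasure P B * (\<integral>\<^sup>+\<omega>. ennreal (\<Delta> \<omega>) \<partial>P)" .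
  have "(\<integral>\<^sup>+\<omega>. ennreal (- (indicator B \<omega> * \<Delta> \<omega>)) \<partial>P) = (\<integral>\<^sup>+\<omega>. ennreal (- \<Delta> \<omega>) * indicator B \<omega> \<partial>P)"
    by (intro nn_integral_cong) (auto split: split_indicator)
  also have "\<dots> = emeasure P B * (\<integral>\<^sup>+\<omega>. ennreal (- \<Delta> \<omega>) \<partial>P)"
    using nn_integral_increment_indicator[OF st(1) lt B, of "\<lambda>x. ennreal (- x)"] by (simp add: \<Delta>_def)
  finally have m: "(\<integral>\<^sup>+\<omega>. ennreal (- (indicator B \<omega> * \<Delta> \<omega>)) \<partial>P) = emeasure P B * (\<integral>\<^sup>+\<omega>. ennreal (- \<Delta> \<omega>) \<partial>P)" .
  have "(\<integral>\<omega>. indicator B \<omega> * \<Delta> \<omega> \<partial>P) = measure P B * (\<integral>\<omega>. \<Delta> \<omega> \<partial>P)"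
    unfolding real_lebesgue_integral_def[OF i(1)] real_lebesgue_integral_def[OF iB] p m
    by (simp add: enn2real_mult emeasure_eq_measure algebra_simps)
  thus ?thesis using i(2) by (simp add: \<Delta>_def)
qed simp

text \<open>Integrability holds because first moments of independent factors multiply. The mean is
  computed by approximating \<open>Y\<close> with simple functions: for an event of
  \<open>Fl s\<close> it is the scalar case, and dominated convergence with twice the limit as
  majorant does the rest.\<close>

lemma increment_times_adapted:
  fixes Y :: "'w \<Rightarrow> 'e::{banach,second_countable_topology}"
  assumes st: "0 \<le> s" "s \<le> t" and YF: "Y \<in> borel_measurable (Fl s)" and Y: "integrable P Y"
  shows "integrable P (\<lambda>\<omega>. (w t \<omega> - w s \<omega>) *\<^sub>R Y \<omega>)" "(\<integral>\<omega>. (w t \<omega> - w s \<omega>) *\<^sub>R Y \<omega> \<partial>P) = 0"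
proof -
  have wm[measurable]: "w t \<in> borel_measurable P" "w s \<in> borel_measurable P" using st by auto
  have int: "integrable P (\<lambda>\<omega>. (w t \<omega> - w s \<omega>) *\<^sub>R Z \<omega>)"
    if ZF: "Z \<in> borel_measurable (Fl s)" and Z: "integrable P Z" for Z :: "'w \<Rightarrow> 'e"
  proof (cases "s = t")
    case False
    hence lt: "s < t" using st by simp
    note [measurable] = borel_measurable_integrable[OF Z]
    have "(\<integral>\<^sup>+\<omega>. ennreal (norm ((w t \<omega> - w s \<omega>) *\<^sub>R Z \<omega>)) \<partial>P) = (\<integral>\<^sup>+\<omega>. ennreal \<bar>w t \<omega> - w s \<omega>\<bar> * ennreal (norm (Z \<omega>)) \<partial>P)"
      by (simp add: ennreal_mult)
    also have "\<dots> = (\<integral>\<^sup>+\<omega>. ennreal \<bar>w t \<omega> - w s \<omega>\<bar> \<partial>P) * (\<integral>\<^sup>+\<omega>. ennreal (norm (Z \<omega>)) \<partial>P)"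
      using ZF by (intro nn_integral_increment_mult[OF st(1) lt, of _ "\<lambda>x. ennreal \<bar>x\<bar>"]) auto
    also have "\<dots> < \<infinity>"
      using increment_integrable(1)[OF st] Z by (auto simp: integrable_iff_bounded ennreal_mult_less_top)
    finally show ?thesis by (intro integrableI_bounded) auto
  qed simp
  show "integrable P (\<lambda>\<omega>. (w t \<omega> - w s \<omega>) *\<^sub>R Y \<omega>)" by (rule int[OF YF Y])
  have sub: "Z \<in> borel_measurable (Fl s)" "integrable P Z" if "integrable (restr_to_subalg P (Fl s)) Z" for Z :: "'w \<Rightarrow> 'e"
    using measurable_in_subalg'[OF subalgebra_Fl borel_measurable_integrable[OF that]]
      integrable_from_subalg[OF subalgebra_Fl that] by auto
  \<comment> \<open>Restricting \<open>P\<close> to \<open>Fl s\<close> forces the approximating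
    functions of the induction to be measurable with respect to \<open>Fl s\<close>.\<close>
  have "integrable (restr_to_subalg P (Fl s)) Y" by (rule integrable_in_subalg[OF subalgebra_Fl YF Y])
  thus "(\<integral>\<omega>. (w t \<omega> - w s \<omega>) *\<^sub>R Y \<omega> \<partial>P) = 0"
  proof (induction rule: integrable_induct)
    case (base A c)
    hence A: "A \<in> sets (Fl s)" by (simp add: sets_restr_to_subalg[OF subalgebra_Fl])
    hence AP: "A \<in> sets P" using sets_Fl by auto
    have i: "integrable P (\<lambda>\<omega>. indicator A \<omega> * (w t \<omega> - w s \<omega>))"
      using integrable_mult_indicator[OF AP increment_integrable(1)[OF st]] by simp
    have "(\<integral>\<omega>. (indicator A \<omega> * (w t \<omega> - w s \<omega>)) *\<^sub>R c \<partial>P) = 0"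
      using i increment_set_integral_zero[OF st A] by simp
    moreover have "(indicator A \<omega> * (w t \<omega> - w s \<omega>)) *\<^sub>R c = (w t \<omega> - w s \<omega>) *\<^sub>R indicator A \<omega> *\<^sub>R c" for \<omega>
      by simp
    ultimately show ?case by (simp only:)
  next
    case (add f g)
    have "integrable P (\<lambda>\<omega>. (w t \<omega> - w s \<omega>) *\<^sub>R f \<omega>)" "integrable P (\<lambda>\<omega>. (w t \<omega> - w s \<omega>) *\<^sub>R g \<omega>)"
      using int[OF sub[OF add.hyps(1)]] int[OF sub[OF add.hyps(2)]] .
    thus ?case using add.IH by (simp add: scaleR_add_right)
  next
    case (lim f u)
    have uF: "u i \<in> borel_measurable (Fl s)" "integrable P (u i)" and fF: "f \<in> borel_measurable (Fl s)" "integrable P f" for i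
      using sub[OF lim.hyps(1)] sub[OF lim.hyps(4)] .
    have sp: "space (restr_to_subalg P (Fl s)) = space P" by (simp add: space_restr_to_subalg)
    have "(\<lambda>i. \<integral>\<omega>. (w t \<omega> - w s \<omega>) *\<^sub>R u i \<omega> \<partial>P) \<longlonglongrightarrow> (\<integral>\<omega>. (w t \<omega> - w s \<omega>) *\<^sub>R f \<omega> \<partial>P)"
    proof (rule integral_dominated_convergence[where w="\<lambda>\<omega>. 2 * norm ((w t \<omega> - w s \<omega>) *\<^sub>R f \<omega>)"])
      show "integrable P (\<lambda>\<omega>. 2 * norm ((w t \<omega> - w s \<omega>) *\<^sub>R f \<omega>))"
        by (intro integrable_mult_right integrable_norm int fF)
      show "AE \<omega> in P. (\<lambda>i. (w t \<omega> - w s \<omega>) *\<^sub>R u i \<omega>) \<longlonglongrightarrow> (w t \<omega> - w s \<omega>) *\<^sub>R f \<omega>"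
        using lim.hyps(2) by (intro AE_I2 tendsto_intros) (simp add: sp)
      show "AE \<omega> in P. norm ((w t \<omega> - w s \<omega>) *\<^sub>R u i \<omega>) \<le> 2 * norm ((w t \<omega> - w s \<omega>) *\<^sub>R f \<omega>)" for i
      proof (rule AE_I2)
        fix \<omega> assume "\<omega> \<in> space P"
        hence "norm (u i \<omega>) \<le> 2 * norm (f \<omega>)" using lim.hyps(3) by (simp add: sp)
        hence "\<bar>w t \<omega> - w s \<omega>\<bar> * norm (u i \<omega>) \<le> \<bar>w t \<omega> - w s \<omega>\<bar> * (2 * norm (f \<omega>))" by (intro mult_left_mono) auto
        thus "norm ((w t \<omega> - w s \<omega>) *\<^sub>R u i \<omega>) \<le> 2 * norm ((w t \<omega> - w s \<omega>) *\<^sub>R f \<omega>)" by (simp add: ac_simps)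
      qed
    qed (rule borel_measurable_integrable[OF int[OF fF]], rule borel_measurable_integrable[OF int[OF uF]])
    thus ?case unfolding lim.IH by (simp add: LIMSEQ_const_iff)
  qed
qed

end

section \<open>Partitions of an interval and their step functions\<close>

lemma strict_steps_less:
  fixes t :: "nat \<Rightarrow> real"
  assumes "\<forall>k<n. t k < t (Suc k)" "i < j" "j \<le> n"
  shows "t i < t j"
  using assms(2,3)
proof (induction j)
  case (Suc j)
  hence "t j < t (Suc j)" using assms(1) by simp
  moreover have "t i \<le> t j" using Suc by (cases "i = j") auto
  ultimately show ?case by simp
qed simp

lemma strict_steps_le:
  fixes t :: "nat \<Rightarrow> real"
  assumes "\<forall>k<n. t k < t (Suc k)" "i \<le> j" "j \<le> n"
  shows "t i \<le> t j"
  using strict_steps_less[OF assms(1), of i j] assms(2,3) by (cases "i = j") auto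

lemma strict_steps_less_iff:
  fixes t :: "nat \<Rightarrow> real"
  assumes "\<forall>k<n. t k < t (Suc k)" "i \<le> n" "j \<le> n"
  shows "t i < t j \<longleftrightarrow> i < j"
  using strict_steps_less[OF assms(1), of i j] strict_steps_le[OF assms(1), of j i] assms(2,3) by force

lemma step_interval_exists:
  fixes t :: "nat \<Rightarrow> real"
  assumes "t 0 < s" "s \<le> t n"
  shows "\<exists>j<n. s \<in> {t j<..t (Suc j)}"
  using assms(2)
proof (induction n)
  case (Suc n)
  show ?case
  proof (cases "s \<le> t n")
    case True
    then show ?thesis using Suc.IH less_SucI by blast
  next
    case False
    then show ?thesis using Suc.prems by auto
  qed
qed (use assms in simp)

lemma elem_val_eq:
  assumes t: "\<forall>k<n. t k < t (Suc k)" and j: "j < n" and s: "s \<in> {t j<..t (Suc j)}"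
  shows "elem_val n t x s \<omega> = x j \<omega>"
proof -
  have "indicator {t k<..t (Suc k)} s *\<^sub>R x k \<omega> = (if k = j then x j \<omega> else 0)" if "k < n" for k
  proof (cases "k < j")
    case True
    hence "t (Suc k) \<le> t j" using j by (intro strict_steps_le[OF t]) auto
    thus ?thesis using s True by (auto split: split_indicator)
  next
    case False
    show ?thesis
    proof (cases "k = j")
      case True
      then show ?thesis using s by auto
    next
      case 2: False
      hence "t (Suc j) \<le> t k" using False that by (intro strict_steps_le[OF t]) auto
      thus ?thesis using s 2 by (auto split: split_indicator)
    qed
  qed
  thus ?thesis using j by (simp add: elem_val_def)
qed

lemma elem_val_outside:
  assumes t: "\<forall>k<n. t k < t (Suc k)" and s: "s \<le> t 0 \<or> s > t n"
  shows "elem_val n t x s \<omega> = 0"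
  unfolding elem_val_def
proof (rule sum.neutral, rule ballI)
  fix k assume "k \<in> {..<n}"
  hence "t 0 \<le> t k" "t (Suc k) \<le> t n" using strict_steps_le[OF t] by auto
  thus "indicator {t k<..t (Suc k)} s *\<^sub>R x k \<omega> = 0" using s by (auto split: split_indicator)
qed

lemma nn_integral_elem_val:
  fixes x :: "nat \<Rightarrow> 'w \<Rightarrow> 'e::{banach,second_countable_topology}"
  assumes t: "\<forall>k<n. t k < t (Suc k)" "t 0 = 0" "t n = T"
  shows "(\<integral>\<^sup>+s\<in>{0..T}. ennreal ((norm (elem_val n t x s \<omega>))\<^sup>2) \<partial>lborel)
    = (\<Sum>k<n. ennreal (t (Suc k) - t k) * ennreal ((norm (x k \<omega>))\<^sup>2))"
proof -
  have "ennreal ((norm (elem_val n t x s \<omega>))\<^sup>2) * indicator {0..T} s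
      = (\<Sum>k<n. ennreal ((norm (x k \<omega>))\<^sup>2) * indicator {t k<..t (Suc k)} s)" for s
  proof (cases "0 < s \<and> s \<le> T")
    case True
    then obtain j where j: "j < n" "s \<in> {t j<..t (Suc j)}" using step_interval_exists[of t s n] t by auto
    have "s \<notin> {t k<..t (Suc k)}" if k: "k < n" "k \<noteq> j" for k
    proof
      assume "s \<in> {t k<..t (Suc k)}"
      \<comment> \<open>Each cell is labelled by its own index: a point in two cells would give the
        labelled step function two values.\<close>
      from elem_val_eq[OF t(1) k(1) this, of "\<lambda>i _. real i" "()"]
        elem_val_eq[OF t(1) j, of "\<lambda>i _. real i" "()"] show False using k by simp
    qed
    hence "ennreal ((norm (x k \<omega>))\<^sup>2) * indicator {t k<..t (Suc k)} s = (if k = j then ennreal ((norm (x j \<omega>))\<^sup>2) else 0)"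
      if "k < n" for k
      using that j by auto
    thus ?thesis using True j elem_val_eq[OF t(1) j, of x \<omega>] by simp
  next
    case False
    hence "(\<Sum>k<n. ennreal ((norm (x k \<omega>))\<^sup>2) * indicator {t k<..t (Suc k)} s) = 0"
    proof (intro sum.neutral ballI)
      fix k assume "k \<in> {..<n}"
      hence "t 0 \<le> t k" "t (Suc k) \<le> t n" using strict_steps_le[OF t(1)] by auto
      thus "ennreal ((norm (x k \<omega>))\<^sup>2) * indicator {t k<..t (Suc k)} s = 0"
        using False t by (auto split: split_indicator)
    qed
    thus ?thesis using False elem_val_outside[OF t(1), of s x \<omega>] t by (auto split: split_indicator)
  qed
  hence "(\<integral>\<^sup>+s\<in>{0..T}. ennreal ((norm (elem_val n t x s \<omega>))\<^sup>2) \<partial>lborel)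
    = (\<integral>\<^sup>+s. (\<Sum>k<n. ennreal ((norm (x k \<omega>))\<^sup>2) * indicator {t k<..t (Suc k)} s) \<partial>lborel)" by simp
  also have "\<dots> = (\<Sum>k<n. ennreal ((norm (x k \<omega>))\<^sup>2) * emeasure lborel {t k<..t (Suc k)})"
    by (subst nn_integral_sum) (auto simp: nn_integral_cmult_indicator)
  also have "\<dots> = (\<Sum>k<n. ennreal (t (Suc k) - t k) * ennreal ((norm (x k \<omega>))\<^sup>2))"
    using t(1) by (intro sum.cong) (auto simp: mult.commute less_imp_le)
  finally show ?thesis .
qed

section \<open>Elementary second moment estimates\<close>

lemma (in finite_measure) L2_imp_integrable:
  fixes Y :: "'a \<Rightarrow> 'e::{banach,second_countable_topology}"
  assumes [measurable]: "Y \<in> borel_measurable M" and fin: "(\<integral>\<^sup>+\<omega>. ennreal ((norm (Y \<omega>))\<^sup>2) \<partial>M) < \<infinity>"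
  shows "integrable M Y"
proof (rule integrableI_bounded)
  have le: "y \<le> y\<^sup>2 + 1" for y :: real
  proof -
    have "0 \<le> (y - 1/2)\<^sup>2" by simp
    thus ?thesis by (simp add: power2_eq_square algebra_simps)
  qed
  have "(\<integral>\<^sup>+\<omega>. ennreal (norm (Y \<omega>)) \<partial>M) \<le> (\<integral>\<^sup>+\<omega>. ennreal ((norm (Y \<omega>))\<^sup>2) + 1 \<partial>M)"
    using le by (intro nn_integral_mono) (simp add: ennreal_leI flip: ennreal_plus ennreal_1)
  also have "\<dots> = (\<integral>\<^sup>+\<omega>. ennreal ((norm (Y \<omega>))\<^sup>2) \<partial>M) + emeasure M (space M)"
    by (subst nn_integral_add) auto
  also have "\<dots> < \<infinity>" using fin by (simp add: emeasure_eq_measure ennreal_add_eq_top less_top)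
  finally show "(\<integral>\<^sup>+\<omega>. ennreal (norm (Y \<omega>)) \<partial>M) < \<infinity>" .
qed simp

lemma norm_diff_sq_le: "(norm (a - b :: 'e::real_normed_vector))\<^sup>2 \<le> 2 * (norm a)\<^sup>2 + 2 * (norm b)\<^sup>2"
proof -
  have "(norm (a - b))\<^sup>2 \<le> (norm a + norm b)\<^sup>2" by (intro power_mono norm_triangle_ineq4) simp
  also have "\<dots> \<le> 2 * (norm a)\<^sup>2 + 2 * (norm b)\<^sup>2"
    using sum_squares_bound[of "norm a" "norm b"] by (simp add: power2_eq_square algebra_simps)
  finally show ?thesis .
qed

text \<open>Stated for a difference, so that a comparison through an intermediate process, u - v =
  (u - z) - (v - z), uses it directly.\<close>

lemma nn_integral_norm_diff_sq_le:
  fixes f g :: "'a \<Rightarrow> 'e::{banach,second_countable_topology}"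
  assumes [measurable]: "f \<in> borel_measurable M" "g \<in> borel_measurable M"
  shows "(\<integral>\<^sup>+x. ennreal ((norm (f x - g x))\<^sup>2) \<partial>M)
    \<le> 2 * (\<integral>\<^sup>+x. ennreal ((norm (f x))\<^sup>2) \<partial>M) + 2 * (\<integral>\<^sup>+x. ennreal ((norm (g x))\<^sup>2) \<partial>M)"
proof -
  have "(\<integral>\<^sup>+x. ennreal ((norm (f x - g x))\<^sup>2) \<partial>M)
      \<le> (\<integral>\<^sup>+x. 2 * ennreal ((norm (f x))\<^sup>2) + 2 * ennreal ((norm (g x))\<^sup>2) \<partial>M)"
  proof (rule nn_integral_mono)
    fix x
    have "ennreal ((norm (f x - g x))\<^sup>2) \<le> ennreal (2 * (norm (f x))\<^sup>2 + 2 * (norm (g x))\<^sup>2)"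
      by (intro ennreal_leI norm_diff_sq_le)
    thus "ennreal ((norm (f x - g x))\<^sup>2) \<le> 2 * ennreal ((norm (f x))\<^sup>2) + 2 * ennreal ((norm (g x))\<^sup>2)"
      by (simp add: ennreal_plus ennreal_mult)
  qed
  also have "\<dots> = 2 * (\<integral>\<^sup>+x. ennreal ((norm (f x))\<^sup>2) \<partial>M) + 2 * (\<integral>\<^sup>+x. ennreal ((norm (g x))\<^sup>2) \<partial>M)"
    by (simp add: nn_integral_add nn_integral_cmult)
  finally show ?thesis .
qed

section \<open>The Ito inequality for elementary processes and their differences\<close>

context brownian_basis
begin

lemma elementaryD:
  assumes "elementary P Fl T n tk xk"
  shows "tk 0 = 0" "tk n = T" "\<forall>k<n. tk k < tk (Suc k)"
    "k < n \<Longrightarrow> xk k \<in> borel_measurable (Fl (tk k))" "k < n \<Longrightarrow> xk k \<in> borel_measurable P"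
    "k < n \<Longrightarrow> (\<integral>\<^sup>+\<omega>. ennreal ((norm (xk k \<omega>))\<^sup>2) \<partial>P) < \<infinity>" "k < n \<Longrightarrow> integrable P (xk k)"
    "k \<le> n \<Longrightarrow> 0 \<le> tk k"
proof -
  show *: "tk 0 = 0" "tk n = T" "\<forall>k<n. tk k < tk (Suc k)"
    "k < n \<Longrightarrow> xk k \<in> borel_measurable (Fl (tk k))" for k
    using assms by (auto simp: elementary_def)
  show "k < n \<Longrightarrow> xk k \<in> borel_measurable P" using *(4) measurable_Fl_P by blast
  moreover show "k < n \<Longrightarrow> (\<integral>\<^sup>+\<omega>. ennreal ((norm (xk k \<omega>))\<^sup>2) \<partial>P) < \<infinity>"
    using assms by (auto simp: elementary_def)
  ultimately show "k < n \<Longrightarrow> integrable P (xk k)" by (intro L2_imp_integrable)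
  show "k \<le> n \<Longrightarrow> 0 \<le> tk k" using strict_steps_le[OF *(3), of 0 k] *(1) by simp
qed

text \<open>An inequality in place of the Ito isometry. The summands are martingale differences,
  since the increment over a cell is independent of what is known at its left end, and the second
  moment of a summand is at most the cell length times that of the coefficient. The M-type 2 bound
  adds these up with a constant chosen before partition, horizon and time.\<close>

lemma elementary_ito_inequality:
  assumes "M_type_2 TYPE('e::{banach,second_countable_topology})"
  shows "\<exists>C\<ge>0. \<forall>T n tk (xk :: nat \<Rightarrow> 'w \<Rightarrow> 'e) t. elementary P Fl T n tk xk \<longrightarrow> 0 \<le> t \<longrightarrow>
    (\<integral>\<^sup>+\<omega>. ennreal ((norm (elem_int w n tk xk t \<omega>))\<^sup>2) \<partial>P)
      \<le> ennreal C * (\<integral>\<^sup>+\<omega>. (\<integral>\<^sup>+s\<in>{0..T}. ennreal ((norm (elem_val n tk xk s \<omega>))\<^sup>2) \<partial>lborel) \<partial>P)"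
proof -
  obtain C where C0: "C \<ge> 0" and C: "\<forall>(Q :: 'w measure) H (d :: nat \<Rightarrow> 'w \<Rightarrow> 'e) N. prob_space Q \<longrightarrow>
     (\<forall>n. subalgebra Q (H n)) \<longrightarrow> (\<forall>n. sets (H n) \<subseteq> sets (H (Suc n))) \<longrightarrow>
     (\<forall>n<N. d n \<in> borel_measurable (H (Suc n)) \<and> integrable Q (d n)) \<longrightarrow>
     (\<forall>n<N. \<forall>B\<in>sets (H n). set_lebesgue_integral Q B (d n) = 0) \<longrightarrow>
     (\<integral>\<^sup>+\<omega>. ennreal ((norm (\<Sum>k<N. d k \<omega>))\<^sup>2) \<partial>Q) \<le> ennreal C * (\<Sum>k<N. \<integral>\<^sup>+\<omega>. ennreal ((norm (d k \<omega>))\<^sup>2) \<partial>Q)"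
    using M_type_2_increments[OF assms] by (elim exE conjE) (rule that)
  show ?thesis
  proof (intro exI[of _ C] conjI allI impI C0)
    fix T n tk and xk :: "nat \<Rightarrow> 'w \<Rightarrow> 'e" and t :: real
    assume el: "elementary P Fl T n tk xk" and t: "0 \<le> t"
    note el' = elementaryD[OF el]
    \<comment> \<open>The points \<open>tk k\<close> increase only up to index \<open>n\<close>;
      freezing the index there gives a filtration over all naturals.\<close>
    define H where "H k = Fl (tk (min k n))" for k
    define d where "d k \<omega> = (w (min (tk (Suc k)) t) \<omega> - w (min (tk k) t) \<omega>) *\<^sub>R xk k \<omega>" for k \<omega>
    \<comment> \<open>Either the cell begins no later than \<open>t\<close>, and its stopped
      increment still starts at \<open>tk k\<close>, or it contributes nothing.\<close>
    have cases: "(tk k \<le> t \<and> min (tk k) t = tk k \<and> tk k \<le> min (tk (Suc k)) t) \<or>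
       (min (tk (Suc k)) t = min (tk k) t)" if "k < n" for k
      using el'(3) that by (cases "tk k \<le> t") (auto simp: less_imp_le intro: less_imp_le)
    have dint: "integrable P (\<lambda>\<omega>. indicator B \<omega> *\<^sub>R d k \<omega>)" "(\<integral>\<omega>. indicator B \<omega> *\<^sub>R d k \<omega> \<partial>P) = 0"
      if k: "k < n" and B: "B \<in> sets (Fl (tk k))" for k B
    proof -
      have "integrable P (\<lambda>\<omega>. indicator B \<omega> *\<^sub>R d k \<omega>) \<and> (\<integral>\<omega>. indicator B \<omega> *\<^sub>R d k \<omega> \<partial>P) = 0"
        using cases[OF k]
      proof (elim disjE conjE)
        assume "min (tk (Suc k)) t = min (tk k) t"
        thus ?thesis by (simp add: d_def)
      next
        assume 1: "min (tk k) t = tk k" "tk k \<le> min (tk (Suc k)) t"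
        have m: "(\<lambda>\<omega>. indicator B \<omega> *\<^sub>R xk k \<omega>) \<in> borel_measurable (Fl (tk k))"
          using el'(4)[OF k] B by measurable
        have i: "integrable P (\<lambda>\<omega>. indicator B \<omega> *\<^sub>R xk k \<omega>)"
          using el'(7)[OF k] B sets_Fl by (intro integrable_mult_indicator) auto
        have "(\<lambda>\<omega>. indicator B \<omega> *\<^sub>R d k \<omega>) = (\<lambda>\<omega>. (w (min (tk (Suc k)) t) \<omega> - w (tk k) \<omega>) *\<^sub>R (indicator B \<omega> *\<^sub>R xk k \<omega>))"
          by (auto simp: d_def 1)
        thus ?thesis using increment_times_adapted[OF _ 1(2) m i] el'(8)[of k] k by simp
      qed
      thus "integrable P (\<lambda>\<omega>. indicator B \<omega> *\<^sub>R d k \<omega>)" "(\<integral>\<omega>. indicator B \<omega> *\<^sub>R d k \<omega> \<partial>P) = 0" by auto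
    qed
    have dint': "integrable P (d k)" if k: "k < n" for k
    proof -
      have "space P \<in> sets (Fl (tk k))" using sets.top[of "Fl (tk k)"] by simp
      from dint(1)[OF k this] show ?thesis by (simp cong: Bochner_Integration.integrable_cong)
    qed
    have dsq: "(\<integral>\<^sup>+\<omega>. ennreal ((norm (d k \<omega>))\<^sup>2) \<partial>P) \<le> ennreal (tk (Suc k) - tk k) * (\<integral>\<^sup>+\<omega>. ennreal ((norm (xk k \<omega>))\<^sup>2) \<partial>P)"
      if k: "k < n" for k
      using cases[OF k]
    proof (elim disjE conjE)
      assume "min (tk (Suc k)) t = min (tk k) t"
      thus ?thesis by (simp add: d_def)
    next
      assume 1: "min (tk k) t = tk k" "tk k \<le> min (tk (Suc k)) t"
      show ?thesis
      proof (cases "tk k = min (tk (Suc k)) t")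
        case True
        thus ?thesis by (simp add: d_def 1(1))
      next
        case False
        hence lt: "tk k < min (tk (Suc k)) t" by (rule le_neq_trans[OF 1(2)])
        have "(\<integral>\<^sup>+\<omega>. ennreal ((norm (d k \<omega>))\<^sup>2) \<partial>P)
          = (\<integral>\<^sup>+\<omega>. ennreal ((w (min (tk (Suc k)) t) \<omega> - w (tk k) \<omega>)\<^sup>2) * ennreal ((norm (xk k \<omega>))\<^sup>2) \<partial>P)"
          by (simp add: d_def 1(1) power_mult_distrib ennreal_mult)
        also have "\<dots> = (\<integral>\<^sup>+\<omega>. ennreal ((w (min (tk (Suc k)) t) \<omega> - w (tk k) \<omega>)\<^sup>2) \<partial>P) * (\<integral>\<^sup>+\<omega>. ennreal ((norm (xk k \<omega>))\<^sup>2) \<partial>P)"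
          using el'(4)[OF k] el'(8)[of k] k
          by (intro nn_integral_increment_mult[OF _ lt, of _ "\<lambda>x. ennreal (x\<^sup>2)"]) auto
        also have "\<dots> = ennreal (min (tk (Suc k)) t - tk k) * (\<integral>\<^sup>+\<omega>. ennreal ((norm (xk k \<omega>))\<^sup>2) \<partial>P)"
          using increment_integrable(3)[OF _ 1(2)] el'(8)[of k] k by simp
        also have "\<dots> \<le> ennreal (tk (Suc k) - tk k) * (\<integral>\<^sup>+\<omega>. ennreal ((norm (xk k \<omega>))\<^sup>2) \<partial>P)"
          by (intro mult_right_mono ennreal_leI) auto
        finally show ?thesis .
      qed
    qed
    have "(\<integral>\<^sup>+\<omega>. ennreal ((norm (\<Sum>k<n. d k \<omega>))\<^sup>2) \<partial>P) \<le> ennreal C * (\<Sum>k<n. \<integral>\<^sup>+\<omega>. ennreal ((norm (d k \<omega>))\<^sup>2) \<partial>P)"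
    proof (rule C[THEN spec, THEN spec, THEN spec, THEN spec, THEN mp, THEN mp, THEN mp, THEN mp, THEN mp])
      show "prob_space P" by (rule prob_space_axioms)
      show "\<forall>k. subalgebra P (H k)" by (simp add: H_def subalgebra_Fl)
      show "\<forall>k. sets (H k) \<subseteq> sets (H (Suc k))"
        unfolding H_def by (intro allI sets_Fl_mono strict_steps_le[OF el'(3)]) auto
      show "\<forall>k<n. d k \<in> borel_measurable (H (Suc k)) \<and> integrable P (d k)"
      proof (intro allI impI conjI)
        fix k assume k: "k < n"
        show "integrable P (d k)" by (rule dint'[OF k])
        have "tk k \<le> tk (Suc k)" "0 \<le> tk k" "0 \<le> tk (Suc k)" using el'(3,8) k by (auto intro: less_imp_le)
        hence "w (min (tk (Suc k)) t) \<in> borel_measurable (Fl (tk (Suc k)))" "w (min (tk k) t) \<in> borel_measurable (Fl (tk (Suc k)))"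
          "xk k \<in> borel_measurable (Fl (tk (Suc k)))"
          using t measurable_Fl_mono[OF el'(4)[OF k]] by (auto intro!: w_measurable simp: min_le_iff_disj)
        thus "d k \<in> borel_measurable (H (Suc k))" using k unfolding d_def H_def by simp
      qed
      show "\<forall>k<n. \<forall>B\<in>sets (H k). set_lebesgue_integral P B (d k) = 0"
        using dint(2) by (auto simp: H_def set_lebesgue_integral_def)
    qed
    also have "\<dots> \<le> ennreal C * (\<Sum>k<n. ennreal (tk (Suc k) - tk k) * (\<integral>\<^sup>+\<omega>. ennreal ((norm (xk k \<omega>))\<^sup>2) \<partial>P))"
      by (intro mult_left_mono sum_mono dsq) auto
    also have "(\<Sum>k<n. ennreal (tk (Suc k) - tk k) * (\<integral>\<^sup>+\<omega>. ennreal ((norm (xk k \<omega>))\<^sup>2) \<partial>P))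
        = (\<integral>\<^sup>+\<omega>. (\<Sum>k<n. ennreal (tk (Suc k) - tk k) * ennreal ((norm (xk k \<omega>))\<^sup>2)) \<partial>P)"
      using el'(5) by (subst nn_integral_sum) (auto simp: nn_integral_cmult)
    also have "\<dots> = (\<integral>\<^sup>+\<omega>. (\<integral>\<^sup>+s\<in>{0..T}. ennreal ((norm (elem_val n tk xk s \<omega>))\<^sup>2) \<partial>lborel) \<partial>P)"
      by (simp add: nn_integral_elem_val[OF el'(3,1,2)])
    finally show "(\<integral>\<^sup>+\<omega>. ennreal ((norm (elem_int w n tk xk t \<omega>))\<^sup>2) \<partial>P)
      \<le> ennreal C * (\<integral>\<^sup>+\<omega>. (\<integral>\<^sup>+s\<in>{0..T}. ennreal ((norm (elem_val n tk xk s \<omega>))\<^sup>2) \<partial>lborel) \<partial>P)"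
      by (simp add: elem_int_def d_def)
  qed
qed

text \<open>A new cell lies inside one old cell, whose coefficient is known at the old left end and
  so at the new one. The value is read at the right end \<open>\<tau> (Suc i)\<close> because the
  cells are left-open. In the integral, the increments over the new cells inside an old one
  telescope.\<close>

lemma elementary_refine:
  fixes xk :: "nat \<Rightarrow> 'w \<Rightarrow> 'e::{banach,second_countable_topology}"
  assumes el: "elementary P Fl T n tk xk"
    and \<tau>: "\<tau> 0 = 0" "\<tau> m = T" "\<forall>i<m. \<tau> i < \<tau> (Suc i)" and sub: "tk ` {..n} \<subseteq> \<tau> ` {..m}"
  defines "y \<equiv> \<lambda>i. elem_val n tk xk (\<tau> (Suc i))"
  shows "elementary P Fl T m \<tau> y" "elem_val m \<tau> y s \<omega> = elem_val n tk xk s \<omega>"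
    "elem_int w m \<tau> y t \<omega> = elem_int w n tk xk t \<omega>"
proof -
  note el' = elementaryD[OF el]
  define idx where "idx k = (SOME i. i \<le> m \<and> tk k = \<tau> i)" for k
  have idx: "idx k \<le> m" "tk k = \<tau> (idx k)" if "k \<le> n" for k
  proof -
    have "\<exists>i. i \<le> m \<and> tk k = \<tau> i" using sub that by auto
    from someI_ex[OF this] show "idx k \<le> m" "tk k = \<tau> (idx k)" by (auto simp: idx_def)
  qed
  \<comment> \<open>The left end of the old cell containing \<open>\<tau> (Suc i)\<close> is itself
    a new grid point; lying strictly below \<open>\<tau> (Suc i)\<close>, it is at most
    \<open>\<tau> i\<close>.\<close>
  have piece: "\<exists>j<n. \<tau> (Suc i) \<in> {tk j<..tk (Suc j)} \<and> tk j \<le> \<tau> i" if i: "i < m" for i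
  proof -
    have "tk 0 < \<tau> (Suc i)" "\<tau> (Suc i) \<le> tk n"
      using strict_steps_less[OF \<tau>(3), of 0 "Suc i"] strict_steps_le[OF \<tau>(3), of "Suc i" m] i \<tau> el'(1,2) by auto
    then obtain j where j: "j < n" "\<tau> (Suc i) \<in> {tk j<..tk (Suc j)}" using step_interval_exists by blast
    hence "\<tau> (idx j) < \<tau> (Suc i)" using idx[of j] by simp
    hence "idx j \<le> i" using strict_steps_less_iff[OF \<tau>(3), of "idx j" "Suc i"] idx[of j] i j by simp
    hence "tk j \<le> \<tau> i" using strict_steps_le[OF \<tau>(3), of "idx j" i] idx[of j] i j by simp
    thus ?thesis using j by blast
  qed
  show "elementary P Fl T m \<tau> y"
    unfolding elementary_def
  proof (intro conjI allI impI \<tau>(1,2))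
    fix i assume i: "i < m"
    show "\<tau> i < \<tau> (Suc i)" using \<tau>(3) i by blast
    obtain j where j: "j < n" "\<tau> (Suc i) \<in> {tk j<..tk (Suc j)}" "tk j \<le> \<tau> i" using piece[OF i] by blast
    have eq: "y i = xk j" by (rule ext) (simp add: y_def elem_val_eq[OF el'(3) j(1,2)])
    show "y i \<in> borel_measurable (Fl (\<tau> i))" unfolding eq using measurable_Fl_mono[OF el'(4)[OF j(1)] j(3)] .
    show "(\<integral>\<^sup>+\<omega>. ennreal ((norm (y i \<omega>))\<^sup>2) \<partial>P) < \<infinity>" unfolding eq by (rule el'(6)[OF j(1)])
  qed
  show "elem_val m \<tau> y s \<omega> = elem_val n tk xk s \<omega>"
  proof (cases "0 < s \<and> s \<le> T")
    case True
    then obtain i where i: "i < m" "s \<in> {\<tau> i<..\<tau> (Suc i)}" using step_interval_exists[of \<tau> s m] \<tau> by auto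
    obtain j where j: "j < n" "\<tau> (Suc i) \<in> {tk j<..tk (Suc j)}" "tk j \<le> \<tau> i" using piece[OF i(1)] by blast
    have s: "s \<in> {tk j<..tk (Suc j)}" using i j by auto
    show ?thesis unfolding elem_val_eq[OF \<tau>(3) i] elem_val_eq[OF el'(3) j(1) s] y_def
      by (rule elem_val_eq[OF el'(3) j(1,2)])
  next
    case False
    hence out: "s \<le> \<tau> 0 \<or> s > \<tau> m" "s \<le> tk 0 \<or> s > tk n" using \<tau>(1,2) el'(1,2) by auto
    show ?thesis unfolding elem_val_outside[OF \<tau>(3) out(1)] elem_val_outside[OF el'(3) out(2)] ..
  qed
  define \<delta> where "\<delta> i = w (min (\<tau> (Suc i)) t) \<omega> - w (min (\<tau> i) t) \<omega>" for i
  have "elem_int w m \<tau> y t \<omega> = (\<Sum>i<m. \<Sum>k<n. \<delta> i *\<^sub>R indicator {tk k<..tk (Suc k)} (\<tau> (Suc i)) *\<^sub>R xk k \<omega>)"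
    unfolding elem_int_def y_def elem_val_def \<delta>_def scaleR_sum_right ..
  also have "\<dots> = (\<Sum>k<n. (\<Sum>i<m. \<delta> i * indicator {tk k<..tk (Suc k)} (\<tau> (Suc i))) *\<^sub>R xk k \<omega>)"
    unfolding scaleR_sum_left by (subst sum.swap) (simp only: scaleR_scaleR)
  also have "\<dots> = (\<Sum>k<n. (w (min (tk (Suc k)) t) \<omega> - w (min (tk k) t) \<omega>) *\<^sub>R xk k \<omega>)"
  proof (rule sum.cong[OF refl])
    fix k assume "k \<in> {..<n}"
    hence k: "k < n" by simp
    define a b where "a = idx k" and "b = idx (Suc k)"
    have ab: "a \<le> m" "b \<le> m" "tk k = \<tau> a" "tk (Suc k) = \<tau> b" using idx[of k] idx[of "Suc k"] k by (auto simp: a_def b_def)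
    have "\<tau> a < \<tau> b" using el'(3) k ab by metis
    hence "a < b" using strict_steps_less_iff[OF \<tau>(3)] ab by blast
    have "indicator {tk k<..tk (Suc k)} (\<tau> (Suc i)) = (indicator {a..<b} i :: real)" if "i < m" for i
    proof -
      have "\<tau> a < \<tau> (Suc i) \<longleftrightarrow> a < Suc i" "\<tau> b < \<tau> (Suc i) \<longleftrightarrow> b < Suc i"
        using strict_steps_less_iff[OF \<tau>(3)] ab that by auto
      thus ?thesis unfolding ab by (auto split: split_indicator)
    qed
    hence "(\<Sum>i<m. \<delta> i * indicator {tk k<..tk (Suc k)} (\<tau> (Suc i))) = (\<Sum>i<m. \<delta> i * indicator {a..<b} i)"
      by (intro sum.cong) (simp_all del: indicator_simps)
    also have "\<dots> = (\<Sum>i\<in>{..<m} \<inter> {a..<b}. \<delta> i)" 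
      unfolding sum.inter_restrict[OF finite_lessThan] by (intro sum.cong) (auto split: split_indicator)
    also have "{..<m} \<inter> {a..<b} = {a..<b}" using ab by auto
    also have "(\<Sum>i=a..<b. \<delta> i) = w (min (\<tau> b) t) \<omega> - w (min (\<tau> a) t) \<omega>"
      unfolding \<delta>_def using \<open>a < b\<close> by (intro sum_Suc_diff'[of a b "\<lambda>i. w (min (\<tau> i) t) \<omega>"]) simp
    finally show "(\<Sum>i<m. \<delta> i * indicator {tk k<..tk (Suc k)} (\<tau> (Suc i))) *\<^sub>R xk k \<omega> = (w (min (tk (Suc k)) t) \<omega> - w (min (tk k) t) \<omega>) *\<^sub>R xk k \<omega>"
      by (simp add: ab)
  qed
  finally show "elem_int w m \<tau> y t \<omega> = elem_int w n tk xk t \<omega>" by (simp add: elem_int_def)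
qed

text \<open>The Ito inequality concerns a single elementary process, while convergence concerns
  differences. On the union of the two grids the difference is again elementary.\<close>

lemma elementary_common_refinement:
  fixes xk yk :: "nat \<Rightarrow> 'w \<Rightarrow> 'e::{banach,second_countable_topology}"
  assumes el: "elementary P Fl T n tk xk" "elementary P Fl T m uk yk"
  shows "\<exists>N \<tau> z. elementary P Fl T N \<tau> z \<and>
    (\<forall>s \<omega>. elem_val N \<tau> z s \<omega> = elem_val n tk xk s \<omega> - elem_val m uk yk s \<omega>) \<and>
    (\<forall>t \<omega>. elem_int w N \<tau> z t \<omega> = elem_int w n tk xk t \<omega> - elem_int w m uk yk t \<omega>)"
proof -
  note a = elementaryD[OF el(1)] and b = elementaryD[OF el(2)]
  define S where "S = tk ` {..n} \<union> uk ` {..m}"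
  define l where "l = sorted_list_of_set S"
  \<comment> \<open>\<open>N\<close> counts cells: the sorted list has \<open>N + 1\<close> points,
    running from 0 to \<open>T\<close>.\<close>
  define N where "N = length l - 1"
  have fin: "finite S" by (simp add: S_def)
  have l: "set l = S" "sorted_wrt (<) l" using fin by (auto simp: l_def)
  have "0 \<in> S" "T \<in> S" using a(1,2) unfolding S_def by (metis UnCI atMost_iff image_eqI le0 order_refl)+
  have range: "0 \<le> s \<and> s \<le> T" if "s \<in> S" for s
    using that a(8) b(8) strict_steps_le[OF a(3)] strict_steps_le[OF b(3)] a(2) b(2) unfolding S_def by fastforce
  have len: "length l = Suc N" using \<open>0 \<in> S\<close> l(1) by (cases l) (auto simp: N_def)
  have step: "\<forall>i<N. l ! i < l ! Suc i" using l(2) len by (simp add: sorted_wrt_nth_less)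
  have im: "(!) l ` {..N} = S" using l(1) len by (auto simp: set_conv_nth image_def less_Suc_eq_le)
  have l0: "l ! 0 = 0"
  proof -
    obtain i where "i \<le> N" "l ! i = 0" using im \<open>0 \<in> S\<close> by (metis atMost_iff imageE)
    hence "l ! 0 \<le> 0" using strict_steps_le[OF step, of 0 i] by simp
    moreover have "l ! 0 \<in> S" using im by auto
    ultimately show ?thesis using range by force
  qed
  have lN: "l ! N = T"
  proof -
    obtain i where "i \<le> N" "l ! i = T" using im \<open>T \<in> S\<close> by (metis atMost_iff imageE)
    hence "T \<le> l ! N" using strict_steps_le[OF step, of i N] by simp
    moreover have "l ! N \<in> S" using im by auto
    ultimately show ?thesis using range by force
  qed
  have sub: "tk ` {..n} \<subseteq> (!) l ` {..N}" "uk ` {..m} \<subseteq> (!) l ` {..N}" unfolding im S_def by auto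
  note ra = elementary_refine[OF el(1) l0 lN step sub(1)] and rb = elementary_refine[OF el(2) l0 lN step sub(2)]
  define x' where "x' i = elem_val n tk xk (l ! Suc i)" for i
  define y' where "y' i = elem_val m uk yk (l ! Suc i)" for i
  define z where "z i \<omega> = x' i \<omega> - y' i \<omega>" for i \<omega>
  note ra' = ra[folded x'_def] and rb' = rb[folded y'_def]
  have "elementary P Fl T N ((!) l) z"
    unfolding elementary_def
  proof (intro conjI allI impI l0 lN)
    fix k assume k: "k < N"
    show "l ! k < l ! Suc k" using step k by blast
    show "z k \<in> borel_measurable (Fl (l ! k))"
      unfolding z_def using elementaryD(4)[OF ra'(1) k] elementaryD(4)[OF rb'(1) k] by measurable
    have "(\<integral>\<^sup>+\<omega>. ennreal ((norm (z k \<omega>))\<^sup>2) \<partial>P) \<le> 2 * (\<integral>\<^sup>+\<omega>. ennreal ((norm (x' k \<omega>))\<^sup>2) \<partial>P) + 2 * (\<integral>\<^sup>+\<omega>. ennreal ((norm (y' k \<omega>))\<^sup>2) \<partial>P)"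
      unfolding z_def using elementaryD(5)[OF ra'(1) k] elementaryD(5)[OF rb'(1) k] by (rule nn_integral_norm_diff_sq_le)
    also have "\<dots> < \<infinity>" using elementaryD(6)[OF ra'(1) k] elementaryD(6)[OF rb'(1) k]
      by (simp add: ennreal_mult_less_top ennreal_add_eq_top less_top)
    finally show "(\<integral>\<^sup>+\<omega>. ennreal ((norm (z k \<omega>))\<^sup>2) \<partial>P) < \<infinity>" .
  qed
  moreover have "elem_val N ((!) l) z s \<omega> = elem_val n tk xk s \<omega> - elem_val m uk yk s \<omega>" for s \<omega>
    unfolding ra'(2)[symmetric] rb'(2)[symmetric]
    by (simp add: elem_val_def z_def scaleR_diff_right sum_subtractf)
  moreover have "elem_int w N ((!) l) z t \<omega> = elem_int w n tk xk t \<omega> - elem_int w m uk yk t \<omega>" for t \<omega>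
    unfolding ra'(3)[symmetric] rb'(3)[symmetric]
    by (simp add: elem_int_def z_def scaleR_diff_right sum_subtractf)
  ultimately show ?thesis by blast
qed

text \<open>The Ito inequality for differences as a property of its constant, so that one
  \<open>C\<close>, valid for every pair of partitions, horizon and time, can be carried through
  later limits.\<close>

definition ito_bound :: "'e::{banach,second_countable_topology} itself \<Rightarrow> real \<Rightarrow> bool" where
  "ito_bound (_ :: 'e itself) C \<longleftrightarrow> C \<ge> 0 \<and> (\<forall>T n tk (xk :: nat \<Rightarrow> 'w \<Rightarrow> 'e) m uk (yk :: nat \<Rightarrow> 'w \<Rightarrow> 'e) t.
    elementary P Fl T n tk xk \<longrightarrow> elementary P Fl T m uk yk \<longrightarrow> 0 \<le> t \<longrightarrow>
    (\<integral>\<^sup>+\<omega>. ennreal ((norm (elem_int w n tk xk t \<omega> - elem_int w m uk yk t \<omega>))\<^sup>2) \<partial>P)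
      \<le> ennreal C * (\<integral>\<^sup>+\<omega>. (\<integral>\<^sup>+s\<in>{0..T}. ennreal ((norm (elem_val n tk xk s \<omega> - elem_val m uk yk s \<omega>))\<^sup>2) \<partial>lborel) \<partial>P))"

lemma ito_bound_exists:
  assumes "M_type_2 TYPE('e::{banach,second_countable_topology})"
  shows "\<exists>C. ito_bound TYPE('e) C"
proof -
  obtain C where C: "C \<ge> 0" "\<forall>T n tk (xk :: nat \<Rightarrow> 'w \<Rightarrow> 'e) t. elementary P Fl T n tk xk \<longrightarrow> 0 \<le> t \<longrightarrow>
    (\<integral>\<^sup>+\<omega>. ennreal ((norm (elem_int w n tk xk t \<omega>))\<^sup>2) \<partial>P)
      \<le> ennreal C * (\<integral>\<^sup>+\<omega>. (\<integral>\<^sup>+s\<in>{0..T}. ennreal ((norm (elem_val n tk xk s \<omega>))\<^sup>2) \<partial>lborel) \<partial>P)"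
    using elementary_ito_inequality[OF assms] by (elim exE conjE) (rule that)
  have "ito_bound TYPE('e) C"
    unfolding ito_bound_def
  proof (intro conjI C(1) allI impI)
    fix T n tk and xk :: "nat \<Rightarrow> 'w \<Rightarrow> 'e" and m uk and yk :: "nat \<Rightarrow> 'w \<Rightarrow> 'e" and t :: real
    assume "elementary P Fl T n tk xk" "elementary P Fl T m uk yk" and t: "0 \<le> t"
    from elementary_common_refinement[OF this(1,2)] obtain N \<tau> z where z: "elementary P Fl T N \<tau> z"
      "\<And>s \<omega>. elem_val N \<tau> z s \<omega> = elem_val n tk xk s \<omega> - elem_val m uk yk s \<omega>"
      "\<And>t \<omega>. elem_int w N \<tau> z t \<omega> = elem_int w n tk xk t \<omega> - elem_int w m uk yk t \<omega>" by blast
    from C(2)[rule_format, OF z(1) t]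
    show "(\<integral>\<^sup>+\<omega>. ennreal ((norm (elem_int w n tk xk t \<omega> - elem_int w m uk yk t \<omega>))\<^sup>2) \<partial>P)
      \<le> ennreal C * (\<integral>\<^sup>+\<omega>. (\<integral>\<^sup>+s\<in>{0..T}. ennreal ((norm (elem_val n tk xk s \<omega> - elem_val m uk yk s \<omega>))\<^sup>2) \<partial>lborel) \<partial>P)"
      by (simp only: z(2,3))
  qed
  thus ?thesis by blast
qed

lemma ito_boundD:
  fixes xk yk :: "nat \<Rightarrow> 'w \<Rightarrow> 'e::{banach,second_countable_topology}"
  assumes "ito_bound TYPE('e) C" "elementary P Fl T n tk xk" "elementary P Fl T m uk yk" "0 \<le> t"
  shows "(\<integral>\<^sup>+\<omega>. ennreal ((norm (elem_int w n tk xk t \<omega> - elem_int w m uk yk t \<omega>))\<^sup>2) \<partial>P)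
      \<le> ennreal C * (\<integral>\<^sup>+\<omega>. (\<integral>\<^sup>+s\<in>{0..T}. ennreal ((norm (elem_val n tk xk s \<omega> - elem_val m uk yk s \<omega>))\<^sup>2) \<partial>lborel) \<partial>P)"
  using assms(1)[unfolded ito_bound_def, THEN conjunct2, rule_format, OF assms(2-4)] .

end

section \<open>Density of dyadic step functions\<close>

text \<open>Lebesgue measure of the interval as a measure on the whole line: integrands stay Borel
  functions on the line, and estimates for arbitrary measures specialise to [0,T].\<close>

definition lborel_Icc :: "real \<Rightarrow> real measure" where
  "lborel_Icc T = density lborel (indicator {0..T})"

lemma sets_lborel_Icc [measurable_cong, simp]: "sets (lborel_Icc T) = sets borel"
  by (simp add: lborel_Icc_def)

lemma space_lborel_Icc [simp]: "space (lborel_Icc T) = UNIV"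
  by (simp add: lborel_Icc_def)

lemma nn_integral_lborel_Icc:
  assumes "f \<in> borel_measurable borel"
  shows "(\<integral>\<^sup>+s. f s \<partial>lborel_Icc T) = (\<integral>\<^sup>+s\<in>{0..T}. f s \<partial>lborel)"
  using assms unfolding lborel_Icc_def by (subst nn_integral_density) (auto simp: mult.commute)

lemma emeasure_lborel_Icc:
  assumes "A \<in> sets borel"
  shows "emeasure (lborel_Icc T) A = emeasure lborel (A \<inter> {0..T})"
proof -
  have "emeasure (lborel_Icc T) A = (\<integral>\<^sup>+s. indicator A s \<partial>lborel_Icc T)" using assms by simp
  also have "\<dots> = (\<integral>\<^sup>+s. indicator (A \<inter> {0..T}) s \<partial>lborel)"
    unfolding nn_integral_lborel_Icc[OF borel_measurable_indicator[OF assms]]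
    by (rule nn_integral_cong) (auto split: split_indicator)
  also have "\<dots> = emeasure lborel (A \<inter> {0..T})" using assms by (intro nn_integral_indicator) simp
  finally show ?thesis .
qed

text \<open>The cells are left-open, like those of \<open>elem_val\<close>, so the value on a cell
  is the one at its right end.\<close>

definition dyadic_step :: "real \<Rightarrow> nat \<Rightarrow> (real \<Rightarrow> 'e) \<Rightarrow> bool" where
  "dyadic_step T m f \<longleftrightarrow>
     (\<forall>k<2^m. \<forall>s\<in>{real k * T / 2^m<..real (Suc k) * T / 2^m}. f s = f (real (Suc k) * T / 2^m))"

text \<open>Dyadic cells are nested: cell \<open>k\<close> of the finer grid lies in cell
  \<open>k div 2\<close> of the coarser one. Two step functions can thus be brought to a common
  level.\<close>

lemma dyadic_step_Suc:
  assumes f: "dyadic_step T m f" and T: "T > 0"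
  shows "dyadic_step T (Suc m) f"
  unfolding dyadic_step_def
proof (intro allI impI ballI)
  fix k :: nat and s assume k: "k < 2 ^ Suc m" and s: "s \<in> {real k * T / 2 ^ Suc m<..real (Suc k) * T / 2 ^ Suc m}"
  define j where "j = k div 2"
  have j: "j < 2 ^ m" "2 * j \<le> k" "Suc k \<le> 2 * Suc j" using k by (auto simp: j_def)
  have le: "real j * T / 2 ^ m \<le> real k * T / 2 ^ Suc m" "real (Suc k) * T / 2 ^ Suc m \<le> real (Suc j) * T / 2 ^ m"
  proof -
    have "real (2 * j) * T \<le> real k * T" "real (Suc k) * T \<le> real (2 * Suc j) * T"
      using j T by (auto intro!: mult_right_mono simp del: of_nat_Suc of_nat_mult)
    hence "real (2 * j) * T / 2 ^ Suc m \<le> real k * T / 2 ^ Suc m"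
      "real (Suc k) * T / 2 ^ Suc m \<le> real (2 * Suc j) * T / 2 ^ Suc m"
      by (auto intro!: divide_right_mono simp del: of_nat_Suc of_nat_mult)
    moreover have "real (2 * i) * T / 2 ^ Suc m = real i * T / 2 ^ m" for i by simp
    ultimately show "real j * T / 2 ^ m \<le> real k * T / 2 ^ Suc m" "real (Suc k) * T / 2 ^ Suc m \<le> real (Suc j) * T / 2 ^ m"
      by metis+
  qed
  have "real k * T / 2 ^ Suc m < real (Suc k) * T / 2 ^ Suc m" using T by (simp add: divide_strict_right_mono)
  hence "s \<in> {real j * T / 2^m<..real (Suc j) * T / 2^m}"
    "real (Suc k) * T / 2 ^ Suc m \<in> {real j * T / 2^m<..real (Suc j) * T / 2^m}"
    using s le unfolding greaterThanAtMost_iff by linarith+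
  thus "f s = f (real (Suc k) * T / 2 ^ Suc m)"
    using f j(1) unfolding dyadic_step_def by metis
qed

lemma dyadic_step_mono:
  assumes "dyadic_step T m f" "T > 0" "m \<le> n"
  shows "dyadic_step T n f"
  using assms(3) by (induction n rule: dec_induct) (use assms dyadic_step_Suc in auto)

text \<open>Membership in the L2 closure of the dyadic step functions. With the grid restricted to
  dyadic levels, a sum only has to pass to the finer of two levels.\<close>

definition step_approximable :: "real \<Rightarrow> (real \<Rightarrow> 'e::{banach,second_countable_topology}) \<Rightarrow> bool" where
  "step_approximable T h \<longleftrightarrow> h \<in> borel_measurable borel \<and>
     (\<forall>\<epsilon>>0. \<exists>m f. dyadic_step T m f \<and> f \<in> borel_measurable borel \<and>
        (\<integral>\<^sup>+s. ennreal ((norm (h s - f s))\<^sup>2) \<partial>lborel_Icc T) < ennreal \<epsilon>)"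

lemma step_approximable_step:
  assumes "dyadic_step T m f" "f \<in> borel_measurable borel"
  shows "step_approximable T f"
  unfolding step_approximable_def using assms by (auto intro!: exI[of _ m] exI[of _ f])

text \<open>The class is closed in L2. Each of the two errors is taken below \<epsilon>/4, because
  the squared triangle inequality doubles both.\<close>

lemma step_approximable_limit:
  assumes [measurable]: "h \<in> borel_measurable borel"
    and g: "\<And>\<epsilon>. \<epsilon> > 0 \<Longrightarrow> \<exists>g. step_approximable T g \<and> (\<integral>\<^sup>+s. ennreal ((norm (h s - g s))\<^sup>2) \<partial>lborel_Icc T) < ennreal \<epsilon>"
  shows "step_approximable T h"
  unfolding step_approximable_def
proof (intro conjI allI impI)
  fix \<epsilon> :: real assume "\<epsilon> > 0"
  hence e: "\<epsilon> / 4 > 0" by simp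
  from g[OF e] obtain g where g: "step_approximable T g" "(\<integral>\<^sup>+s. ennreal ((norm (h s - g s))\<^sup>2) \<partial>lborel_Icc T) < ennreal (\<epsilon> / 4)" by blast
  from g(1) e obtain m f where f: "dyadic_step T m f" "f \<in> borel_measurable borel"
    "(\<integral>\<^sup>+s. ennreal ((norm (g s - f s))\<^sup>2) \<partial>lborel_Icc T) < ennreal (\<epsilon> / 4)" unfolding step_approximable_def by blast
  have [measurable]: "f \<in> borel_measurable borel" "g \<in> borel_measurable borel"
    using f g by (auto simp: step_approximable_def)
  have "(\<integral>\<^sup>+s. ennreal ((norm (h s - f s))\<^sup>2) \<partial>lborel_Icc T) = (\<integral>\<^sup>+s. ennreal ((norm ((h s - g s) - (f s - g s)))\<^sup>2) \<partial>lborel_Icc T)" by simp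
  also have "\<dots> \<le> 2 * (\<integral>\<^sup>+s. ennreal ((norm (h s - g s))\<^sup>2) \<partial>lborel_Icc T) + 2 * (\<integral>\<^sup>+s. ennreal ((norm (f s - g s))\<^sup>2) \<partial>lborel_Icc T)"
    by (rule nn_integral_norm_diff_sq_le) simp_all
  also have "\<dots> < 2 * ennreal (\<epsilon> / 4) + 2 * ennreal (\<epsilon> / 4)"
    using f(3) g(2) by (intro add_strict_mono ennreal_mult_strict_left_mono) (auto simp: norm_minus_commute)
  also have "\<dots> = ennreal (2 * (\<epsilon> / 4)) + ennreal (2 * (\<epsilon> / 4))"
    using e by (simp only: ennreal_mult ennreal_numeral zero_le_numeral less_imp_le)
  also have "\<dots> = ennreal \<epsilon>" using e by (simp flip: ennreal_plus)
  finally show "\<exists>m f. dyadic_step T m f \<and> f \<in> borel_measurable borel \<and> (\<integral>\<^sup>+s. ennreal ((norm (h s - f s))\<^sup>2) \<partial>lborel_Icc T) < ennreal \<epsilon>"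
    using f(1,2) by blast
qed simp

lemma step_approximable_add:
  assumes T: "T > 0" and h: "step_approximable T h" "step_approximable T g"
  shows "step_approximable T (\<lambda>s. h s + g s)"
  unfolding step_approximable_def
proof (intro conjI allI impI)
  have [measurable]: "h \<in> borel_measurable borel" "g \<in> borel_measurable borel"
    using h by (auto simp: step_approximable_def)
  show "(\<lambda>s. h s + g s) \<in> borel_measurable borel" by measurable
  fix \<epsilon> :: real assume "\<epsilon> > 0"
  hence e: "\<epsilon> / 4 > 0" by simp
  from h(1) e obtain m f where f: "dyadic_step T m f" "f \<in> borel_measurable borel"
    "(\<integral>\<^sup>+s. ennreal ((norm (h s - f s))\<^sup>2) \<partial>lborel_Icc T) < ennreal (\<epsilon> / 4)" unfolding step_approximable_def by blast
  from h(2) e obtain n u where u: "dyadic_step T n u" "u \<in> borel_measurable borel"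
    "(\<integral>\<^sup>+s. ennreal ((norm (g s - u s))\<^sup>2) \<partial>lborel_Icc T) < ennreal (\<epsilon> / 4)" unfolding step_approximable_def by blast
  note [measurable] = f(2) u(2)
  have "dyadic_step T (max m n) f" "dyadic_step T (max m n) u"
    using f u by (auto intro: dyadic_step_mono[OF _ T])
  hence st: "dyadic_step T (max m n) (\<lambda>s. f s + u s)" unfolding dyadic_step_def by metis
  have "(\<integral>\<^sup>+s. ennreal ((norm (h s + g s - (f s + u s)))\<^sup>2) \<partial>lborel_Icc T) = (\<integral>\<^sup>+s. ennreal ((norm ((h s - f s) - (u s - g s)))\<^sup>2) \<partial>lborel_Icc T)"
    by (simp add: algebra_simps)
  also have "\<dots> \<le> 2 * (\<integral>\<^sup>+s. ennreal ((norm (h s - f s))\<^sup>2) \<partial>lborel_Icc T) + 2 * (\<integral>\<^sup>+s. ennreal ((norm (u s - g s))\<^sup>2) \<partial>lborel_Icc T)"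
    by (rule nn_integral_norm_diff_sq_le) simp_all
  also have "\<dots> < 2 * ennreal (\<epsilon> / 4) + 2 * ennreal (\<epsilon> / 4)"
    using f(3) u(3) by (intro add_strict_mono ennreal_mult_strict_left_mono) (auto simp: norm_minus_commute)
  also have "\<dots> = ennreal (2 * (\<epsilon> / 4)) + ennreal (2 * (\<epsilon> / 4))"
    using e by (simp only: ennreal_mult ennreal_numeral zero_le_numeral less_imp_le)
  also have "\<dots> = ennreal \<epsilon>" using e by (simp flip: ennreal_plus)
  finally show "\<exists>m f. dyadic_step T m f \<and> f \<in> borel_measurable borel \<and> (\<integral>\<^sup>+s. ennreal ((norm (h s + g s - f s))\<^sup>2) \<partial>lborel_Icc T) < ennreal \<epsilon>"
    using st by (intro exI[of _ "max m n"] exI[of _ "\<lambda>s. f s + u s"]) auto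
qed

lemma step_approximable_scaleR_const:
  fixes h :: "real \<Rightarrow> real" and c :: "'e::{banach,second_countable_topology}"
  assumes h: "step_approximable T h"
  shows "step_approximable T (\<lambda>s. h s *\<^sub>R c)"
  unfolding step_approximable_def
proof (intro conjI allI impI)
  have [measurable]: "h \<in> borel_measurable borel" using h by (auto simp: step_approximable_def)
  show "(\<lambda>s. h s *\<^sub>R c) \<in> borel_measurable borel" by measurable
  fix \<epsilon> :: real assume \<epsilon>: "\<epsilon> > 0"
  define K where "K = (norm c)\<^sup>2 + 1"
  have K: "K > 0" "(norm c)\<^sup>2 \<le> K" by (auto simp: K_def add_nonneg_pos)
  have "\<epsilon> / K > 0" using \<epsilon> K by simp
  with h obtain m f where f: "dyadic_step T m f" "f \<in> borel_measurable borel"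
    "(\<integral>\<^sup>+s. ennreal ((norm (h s - f s))\<^sup>2) \<partial>lborel_Icc T) < ennreal (\<epsilon> / K)" unfolding step_approximable_def by blast
  note [measurable] = f(2)
  have st: "dyadic_step T m (\<lambda>s. f s *\<^sub>R c)" using f(1) unfolding dyadic_step_def by metis
  have "(\<integral>\<^sup>+s. ennreal ((norm (h s *\<^sub>R c - f s *\<^sub>R c))\<^sup>2) \<partial>lborel_Icc T) \<le> (\<integral>\<^sup>+s. ennreal K * ennreal ((norm (h s - f s))\<^sup>2) \<partial>lborel_Icc T)"
  proof (rule nn_integral_mono)
    fix s
    have "(norm (h s *\<^sub>R c - f s *\<^sub>R c))\<^sup>2 = (norm c)\<^sup>2 * (norm (h s - f s))\<^sup>2"
      by (simp add: power_mult_distrib flip: scaleR_diff_left)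
    also have "\<dots> \<le> K * (norm (h s - f s))\<^sup>2" using K by (intro mult_right_mono) auto
    finally show "ennreal ((norm (h s *\<^sub>R c - f s *\<^sub>R c))\<^sup>2) \<le> ennreal K * ennreal ((norm (h s - f s))\<^sup>2)"
      using K by (simp add: ennreal_leI flip: ennreal_mult)
  qed
  also have "\<dots> = ennreal K * (\<integral>\<^sup>+s. ennreal ((norm (h s - f s))\<^sup>2) \<partial>lborel_Icc T)"
    by (rule nn_integral_cmult) simp
  also have "\<dots> < ennreal K * ennreal (\<epsilon> / K)"
    using f(3) K by (intro ennreal_mult_strict_left_mono) auto
  also have "\<dots> = ennreal \<epsilon>" using K \<epsilon> by (simp flip: ennreal_mult)
  finally show "\<exists>m f. dyadic_step T m f \<and> f \<in> borel_measurable borel \<and> (\<integral>\<^sup>+s. ennreal ((norm (h s *\<^sub>R c - f s))\<^sup>2) \<partial>lborel_Icc T) < ennreal \<epsilon>"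
    using st by (intro exI[of _ m] exI[of _ "\<lambda>s. f s *\<^sub>R c"]) auto
qed

lemma step_approximable_sum:
  assumes T: "T > 0" and "finite I" "\<And>i. i \<in> I \<Longrightarrow> step_approximable T (h i)"
  shows "step_approximable T (\<lambda>s. \<Sum>i\<in>I. h i s)"
  using assms(2,3)
proof (induction I rule: finite_induct)
  case empty
  then show ?case by (simp, intro step_approximable_step[of _ 0]) (auto simp: dyadic_step_def)
next
  case (insert i I)
  then show ?case by (simp add: step_approximable_add[OF T])
qed

text \<open>The end point \<open>a\<close> is rounded down to a grid point \<open>b\<close>. The set
  {..b} respects the left-open cells, and the two indicators differ at most on an interval of length
  T/2^m.\<close>

lemma step_approximable_lessThan:
  assumes T: "T > 0"
  shows "step_approximable T (indicator {..<a} :: real \<Rightarrow> real)"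
proof (rule step_approximable_limit)
  fix \<epsilon> :: real assume \<epsilon>: "\<epsilon> > 0"
  obtain m where m: "T / \<epsilon> < 2 ^ m" using real_arch_pow[of 2 "T / \<epsilon>"] by auto
  define b where "b = of_int \<lfloor>a * 2 ^ m / T\<rfloor> * T / 2 ^ m"
  have fl: "of_int \<lfloor>a * 2 ^ m / T\<rfloor> \<le> a * 2 ^ m / T" "a * 2 ^ m / T < of_int \<lfloor>a * 2 ^ m / T\<rfloor> + 1"
    by linarith+
  have b: "b \<le> a" "a \<le> b + T / 2 ^ m"
  proof -
    have 1: "of_int \<lfloor>a * 2 ^ m / T\<rfloor> * T \<le> a * 2 ^ m"
      using fl(1) by (rule pos_le_divide_eq[THEN iffD1, OF T])
    have 2: "a * 2 ^ m < (of_int \<lfloor>a * 2 ^ m / T\<rfloor> + 1) * T"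
      using fl(2) by (rule pos_divide_less_eq[THEN iffD1, OF T])
    show "b \<le> a" unfolding b_def using 1 by (intro pos_divide_le_eq[THEN iffD2]) auto
    have "a \<le> (of_int \<lfloor>a * 2 ^ m / T\<rfloor> + 1) * T / 2 ^ m" using 2 by (intro pos_le_divide_eq[THEN iffD2]) auto
    also have "\<dots> = b + T / 2 ^ m" by (simp add: b_def distrib_right add_divide_distrib)
    finally show "a \<le> b + T / 2 ^ m" .
  qed
  have st: "dyadic_step T m (indicator {..b} :: real \<Rightarrow> real)"
    unfolding dyadic_step_def
  proof (intro allI impI ballI)
    fix k :: nat and s assume s: "s \<in> {real k * T / 2 ^ m<..real (Suc k) * T / 2 ^ m}"
    have "real (Suc k) * T / 2 ^ m \<le> b" if "s \<le> b"
    proof -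
      have "real k * T / 2 ^ m < of_int \<lfloor>a * 2 ^ m / T\<rfloor> * T / 2 ^ m" using s that by (simp add: b_def)
      hence "real k < of_int \<lfloor>a * 2 ^ m / T\<rfloor>" using T by (simp add: divide_less_cancel)
      hence "int k < \<lfloor>a * 2 ^ m / T\<rfloor>" by (metis of_int_less_iff of_int_of_nat_eq)
      hence "int (Suc k) \<le> \<lfloor>a * 2 ^ m / T\<rfloor>" by simp
      hence "real (Suc k) \<le> of_int \<lfloor>a * 2 ^ m / T\<rfloor>" by (metis of_int_le_iff of_int_of_nat_eq)
      thus ?thesis using T by (simp add: b_def divide_right_mono mult_right_mono)
    qed
    thus "(indicator {..b} s :: real) = indicator {..b} (real (Suc k) * T / 2 ^ m)"
      using s by (auto split: split_indicator)
  qed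
  have "(\<integral>\<^sup>+s. ennreal ((norm (indicator {..<a} s - indicator {..b} s :: real))\<^sup>2) \<partial>lborel_Icc T) \<le> (\<integral>\<^sup>+s. indicator {b..b + T / 2 ^ m} s \<partial>lborel_Icc T)"
    using b by (intro nn_integral_mono) (auto split: split_indicator)
  also have "\<dots> = emeasure lborel ({b..b + T / 2 ^ m} \<inter> {0..T})" by (simp add: emeasure_lborel_Icc)
  also have "\<dots> \<le> emeasure lborel {b..b + T / 2 ^ m}" by (intro emeasure_mono) auto
  also have "\<dots> = ennreal (T / 2 ^ m)" using T by simp
  also have "\<dots> < ennreal \<epsilon>" using m \<epsilon> T by (intro ennreal_lessI) (auto simp: field_simps)
  finally show "\<exists>g. step_approximable T g \<and> (\<integral>\<^sup>+s. ennreal ((norm (indicator {..<a} s - g s :: real))\<^sup>2) \<partial>lborel_Icc T) < ennreal \<epsilon>"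
    using step_approximable_step[OF st] by auto
qed simp

text \<open>Dynkin's argument on half-lines, which are stable under intersection and generate the
  Borel sets. Complements use linearity with the constant 1; disjoint unions use dominated
  convergence, for which the finite measure of [0,T] supplies the majorant 1.\<close>

lemma step_approximable_indicator:
  assumes T: "T > 0" and B: "B \<in> sets borel"
  shows "step_approximable T (indicator B :: real \<Rightarrow> real)"
proof -
  have "Int_stable (range (lessThan :: real \<Rightarrow> real set))"
    unfolding Int_stable_def
  proof (intro ballI)
    fix A C :: "real set" assume "A \<in> range lessThan" "C \<in> range lessThan"
    then obtain a c where "A = {..<a}" "C = {..<c}" by auto
    hence "A \<inter> C = {..<min a c}" by auto
    thus "A \<inter> C \<in> range lessThan" by blast
  qed
  moreover have "range lessThan \<subseteq> Pow (UNIV :: real set)" by simp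
  moreover have "B \<in> sigma_sets UNIV (range lessThan)" using B by (simp add: borel_Iio)
  ultimately show ?thesis
  proof (induction rule: sigma_sets_induct_disjoint)
    case (basic A)
    then show ?case using step_approximable_lessThan[OF T] by auto
  next
    case empty
    have "dyadic_step T 0 (indicator {} :: real \<Rightarrow> real)" by (simp add: dyadic_step_def)
    thus ?case by (rule step_approximable_step) simp
  next
    case (compl A)
    have "step_approximable T (\<lambda>s. 1 :: real)"
      by (rule step_approximable_step[of _ 0]) (auto simp: dyadic_step_def)
    from step_approximable_add[OF T this step_approximable_scaleR_const[OF compl(2), of "-1 :: real"]]
    have "step_approximable T (\<lambda>s. 1 - indicator A s :: real)" by simp
    moreover have "(\<lambda>s. 1 - indicator A s :: real) = indicator (UNIV - A)" by (auto split: split_indicator)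
    ultimately show ?case by simp
  next
    case (union A)
    have A[measurable]: "A i \<in> sets borel" for i
      using union(2) by (auto simp: borel_Iio)
    define U where "U n = (\<Union>i<n. A i)" for n
    have [measurable]: "U n \<in> sets borel" for n by (simp add: U_def)
    \<comment> \<open>By disjointness a finite union has the sum of the indicators as its indicator,
      so it is approximable by linearity.\<close>
    have Ueq: "(\<lambda>s. \<Sum>i<n. indicator (A i) s) = (indicator (U n) :: real \<Rightarrow> real)" for n
      unfolding U_def using union(1)
      by (intro ext indicator_UN_disjoint[symmetric]) (auto simp: disjoint_family_on_def)
    have ap: "step_approximable T (indicator (U n) :: real \<Rightarrow> real)" for n
      unfolding Ueq[symmetric] by (intro step_approximable_sum[OF T] union(3)) auto
    show ?case
    proof (rule step_approximable_limit)
      fix \<epsilon> :: real assume \<epsilon>: "\<epsilon> > 0"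
      have "(\<lambda>n. \<integral>\<^sup>+s. ennreal ((norm (indicator (\<Union>i. A i) s - indicator (U n) s :: real))\<^sup>2) \<partial>lborel_Icc T) \<longlonglongrightarrow> (\<integral>\<^sup>+s. 0 \<partial>lborel_Icc T)"
      proof (rule nn_integral_dominated_convergence[where w="\<lambda>_. 1"])
        show "(\<integral>\<^sup>+s. 1 \<partial>lborel_Icc T) < \<infinity>"
          by (simp add: emeasure_lborel_Icc emeasure_lborel_Icc_eq)
        show "AE s in lborel_Icc T. (\<lambda>n. ennreal ((norm (indicator (\<Union>i. A i) s - indicator (U n) s :: real))\<^sup>2)) \<longlonglongrightarrow> 0"
        proof (rule AE_I2)
          fix s :: real
          have "\<forall>\<^sub>F n in sequentially. (indicator (\<Union>i. A i) s :: real) = indicator (U n) s"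
          proof (cases "s \<in> (\<Union>i. A i)")
            case True
            then obtain i where "s \<in> A i" by blast
            thus ?thesis using True by (intro eventually_sequentiallyI[of "Suc i"]) (auto simp: U_def split: split_indicator)
          qed (auto simp: U_def split: split_indicator)
          thus "(\<lambda>n. ennreal ((norm (indicator (\<Union>i. A i) s - indicator (U n) s :: real))\<^sup>2)) \<longlonglongrightarrow> 0"
            by (intro tendsto_eventually) (auto elim!: eventually_mono)
        qed
      qed (auto split: split_indicator)
      hence "(\<lambda>n. \<integral>\<^sup>+s. ennreal ((norm (indicator (\<Union>i. A i) s - indicator (U n) s :: real))\<^sup>2) \<partial>lborel_Icc T) \<longlonglongrightarrow> 0" by simp
      from order_tendstoD(2)[OF this, of "ennreal \<epsilon>"] \<epsilon>
      obtain n where "(\<integral>\<^sup>+s. ennreal ((norm (indicator (\<Union>i. A i) s - indicator (U n) s :: real))\<^sup>2) \<partial>lborel_Icc T) < ennreal \<epsilon>"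
        by (auto simp: eventually_sequentially)
      thus "\<exists>g. step_approximable T g \<and> (\<integral>\<^sup>+s. ennreal ((norm (indicator (\<Union>i. A i) s - g s :: real))\<^sup>2) \<partial>lborel_Icc T) < ennreal \<epsilon>"
        using ap by blast
    qed simp
  qed
qed

lemma step_approximable_L2:
  fixes h :: "real \<Rightarrow> 'e::{banach,second_countable_topology}"
  assumes T: "T > 0" and h[measurable]: "h \<in> borel_measurable borel"
    and fin: "(\<integral>\<^sup>+s. ennreal ((norm (h s))\<^sup>2) \<partial>lborel_Icc T) < \<infinity>"
  shows "step_approximable T h"
proof (rule step_approximable_limit)
  obtain F where F: "\<And>i. simple_function (borel :: real measure) (F i)" "\<And>x. (\<lambda>i. F i x) \<longlonglongrightarrow> h x"
    "\<And>i x. dist (F i x) 0 \<le> 2 * dist (h x) 0"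
    using borel_measurable_implies_sequence_metric[OF h, of 0] by auto
  have [measurable]: "F i \<in> borel_measurable borel" for i using F(1) by (rule borel_measurable_simple_function)
  have ap: "step_approximable T (F i)" for i
  proof -
    have e: "F i = (\<lambda>x. \<Sum>y\<in>range (F i). indicator (F i -` {y}) x *\<^sub>R y)"
      by (rule ext) (rule simple_function_indicator_representation_banach[OF F(1)[of i], unfolded space_borel Int_UNIV_right, OF UNIV_I])
    have "step_approximable T (\<lambda>x. \<Sum>y\<in>range (F i). indicator (F i -` {y}) x *\<^sub>R y)"
    proof (intro step_approximable_sum[OF T] step_approximable_scaleR_const step_approximable_indicator[OF T])
      show "finite (range (F i))" using F(1)[of i] by (simp add: simple_function_def)
      show "F i -` {y} \<in> sets borel" for y by (rule measurable_sets_borel[of _ borel]) auto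
    qed
    thus ?thesis by (subst e)
  qed
  fix \<epsilon> :: real assume \<epsilon>: "\<epsilon> > 0"
  \<comment> \<open>The simple functions satisfy |F n| \<le> 2|h|, hence |h - F n| \<le> 3|h|; the
    square gives the majorant with factor 9.\<close>
  have "(\<lambda>n. \<integral>\<^sup>+s. ennreal ((norm (h s - F n s))\<^sup>2) \<partial>lborel_Icc T) \<longlonglongrightarrow> (\<integral>\<^sup>+s. 0 \<partial>lborel_Icc T)"
  proof (rule nn_integral_dominated_convergence[where w="\<lambda>s. 9 * ennreal ((norm (h s))\<^sup>2)"])
    show "(\<integral>\<^sup>+s. 9 * ennreal ((norm (h s))\<^sup>2) \<partial>lborel_Icc T) < \<infinity>"
      using fin by (subst nn_integral_cmult) (auto simp: ennreal_mult_less_top)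
    show "AE s in lborel_Icc T. ennreal ((norm (h s - F n s))\<^sup>2) \<le> 9 * ennreal ((norm (h s))\<^sup>2)" for n
    proof (rule AE_I2)
      fix s
      have "norm (h s - F n s) \<le> 3 * norm (h s)"
        using F(3)[of n s] norm_triangle_ineq4[of "h s" "F n s"] by simp
      hence "(norm (h s - F n s))\<^sup>2 \<le> (3 * norm (h s))\<^sup>2" by (intro power_mono) auto
      hence "ennreal ((norm (h s - F n s))\<^sup>2) \<le> ennreal (9 * (norm (h s))\<^sup>2)" by (intro ennreal_leI) (simp add: power_mult_distrib)
      thus "ennreal ((norm (h s - F n s))\<^sup>2) \<le> 9 * ennreal ((norm (h s))\<^sup>2)" by (simp add: ennreal_mult)
    qed
    show "AE s in lborel_Icc T. (\<lambda>n. ennreal ((norm (h s - F n s))\<^sup>2)) \<longlonglongrightarrow> 0"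
    proof (rule AE_I2)
      fix s
      have "(\<lambda>n. ennreal ((norm (h s - F n s))\<^sup>2)) \<longlonglongrightarrow> ennreal ((norm (h s - h s))\<^sup>2)"
        by (intro tendsto_intros F)
      thus "(\<lambda>n. ennreal ((norm (h s - F n s))\<^sup>2)) \<longlonglongrightarrow> 0" by simp
    qed
  qed auto
  hence "(\<lambda>n. \<integral>\<^sup>+s. ennreal ((norm (h s - F n s))\<^sup>2) \<partial>lborel_Icc T) \<longlonglongrightarrow> 0" by simp
  from order_tendstoD(2)[OF this, of "ennreal \<epsilon>"] \<epsilon>
  obtain n where "(\<integral>\<^sup>+s. ennreal ((norm (h s - F n s))\<^sup>2) \<partial>lborel_Icc T) < ennreal \<epsilon>"
    by (auto simp: eventually_sequentially)
  thus "\<exists>g. step_approximable T g \<and> (\<integral>\<^sup>+s. ennreal ((norm (h s - g s))\<^sup>2) \<partial>lborel_Icc T) < ennreal \<epsilon>"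
    using ap by blast
qed simp

text \<open>The coefficients are non-random, so one bound serves every outcome, and the integrals of
  the approximants become linear combinations of stopped Brownian motions.\<close>

lemma elem_val_L2_dense:
  fixes h :: "real \<Rightarrow> 'e::{banach,second_countable_topology}"
  assumes T: "T > 0" and h[measurable]: "h \<in> borel_measurable borel"
    and fin: "(\<integral>\<^sup>+s\<in>{0..T}. ennreal ((norm (h s))\<^sup>2) \<partial>lborel) < \<infinity>" and \<epsilon>: "\<epsilon> > 0"
  shows "\<exists>n tk x. tk 0 = 0 \<and> tk n = T \<and> (\<forall>k<n. tk k < tk (Suc k)) \<and>
    (\<forall>\<omega>::'w. (\<integral>\<^sup>+s\<in>{0..T}. ennreal ((norm (h s - elem_val n tk (\<lambda>k _. x k) s \<omega>))\<^sup>2) \<partial>lborel) < ennreal \<epsilon>)"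
proof -
  have "step_approximable T h"
    using fin by (intro step_approximable_L2[OF T h]) (simp add: nn_integral_lborel_Icc)
  then obtain m f where f: "dyadic_step T m f" and [measurable]: "f \<in> borel_measurable borel"
    and lt: "(\<integral>\<^sup>+s. ennreal ((norm (h s - f s))\<^sup>2) \<partial>lborel_Icc T) < ennreal \<epsilon>"
    using \<epsilon> unfolding step_approximable_def by blast
  define tk where "tk k = real k * T / 2 ^ m" for k
  have tk: "tk 0 = 0" "tk (2 ^ m) = T" "\<forall>k<2^m. tk k < tk (Suc k)"
    using T by (auto simp: tk_def divide_strict_right_mono)
  define x where "x k = f (tk (Suc k))" for k
  have eq: "elem_val (2^m) tk (\<lambda>k _. x k) s \<omega> = f s" if "0 < s" "s \<le> T" for s and \<omega> :: 'w
  proof -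
    have "tk 0 < s" "s \<le> tk (2 ^ m)" unfolding tk(1,2) by fact+
    then obtain j where j: "j < 2^m" "s \<in> {tk j<..tk (Suc j)}" using step_interval_exists by blast
    have "f s = x j" using f j unfolding dyadic_step_def x_def tk_def by blast
    thus ?thesis using elem_val_eq[OF tk(3) j, of "\<lambda>k _. x k" \<omega>] by simp
  qed
  \<comment> \<open>At the point 0 the elementary process vanishes whatever the value of
    \<open>f\<close> there, so the integrands agree off a null set.\<close>
  have "(\<integral>\<^sup>+s\<in>{0..T}. ennreal ((norm (h s - elem_val (2^m) tk (\<lambda>k _. x k) s \<omega>))\<^sup>2) \<partial>lborel) = (\<integral>\<^sup>+s\<in>{0..T}. ennreal ((norm (h s - f s))\<^sup>2) \<partial>lborel)" for \<omega> :: 'w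
  proof (rule nn_integral_cong_AE)
    show "AE s in lborel. ennreal ((norm (h s - elem_val (2^m) tk (\<lambda>k _. x k) s \<omega>))\<^sup>2) * indicator {0..T} s = ennreal ((norm (h s - f s))\<^sup>2) * indicator {0..T} s"
      using AE_lborel_singleton[of "0::real"]
    proof eventually_elim
      case (elim s)
      thus ?case using eq[of s \<omega>] by (cases "s \<in> {0..T}") auto
    qed
  qed
  also have "(\<integral>\<^sup>+s\<in>{0..T}. ennreal ((norm (h s - f s))\<^sup>2) \<partial>lborel) < ennreal \<epsilon>"
    using lt by (simp add: nn_integral_lborel_Icc)
  finally have "(\<integral>\<^sup>+s\<in>{0..T}. ennreal ((norm (h s - elem_val (2^m) tk (\<lambda>k _. x k) s \<omega>))\<^sup>2) \<partial>lborel) < ennreal \<epsilon>" for \<omega> :: 'w .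
  thus ?thesis using tk by blast
qed

section \<open>The Ito integral of a deterministic function\<close>

text \<open>Fatou's lemma for an almost everywhere limit: \<open>v\<close> is exchanged for the
  lower limit of \<open>u\<close>, which is measurable.\<close>

lemma nn_integral_le_of_AE_limit:
  fixes u :: "nat \<Rightarrow> 'a \<Rightarrow> ennreal"
  assumes [measurable]: "\<And>m. u m \<in> borel_measurable M"
    and lim: "AE x in M. (\<lambda>m. u m x) \<longlonglongrightarrow> v x" and le: "\<And>m. (\<integral>\<^sup>+x. u m x \<partial>M) \<le> c"
  shows "(\<integral>\<^sup>+x. v x \<partial>M) \<le> c"
proof -
  have "(\<integral>\<^sup>+x. v x \<partial>M) = (\<integral>\<^sup>+x. liminf (\<lambda>m. u m x) \<partial>M)"
    using lim by (intro nn_integral_cong_AE) (auto elim!: eventually_mono simp: lim_imp_Liminf)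
  also have "\<dots> \<le> liminf (\<lambda>m. \<integral>\<^sup>+x. u m x \<partial>M)" by (rule nn_integral_liminf) simp
  also have "\<dots> \<le> liminf (\<lambda>m. c)" by (intro Liminf_mono always_eventually allI le)
  also have "\<dots> = c" by (simp add: Liminf_const)
  finally show ?thesis .
qed

section \<open>Uniqueness and continuous version of the stochastic integral\<close>

context brownian_basis
begin

lemma elem_val_joint_measurable:
  fixes xk :: "nat \<Rightarrow> 'w \<Rightarrow> 'e::{banach,second_countable_topology}"
  assumes "elementary P Fl T n tk xk"
  shows "(\<lambda>(\<omega>, s). elem_val n tk xk s \<omega>) \<in> borel_measurable (P \<Otimes>\<^sub>M lborel)"
proof -
  have "(\<lambda>z. indicator {tk k<..tk (Suc k)} (snd z) *\<^sub>R xk k (fst z)) \<in> borel_measurable (P \<Otimes>\<^sub>M lborel)" if "k \<in> {..<n}" for k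
  proof -
    have [measurable]: "xk k \<in> borel_measurable P" using elementaryD(5)[OF assms] that by simp
    show ?thesis by measurable
  qed
  thus ?thesis unfolding elem_val_def case_prod_beta by (rule borel_measurable_sum)
qed

lemma elem_int_measurable:
  assumes "elementary P Fl T n tk xk" "0 \<le> t"
  shows "elem_int w n tk xk t \<in> borel_measurable P"
  unfolding elem_int_def
proof (intro borel_measurable_sum borel_measurable_scaleR borel_measurable_diff w_measurable_P)
  fix k assume "k \<in> {..<n}"
  thus "xk k \<in> borel_measurable P" "0 \<le> min (tk (Suc k)) t" "0 \<le> min (tk k) t"
    using elementaryD(5,8)[OF assms(1)] assms(2) by auto
qed

text \<open>The difference is written through \<open>G\<close>. Joint measurability of the step
  processes lets the outer integral be split into two.\<close>

lemma nn_integral_elem_val_diff_le: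
  fixes G :: "real \<Rightarrow> 'e::{banach,second_countable_topology}"
  assumes G[measurable]: "G \<in> borel_measurable borel"
    and a: "elementary P Fl T n tk xk" and b: "elementary P Fl T m uk yk"
  shows "(\<integral>\<^sup>+\<omega>. (\<integral>\<^sup>+s\<in>{0..T}. ennreal ((norm (elem_val n tk xk s \<omega> - elem_val m uk yk s \<omega>))\<^sup>2) \<partial>lborel) \<partial>P)
    \<le> 2 * (\<integral>\<^sup>+\<omega>. (\<integral>\<^sup>+s\<in>{0..T}. ennreal ((norm (G s - elem_val m uk yk s \<omega>))\<^sup>2) \<partial>lborel) \<partial>P)
     + 2 * (\<integral>\<^sup>+\<omega>. (\<integral>\<^sup>+s\<in>{0..T}. ennreal ((norm (G s - elem_val n tk xk s \<omega>))\<^sup>2) \<partial>lborel) \<partial>P)" (is "?l \<le> ?r")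
proof -
  note [measurable] = elem_val_joint_measurable[OF a] elem_val_joint_measurable[OF b]
  have sect: "(\<lambda>s. elem_val n tk xk s \<omega>) \<in> borel_measurable borel" "(\<lambda>s. elem_val m uk yk s \<omega>) \<in> borel_measurable borel" for \<omega>
    unfolding elem_val_def by measurable
  have "?l \<le> (\<integral>\<^sup>+\<omega>. 2 * (\<integral>\<^sup>+s\<in>{0..T}. ennreal ((norm (G s - elem_val m uk yk s \<omega>))\<^sup>2) \<partial>lborel)
     + 2 * (\<integral>\<^sup>+s\<in>{0..T}. ennreal ((norm (G s - elem_val n tk xk s \<omega>))\<^sup>2) \<partial>lborel) \<partial>P)"
  proof (rule nn_integral_mono)
    fix \<omega>
    note [measurable] = sect[of \<omega>]
    have "(\<integral>\<^sup>+s. ennreal ((norm ((G s - elem_val m uk yk s \<omega>) - (G s - elem_val n tk xk s \<omega>)))\<^sup>2) \<partial>lborel_Icc T)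
      \<le> 2 * (\<integral>\<^sup>+s. ennreal ((norm (G s - elem_val m uk yk s \<omega>))\<^sup>2) \<partial>lborel_Icc T)
       + 2 * (\<integral>\<^sup>+s. ennreal ((norm (G s - elem_val n tk xk s \<omega>))\<^sup>2) \<partial>lborel_Icc T)"
      by (rule nn_integral_norm_diff_sq_le) measurable
    thus "(\<integral>\<^sup>+s\<in>{0..T}. ennreal ((norm (elem_val n tk xk s \<omega> - elem_val m uk yk s \<omega>))\<^sup>2) \<partial>lborel)
      \<le> 2 * (\<integral>\<^sup>+s\<in>{0..T}. ennreal ((norm (G s - elem_val m uk yk s \<omega>))\<^sup>2) \<partial>lborel)
       + 2 * (\<integral>\<^sup>+s\<in>{0..T}. ennreal ((norm (G s - elem_val n tk xk s \<omega>))\<^sup>2) \<partial>lborel)"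
      by (simp add: nn_integral_lborel_Icc)
  qed
  also have "\<dots> = ?r"
    by (subst nn_integral_add) (auto simp: nn_integral_cmult)
  finally show ?thesis .
qed

text \<open>\<open>ito_integral\<close> admits any approximating sequence. Two sequences for the
  same \<open>G\<close> approach each other, so by the Ito inequality for differences their
  integrals do too.\<close>

lemma ito_integral_unique:
  fixes G :: "real \<Rightarrow> 'e::{banach,second_countable_topology}"
  assumes M2: "M_type_2 TYPE('e)" and G: "G \<in> borel_measurable borel" and t: "0 \<le> t"
    and I: "ito_integral P Fl w T (\<lambda>s \<omega>. G s) t I" and I': "ito_integral P Fl w T (\<lambda>s \<omega>. G s) t I'"
  shows "AE \<omega> in P. I \<omega> = I' \<omega>"
proof -
  obtain C where C: "ito_bound TYPE('e) C" using ito_bound_exists[OF M2] by blast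
  have [measurable]: "I \<in> borel_measurable P" "I' \<in> borel_measurable P"
    using I I' by (auto simp: ito_integral_def)
  from I obtain n tk xk where a: "\<And>j. elementary P Fl T (n j) (tk j) (xk j)"
    and a1: "(\<lambda>j. \<integral>\<^sup>+\<omega>. (\<integral>\<^sup>+s\<in>{0..T}. ennreal ((norm (G s - elem_val (n j) (tk j) (xk j) s \<omega>))\<^sup>2) \<partial>lborel) \<partial>P) \<longlonglongrightarrow> 0"
    and a2: "(\<lambda>j. \<integral>\<^sup>+\<omega>. ennreal ((norm (I \<omega> - elem_int w (n j) (tk j) (xk j) t \<omega>))\<^sup>2) \<partial>P) \<longlonglongrightarrow> 0"
    unfolding ito_integral_def by auto
  from I' obtain m uk yk where b: "\<And>j. elementary P Fl T (m j) (uk j) (yk j)"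
    and b1: "(\<lambda>j. \<integral>\<^sup>+\<omega>. (\<integral>\<^sup>+s\<in>{0..T}. ennreal ((norm (G s - elem_val (m j) (uk j) (yk j) s \<omega>))\<^sup>2) \<partial>lborel) \<partial>P) \<longlonglongrightarrow> 0"
    and b2: "(\<lambda>j. \<integral>\<^sup>+\<omega>. ennreal ((norm (I' \<omega> - elem_int w (m j) (uk j) (yk j) t \<omega>))\<^sup>2) \<partial>P) \<longlonglongrightarrow> 0"
    unfolding ito_integral_def by auto
  define A1 B1 A2 B2 where "A1 j = (\<integral>\<^sup>+\<omega>. (\<integral>\<^sup>+s\<in>{0..T}. ennreal ((norm (G s - elem_val (n j) (tk j) (xk j) s \<omega>))\<^sup>2) \<partial>lborel) \<partial>P)"
    and "B1 j = (\<integral>\<^sup>+\<omega>. (\<integral>\<^sup>+s\<in>{0..T}. ennreal ((norm (G s - elem_val (m j) (uk j) (yk j) s \<omega>))\<^sup>2) \<partial>lborel) \<partial>P)"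
    and "A2 j = (\<integral>\<^sup>+\<omega>. ennreal ((norm (I \<omega> - elem_int w (n j) (tk j) (xk j) t \<omega>))\<^sup>2) \<partial>P)"
    and "B2 j = (\<integral>\<^sup>+\<omega>. ennreal ((norm (I' \<omega> - elem_int w (m j) (uk j) (yk j) t \<omega>))\<^sup>2) \<partial>P)" for j
  \<comment> \<open>With \<open>X\<close> and \<open>Y\<close> the elementary integrals of stage
    \<open>j\<close>, I - I' = (I - X) - ((I' - Y) - (X - Y)). Two of the terms vanish in the limit
    by definition, the third by the Ito inequality.\<close>
  have le: "(\<integral>\<^sup>+\<omega>. ennreal ((norm (I \<omega> - I' \<omega>))\<^sup>2) \<partial>P) \<le> 2 * A2 j + 2 * (2 * B2 j + 2 * (ennreal C * (2 * B1 j + 2 * A1 j)))" for j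
  proof -
    define X where "X = elem_int w (n j) (tk j) (xk j) t"
    define Y where "Y = elem_int w (m j) (uk j) (yk j) t"
    have [measurable]: "X \<in> borel_measurable P" "Y \<in> borel_measurable P"
      unfolding X_def Y_def using elem_int_measurable[OF a t] elem_int_measurable[OF b t] by auto
    have "(\<integral>\<^sup>+\<omega>. ennreal ((norm (I \<omega> - I' \<omega>))\<^sup>2) \<partial>P) = (\<integral>\<^sup>+\<omega>. ennreal ((norm ((I \<omega> - X \<omega>) - (I' \<omega> - X \<omega>)))\<^sup>2) \<partial>P)" by simp
    also have "\<dots> \<le> 2 * (\<integral>\<^sup>+\<omega>. ennreal ((norm (I \<omega> - X \<omega>))\<^sup>2) \<partial>P) + 2 * (\<integral>\<^sup>+\<omega>. ennreal ((norm (I' \<omega> - X \<omega>))\<^sup>2) \<partial>P)"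
      by (rule nn_integral_norm_diff_sq_le) simp_all
    also have "(\<integral>\<^sup>+\<omega>. ennreal ((norm (I \<omega> - X \<omega>))\<^sup>2) \<partial>P) = A2 j" by (simp add: A2_def X_def)
    also have "(\<integral>\<^sup>+\<omega>. ennreal ((norm (I' \<omega> - X \<omega>))\<^sup>2) \<partial>P) = (\<integral>\<^sup>+\<omega>. ennreal ((norm ((I' \<omega> - Y \<omega>) - (X \<omega> - Y \<omega>)))\<^sup>2) \<partial>P)" by simp
    also have "\<dots> \<le> 2 * (\<integral>\<^sup>+\<omega>. ennreal ((norm (I' \<omega> - Y \<omega>))\<^sup>2) \<partial>P) + 2 * (\<integral>\<^sup>+\<omega>. ennreal ((norm (X \<omega> - Y \<omega>))\<^sup>2) \<partial>P)"
      by (rule nn_integral_norm_diff_sq_le) simp_all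
    also have "(\<integral>\<^sup>+\<omega>. ennreal ((norm (I' \<omega> - Y \<omega>))\<^sup>2) \<partial>P) = B2 j" by (simp add: B2_def Y_def)
    also have "(\<integral>\<^sup>+\<omega>. ennreal ((norm (X \<omega> - Y \<omega>))\<^sup>2) \<partial>P) \<le> ennreal C * (2 * B1 j + 2 * A1 j)"
      unfolding X_def Y_def A1_def B1_def
      by (rule order_trans[OF ito_boundD[OF C a b t] mult_left_mono[OF nn_integral_elem_val_diff_le[OF G a b]]]) simp
    finally show ?thesis by (simp add: add_left_mono mult_left_mono)
  qed
  have "(\<lambda>j. 2 * A2 j + 2 * (2 * B2 j + 2 * (ennreal C * (2 * B1 j + 2 * A1 j)))) \<longlonglongrightarrow> 2 * 0 + 2 * (2 * 0 + 2 * (ennreal C * (2 * 0 + 2 * 0)))"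
    using a1 a2 b1 b2 unfolding A1_def[symmetric] A2_def[symmetric] B1_def[symmetric] B2_def[symmetric]
    by (intro tendsto_add ennreal_tendsto_cmult) auto
  hence "(\<integral>\<^sup>+\<omega>. ennreal ((norm (I \<omega> - I' \<omega>))\<^sup>2) \<partial>P) \<le> 2 * 0 + 2 * (2 * 0 + 2 * (ennreal C * (2 * 0 + 2 * 0)))"
    by (rule tendsto_lowerbound[OF _ always_eventually[OF allI[OF le]]]) simp
  hence "(\<integral>\<^sup>+\<omega>. ennreal ((norm (I \<omega> - I' \<omega>))\<^sup>2) \<partial>P) = 0" by simp
  hence "AE \<omega> in P. ennreal ((norm (I \<omega> - I' \<omega>))\<^sup>2) = 0" by (subst (asm) nn_integral_0_iff_AE) auto
  thus ?thesis by (rule eventually_mono) (simp add: ennreal_eq_0_iff)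
qed

text \<open>Exceeding \<epsilon> strictly is an open condition along a continuous path, so it is
  seen at some dyadic time. The events for finer grids increase to the full event, which makes it
  measurable and, by continuity from below, transfers the discrete inequality with the same
  bound.\<close>

lemma doob_maximal_continuous:
  fixes N :: "real \<Rightarrow> 'w \<Rightarrow> 'e::{banach,second_countable_topology}"
  assumes T: "T > 0" and \<epsilon>: "\<epsilon> > 0"
    and cont: "\<And>\<omega>. \<omega> \<in> space P \<Longrightarrow> continuous_on {0..T} (\<lambda>t. N t \<omega>)"
    and meas: "\<And>t. t \<in> {0..T} \<Longrightarrow> N t \<in> borel_measurable (Fl t)"
    and int: "\<And>t. t \<in> {0..T} \<Longrightarrow> integrable P (N t)"
    and mart: "\<And>t B. t \<in> {0..T} \<Longrightarrow> B \<in> sets (Fl t) \<Longrightarrow> set_lebesgue_integral P B (N t) = set_lebesgue_integral P B (N T)"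
  shows "{\<omega>\<in>space P. \<exists>t\<in>{0..T}. norm (N t \<omega>) > \<epsilon>} \<in> sets P"
    "ennreal \<epsilon> * emeasure P {\<omega>\<in>space P. \<exists>t\<in>{0..T}. norm (N t \<omega>) > \<epsilon>} \<le> (\<integral>\<^sup>+\<omega>. ennreal (norm (N T \<omega>)) \<partial>P)"
proof -
  \<comment> \<open>Capping at \<open>T\<close> defines a time for every index, as the discrete
    inequality speaks of sequences; \<open>T\<close> itself is reached at index
    \<open>2 ^ m\<close>.\<close>
  define \<tau> where "\<tau> m k = min (real k * T / 2 ^ m) T" for m k :: nat
  have \<tau>: "\<tau> m k \<in> {0..T}" "k \<le> l \<Longrightarrow> \<tau> m k \<le> \<tau> m l" "\<tau> m (2 ^ m) = T" for m k l
    unfolding \<tau>_def using T by (simp, intro min.mono divide_right_mono mult_right_mono, auto)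
  define E where "E m = {\<omega>\<in>space P. \<exists>k\<le>2 ^ m. norm (N (\<tau> m k) \<omega>) > \<epsilon>}" for m
  have [measurable]: "N (\<tau> m k) \<in> borel_measurable P" for m k
    using measurable_Fl_P[OF meas[OF \<tau>(1)]] .
  have E[measurable]: "E m \<in> sets P" for m unfolding E_def by measurable
  have inc: "incseq E"
  proof (rule incseq_SucI, rule subsetI)
    fix m \<omega> assume "\<omega> \<in> E m"
    then obtain k where k: "k \<le> 2 ^ m" "norm (N (\<tau> m k) \<omega>) > \<epsilon>" "\<omega> \<in> space P" by (auto simp: E_def)
    have "\<tau> (Suc m) (2 * k) = \<tau> m k" by (simp add: \<tau>_def)
    thus "\<omega> \<in> E (Suc m)" using k by (auto simp: E_def intro!: exI[of _ "2 * k"])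
  qed
  have eq: "{\<omega>\<in>space P. \<exists>t\<in>{0..T}. norm (N t \<omega>) > \<epsilon>} = (\<Union>m. E m)"
  proof (intro equalityI subsetI)
    fix \<omega> assume "\<omega> \<in> {\<omega>\<in>space P. \<exists>t\<in>{0..T}. norm (N t \<omega>) > \<epsilon>}"
    then obtain t where \<omega>: "\<omega> \<in> space P" and t: "t \<in> {0..T}" "norm (N t \<omega>) > \<epsilon>" by auto
    have "continuous_on {0..T} (\<lambda>t. norm (N t \<omega>))" using cont[OF \<omega>] by (rule continuous_on_norm)
    then obtain d where d: "d > 0" "\<And>s. s \<in> {0..T} \<Longrightarrow> dist s t < d \<Longrightarrow> dist (norm (N s \<omega>)) (norm (N t \<omega>)) < norm (N t \<omega>) - \<epsilon>"
      using t unfolding continuous_on_iff by (metis diff_gt_0_iff_gt)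
    obtain m where m: "T / d < 2 ^ m" using real_arch_pow[of 2 "T / d"] by auto
    define k where "k = nat \<lfloor>t * 2 ^ m / T\<rfloor>"
    have "0 \<le> t * 2 ^ m / T" using t T by simp
    hence k1: "real k \<le> t * 2 ^ m / T" "t * 2 ^ m / T < real k + 1" unfolding k_def by linarith+
    have k2: "real k * T / 2 ^ m \<le> t"
      using k1(1) T by (simp add: pos_le_divide_eq pos_divide_le_eq)
    have k3: "t < real k * T / 2 ^ m + T / 2 ^ m"
      using k1(2) T by (simp add: pos_divide_less_eq pos_less_divide_eq distrib_right flip: add_divide_distrib)
    have "T / 2 ^ m < d" using m d T by (simp add: field_simps)
    have tk: "\<tau> m k = real k * T / 2 ^ m" using k2 t by (simp add: \<tau>_def)
    have "a \<le> t \<Longrightarrow> t < a + c \<Longrightarrow> c < d \<Longrightarrow> \<bar>a - t\<bar> < d" for a c :: real by linarith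
    from this[OF k2 k3 \<open>T / 2 ^ m < d\<close>] have "dist (\<tau> m k) t < d" unfolding tk dist_real_def .
    hence "norm (N (\<tau> m k) \<omega>) > \<epsilon>" using d(2)[OF \<tau>(1)] by (force simp: dist_real_def)
    moreover have "k \<le> 2 ^ m"
    proof -
      have "real k \<le> t * 2 ^ m / T" by (rule k1)
      also have "\<dots> \<le> 2 ^ m" using t T by (simp add: pos_divide_le_eq mult.commute)
      finally show ?thesis by (metis of_nat_le_iff of_nat_numeral of_nat_power)
    qed
    ultimately show "\<omega> \<in> (\<Union>m. E m)" using \<omega> by (auto simp: E_def)
  next
    fix \<omega> assume "\<omega> \<in> (\<Union>m. E m)"
    thus "\<omega> \<in> {\<omega>\<in>space P. \<exists>t\<in>{0..T}. norm (N t \<omega>) > \<epsilon>}" using \<tau>(1) by (auto simp: E_def)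
  qed
  show "{\<omega>\<in>space P. \<exists>t\<in>{0..T}. norm (N t \<omega>) > \<epsilon>} \<in> sets P" unfolding eq by measurable
  have bound: "ennreal \<epsilon> * emeasure P (E m) \<le> (\<integral>\<^sup>+\<omega>. ennreal (norm (N T \<omega>)) \<partial>P)" for m
  proof -
    have "ennreal \<epsilon> * emeasure P {\<omega>\<in>space P. \<exists>k\<le>2^m. norm (N (\<tau> m k) \<omega>) > \<epsilon>} \<le> (\<integral>\<^sup>+\<omega>. ennreal (norm (N (\<tau> m (2^m)) \<omega>)) \<partial>P)"
    proof (rule doob_maximal_inequality[where H="\<lambda>k. Fl (\<tau> m k)"])
      show "finite_measure P" by (rule finite_measure_axioms)
      show "subalgebra P (Fl (\<tau> m k))" for k by (rule subalgebra_Fl)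
      show "sets (Fl (\<tau> m k)) \<subseteq> sets (Fl (\<tau> m l))" if "k \<le> l" for k l by (intro sets_Fl_mono \<tau> that)
      show "set_lebesgue_integral P B (N (\<tau> m k)) = set_lebesgue_integral P B (N (\<tau> m (2 ^ m)))"
        if "B \<in> sets (Fl (\<tau> m k))" for k B
        unfolding \<tau>(3) by (rule mart[OF \<tau>(1) that])
    qed (use meas[OF \<tau>(1)] int[OF \<tau>(1)] \<epsilon> in auto)
    thus ?thesis by (simp add: E_def \<tau>(3))
  qed
  have "emeasure P (\<Union>m. E m) = (SUP m. emeasure P (E m))" using inc by (intro SUP_emeasure_incseq[symmetric]) auto
  hence "ennreal \<epsilon> * emeasure P (\<Union>m. E m) = (SUP m. ennreal \<epsilon> * emeasure P (E m))"
    by (simp add: SUP_mult_left_ennreal)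
  also have "\<dots> \<le> (\<integral>\<^sup>+\<omega>. ennreal (norm (N T \<omega>)) \<partial>P)" by (intro SUP_least bound)
  finally show "ennreal \<epsilon> * emeasure P {\<omega>\<in>space P. \<exists>t\<in>{0..T}. norm (N t \<omega>) > \<epsilon>} \<le> (\<integral>\<^sup>+\<omega>. ennreal (norm (N T \<omega>)) \<partial>P)"
    unfolding eq .
qed

lemma w_integrable: "0 \<le> t \<Longrightarrow> integrable P (w t)"
  using increment_integrable(1)[of 0 t] by (simp add: w_0 cong: Bochner_Integration.integrable_cong)

text \<open>If the level \<open>c\<close> is at most \<open>s\<close>, both sides involve the same
  variable; otherwise they differ by an increment after \<open>s\<close>.\<close>

lemma stopped_w_martingale:
  assumes c: "0 \<le> c" and st: "0 \<le> s" "s \<le> t" and B: "B \<in> sets (Fl s)"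
  shows "(\<integral>\<omega>. indicator B \<omega> * w (min c t) \<omega> \<partial>P) = (\<integral>\<omega>. indicator B \<omega> * w (min c s) \<omega> \<partial>P)"
proof (cases "c \<le> s")
  case False
  hence m: "min c s = s" "s \<le> min c t" using st by auto
  have BP: "B \<in> sets P" using B sets_Fl by auto
  have i: "integrable P (\<lambda>\<omega>. indicator B \<omega> * w u \<omega>)" if "0 \<le> u" for u
    using integrable_mult_indicator[OF BP w_integrable[OF that]] by simp
  have "(\<integral>\<omega>. indicator B \<omega> * (w (min c t) \<omega> - w s \<omega>) \<partial>P) = 0"
    by (rule increment_set_integral_zero[OF st(1) m(2) B])
  thus ?thesis using i[of "min c t"] i[of s] c st by (simp add: m(1) right_diff_distrib)
qed (use st in \<open>simp add: min_def\<close>)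

text \<open>Elementary integrands with non-random values are continuous martingales because stopped Brownian
  motion is one.\<close>

lemma deterministic_elem_int:
  fixes x :: "nat \<Rightarrow> 'e::{banach,second_countable_topology}"
  assumes tk: "\<forall>k\<le>n. 0 \<le> tk k"
  defines "Z \<equiv> elem_int w n tk (\<lambda>k _. x k)"
  shows "\<omega> \<in> space P \<Longrightarrow> continuous_on {0..} (\<lambda>t. Z t \<omega>)"
    "0 \<le> t \<Longrightarrow> Z t \<in> borel_measurable (Fl t)" "0 \<le> t \<Longrightarrow> integrable P (Z t)"
    "0 \<le> s \<Longrightarrow> s \<le> t \<Longrightarrow> B \<in> sets (Fl s) \<Longrightarrow> set_lebesgue_integral P B (Z s) = set_lebesgue_integral P B (Z t)"
proof -
  show "continuous_on {0..} (\<lambda>t. Z t \<omega>)" if "\<omega> \<in> space P"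
    unfolding Z_def elem_int_def
    by (intro continuous_intros continuous_on_compose2[OF w_continuous[OF that]]) (auto simp: tk)
  show "Z t \<in> borel_measurable (Fl t)" if "0 \<le> t" for t
    unfolding Z_def elem_int_def
    by (intro borel_measurable_sum borel_measurable_scaleR borel_measurable_diff w_measurable) (auto simp: tk that)
  show iZ: "integrable P (Z t)" if "0 \<le> t" for t
    unfolding Z_def elem_int_def
    by (intro Bochner_Integration.integrable_sum integrable_scaleR_left Bochner_Integration.integrable_diff w_integrable)
       (auto simp: tk that)
  assume st: "0 \<le> s" "s \<le> t" and B: "B \<in> sets (Fl s)"
  have BP: "B \<in> sets P" using B sets_Fl by auto
  have i: "integrable P (\<lambda>\<omega>. indicator B \<omega> * w u \<omega>)" if "0 \<le> u" for u
    using integrable_mult_indicator[OF BP w_integrable[OF that]] by simp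
  define m where "m c u = (\<integral>\<omega>. indicator B \<omega> * w (min c u) \<omega> \<partial>P)" for c u
  have *: "set_lebesgue_integral P B (Z u) = (\<Sum>k<n. (m (tk (Suc k)) u - m (tk k) u) *\<^sub>R x k)" if u: "0 \<le> u" for u
  proof -
    have "set_lebesgue_integral P B (Z u)
      = (\<integral>\<omega>. (\<Sum>k<n. (indicator B \<omega> * w (min (tk (Suc k)) u) \<omega> - indicator B \<omega> * w (min (tk k) u) \<omega>) *\<^sub>R x k) \<partial>P)"
      unfolding set_lebesgue_integral_def Z_def elem_int_def scaleR_sum_right
      by (simp only: scaleR_scaleR right_diff_distrib)
    also have "\<dots> = (\<Sum>k<n. \<integral>\<omega>. (indicator B \<omega> * w (min (tk (Suc k)) u) \<omega> - indicator B \<omega> * w (min (tk k) u) \<omega>) *\<^sub>R x k \<partial>P)"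
      by (intro Bochner_Integration.integral_sum integrable_scaleR_left Bochner_Integration.integrable_diff i) (auto simp: tk u)
    also have "\<dots> = (\<Sum>k<n. (m (tk (Suc k)) u - m (tk k) u) *\<^sub>R x k)"
    proof (rule sum.cong[OF refl])
      fix k assume "k \<in> {..<n}"
      hence ii: "integrable P (\<lambda>\<omega>. indicator B \<omega> * w (min (tk (Suc k)) u) \<omega>)" "integrable P (\<lambda>\<omega>. indicator B \<omega> * w (min (tk k) u) \<omega>)"
        by (auto intro!: i simp: tk u)
      show "(\<integral>\<omega>. (indicator B \<omega> * w (min (tk (Suc k)) u) \<omega> - indicator B \<omega> * w (min (tk k) u) \<omega>) *\<^sub>R x k \<partial>P) = (m (tk (Suc k)) u - m (tk k) u) *\<^sub>R x k"
        unfolding m_def Bochner_Integration.integral_diff[OF ii, symmetric]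
        by (rule integral_scaleR_left) (intro Bochner_Integration.integrable_diff ii)
    qed
    finally show ?thesis .
  qed
  have "m c t = m c s" if "0 \<le> c" for c unfolding m_def by (rule stopped_w_martingale[OF that st B])
  thus "set_lebesgue_integral P B (Z s) = set_lebesgue_integral P B (Z t)"
    using st by (simp add: * tk)
qed

text \<open>The reason why a process may be altered on a null set without losing
  adaptedness.\<close>

lemma null_set_Fl: "Z \<in> null_sets P \<Longrightarrow> 0 \<le> t \<Longrightarrow> Z \<in> sets (Fl t)"
  using basis sets_Fl_mono[of 0 t] unfolding usual_basis_def by blast

theorem ito_integral_continuous_version:
  fixes G :: "real \<Rightarrow> 'e::{banach,second_countable_topology}"
  assumes M2: "M_type_2 TYPE('e)" and T: "T > 0" and G[measurable]: "G \<in> borel_measurable borel"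
    and fin: "(\<integral>\<^sup>+s\<in>{0..T}. ennreal ((norm (G s))\<^sup>2) \<partial>lborel) < \<infinity>"
  shows "\<exists>J. (\<forall>\<omega>\<in>space P. continuous_on {0..T} (\<lambda>t. J t \<omega>)) \<and>
    (\<forall>t\<in>{0..T}. J t \<in> borel_measurable (Fl t) \<and> ito_integral P Fl w T (\<lambda>s \<omega>. G s) t (J t)) \<and>
    (\<exists>K<\<infinity>. \<forall>t\<in>{0..T}. (\<integral>\<^sup>+\<omega>. ennreal ((norm (J t \<omega>))\<^sup>2) \<partial>P) \<le> K)"
proof -
  obtain C where C: "ito_bound TYPE('e) C" using ito_bound_exists[OF M2] by blast
  have C0: "C \<ge> 0" using C by (simp add: ito_bound_def)
  \<comment> \<open>The rate 16^-j is dictated by what follows: the second moment of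
    \<open>N j T\<close> is at most 4C 16^-j, its first moment at most (4C+1) 4^-j, and Doob's
    inequality with threshold 2^-j leaves probabilities of at most (4C+1) 2^-j, which are
    summable.\<close>
  define \<epsilon> where "\<epsilon> j = (1/16 :: real) ^ j" for j
  have \<epsilon>: "\<epsilon> j > 0" "i \<le> j \<Longrightarrow> \<epsilon> j \<le> \<epsilon> i" for i j by (auto simp: \<epsilon>_def intro: power_decreasing)
  define Q where "Q j n tk x \<longleftrightarrow> tk 0 = 0 \<and> tk n = T \<and> (\<forall>k<n. tk k < tk (Suc k)) \<and>
    (\<forall>\<omega>::'w. (\<integral>\<^sup>+s\<in>{0..T}. ennreal ((norm (G s - elem_val n tk (\<lambda>k _. x k) s \<omega>))\<^sup>2) \<partial>lborel) < ennreal (\<epsilon> j))" for j n tk x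
  have "\<exists>n tk x. Q j n tk x" for j
    unfolding Q_def by (rule elem_val_L2_dense[OF T G fin \<epsilon>(1)])
  then obtain n tk x where Q: "\<And>j. Q j (n j) (tk j) (x j)" by metis
  hence tk: "\<And>j. tk j 0 = 0" "\<And>j. tk j (n j) = T" "\<And>j. \<forall>k<n j. tk j k < tk j (Suc k)"
    and app: "\<And>j \<omega>. (\<integral>\<^sup>+s\<in>{0..T}. ennreal ((norm (G s - elem_val (n j) (tk j) (\<lambda>k (_::'w). x j k) s \<omega>))\<^sup>2) \<partial>lborel) < ennreal (\<epsilon> j)"
    unfolding Q_def by blast+
  \<comment> \<open>Arbitrary coefficients are allowed on the grid, so that the zero process on the
    same grid is available for the second moment bound at the end.\<close>
  have el: "elementary P Fl T (n j) (tk j) (\<lambda>k _. y k)" for j and y :: "nat \<Rightarrow> 'e"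
    using tk[of j] by (auto simp: elementary_def emeasure_space_1)
  have nonneg: "\<forall>k\<le>n j. 0 \<le> tk j k" for j
    using elementaryD(8)[OF el[of j "x j"]] by blast
  define Z where "Z j = elem_int w (n j) (tk j) (\<lambda>k _. x j k)" for j
  note Z = deterministic_elem_int[where n="n j" and tk="tk j" and x="x j" for j, OF nonneg, folded Z_def]
  have app': "(\<integral>\<^sup>+\<omega>. (\<integral>\<^sup>+s\<in>{0..T}. ennreal ((norm (G s - elem_val (n j) (tk j) (\<lambda>k _. x j k) s \<omega>))\<^sup>2) \<partial>lborel) \<partial>P) \<le> ennreal (\<epsilon> j)" for j
    using nn_integral_mono[of P "\<lambda>\<omega>. \<integral>\<^sup>+s\<in>{0..T}. ennreal ((norm (G s - elem_val (n j) (tk j) (\<lambda>k _. x j k) s \<omega>))\<^sup>2) \<partial>lborel" "\<lambda>_. ennreal (\<epsilon> j)"] app[of j]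
    by (auto simp: emeasure_space_1 less_imp_le)
  have ZP[measurable]: "Z j t \<in> borel_measurable P" if "0 \<le> t" for j t
    using measurable_Fl_P[OF Z(2)[OF that]] .
  have diff: "(\<integral>\<^sup>+\<omega>. ennreal ((norm (Z i t \<omega> - Z j t \<omega>))\<^sup>2) \<partial>P) \<le> ennreal (4 * C * \<epsilon> j)"
    if t: "0 \<le> t" and ij: "j \<le> i" for i j t
  proof -
    have "(\<integral>\<^sup>+\<omega>. ennreal ((norm (Z i t \<omega> - Z j t \<omega>))\<^sup>2) \<partial>P) \<le> ennreal C * (2 * ennreal (\<epsilon> j) + 2 * ennreal (\<epsilon> i))"
      unfolding Z_def
      by (rule order_trans[OF ito_boundD[OF C el el t] mult_left_mono[OF order_trans[OF nn_integral_elem_val_diff_le[OF G el el]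
          add_mono[OF mult_left_mono[OF app'] mult_left_mono[OF app']]]]]) auto
    also have "\<dots> \<le> ennreal C * (2 * ennreal (\<epsilon> j) + 2 * ennreal (\<epsilon> j))"
      using \<epsilon>(2)[OF ij] by (intro mult_left_mono add_mono ennreal_leI) auto
    also have "\<dots> = ennreal (4 * C * \<epsilon> j)"
      using C0 \<epsilon>(1)[of j] by (simp add: ennreal_mult flip: distrib_right) (simp add: ac_simps)
    finally show ?thesis .
  qed
  define N where "N j t \<omega> = Z (Suc j) t \<omega> - Z j t \<omega>" for j t \<omega>
  define A where "A j = {\<omega>\<in>space P. \<exists>t\<in>{0..T}. norm (N j t \<omega>) > (1/2)^j}" for j
  have N: "{\<omega>\<in>space P. \<exists>t\<in>{0..T}. norm (N j t \<omega>) > (1/2)^j} \<in> sets P"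
    "ennreal ((1/2)^j) * emeasure P {\<omega>\<in>space P. \<exists>t\<in>{0..T}. norm (N j t \<omega>) > (1/2)^j} \<le> (\<integral>\<^sup>+\<omega>. ennreal (norm (N j T \<omega>)) \<partial>P)" for j
  proof -
    have cont: "continuous_on {0..T} (\<lambda>t. N j t \<omega>)" if "\<omega> \<in> space P" for \<omega>
      unfolding N_def using that by (intro continuous_intros continuous_on_subset[OF Z(1)]) auto
    have meas: "N j t \<in> borel_measurable (Fl t)" if "t \<in> {0..T}" for t
      unfolding N_def using that Z(2) by (intro borel_measurable_diff) auto
    have int: "integrable P (N j t)" if "t \<in> {0..T}" for t
      unfolding N_def using that Z(3) by (intro Bochner_Integration.integrable_diff) auto
    have mart: "set_lebesgue_integral P B (N j t) = set_lebesgue_integral P B (N j T)"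
      if t: "t \<in> {0..T}" and B: "B \<in> sets (Fl t)" for t B
    proof -
      have BP: "B \<in> sets P" using B sets_Fl by auto
      have "set_integrable P B (Z i u)" if "0 \<le> u" for i u
        unfolding set_integrable_def by (intro integrable_mult_indicator BP Z(3) that)
      hence "set_lebesgue_integral P B (N j u) = set_lebesgue_integral P B (Z (Suc j) u) - set_lebesgue_integral P B (Z j u)" if "0 \<le> u" for u
        unfolding N_def using that by (intro set_integral_diff) auto
      thus ?thesis using t Z(4)[OF _ _ B, of T] by simp
    qed
    have pos: "(1/2 :: real)^j > 0" by simp
    show "{\<omega>\<in>space P. \<exists>t\<in>{0..T}. norm (N j t \<omega>) > (1/2)^j} \<in> sets P"
      "ennreal ((1/2)^j) * emeasure P {\<omega>\<in>space P. \<exists>t\<in>{0..T}. norm (N j t \<omega>) > (1/2)^j} \<le> (\<integral>\<^sup>+\<omega>. ennreal (norm (N j T \<omega>)) \<partial>P)"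
      by (rule doob_maximal_continuous[OF T pos cont meas int mart]; assumption)+
  qed
  have Asets[measurable]: "A j \<in> sets P" for j unfolding A_def by (rule N)
  have Ab: "measure P (A j) \<le> (4 * C + 1) * (1/2)^j" for j
  proof -
    have "(\<integral>\<^sup>+\<omega>. ennreal (norm (N j T \<omega>)) \<partial>P) \<le> (\<integral>\<^sup>+\<omega>. ennreal (4 ^ j) * ennreal ((norm (N j T \<omega>))\<^sup>2) + ennreal ((1/4)^j) \<partial>P)"
    proof (rule nn_integral_mono)
      fix \<omega>
      define y where "y = norm (N j T \<omega>)"
      \<comment> \<open>A substitute for the Cauchy-Schwarz inequality: the first moment is bounded
        by 4^j times the second, itself of order 16^-j, plus an error of the same resulting order
        4^-j.\<close>
      have "y \<le> 4 ^ j * y\<^sup>2 + (1/4)^j"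
      proof (cases "y \<le> (1/4)^j")
        case True
        thus ?thesis by (simp add: add_increasing)
      next
        case False
        hence "1 \<le> 4 ^ j * y" by (simp add: field_simps power_one_over)
        hence "1 * y \<le> 4 ^ j * y * y" by (intro mult_right_mono) (auto simp: y_def)
        thus ?thesis by (simp add: power2_eq_square add_increasing2 mult.assoc)
      qed
      hence "ennreal y \<le> ennreal (4 ^ j * y\<^sup>2 + (1/4)^j)" by (rule ennreal_leI)
      thus "ennreal (norm (N j T \<omega>)) \<le> ennreal (4 ^ j) * ennreal ((norm (N j T \<omega>))\<^sup>2) + ennreal ((1/4)^j)"
        by (simp add: y_def ennreal_plus ennreal_mult)
    qed
    also have "\<dots> = ennreal (4 ^ j) * (\<integral>\<^sup>+\<omega>. ennreal ((norm (N j T \<omega>))\<^sup>2) \<partial>P) + ennreal ((1/4)^j)"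
      unfolding N_def using T by (subst nn_integral_add) (auto simp: nn_integral_cmult emeasure_space_1)
    also have "\<dots> \<le> ennreal (4 ^ j) * ennreal (4 * C * \<epsilon> j) + ennreal ((1/4)^j)"
      unfolding N_def using T by (intro add_right_mono mult_left_mono diff) auto
    also have "\<dots> = ennreal (4 ^ j * (4 * C * \<epsilon> j) + (1/4)^j)"
      using C0 \<epsilon>(1)[of j] by (simp add: ennreal_plus ennreal_mult)
    also have "4 ^ j * (4 * C * \<epsilon> j) + (1/4)^j = (4 * C + 1) * (1/4)^j"
    proof -
      have "4 ^ j * \<epsilon> j = (1/4)^j" unfolding \<epsilon>_def power_mult_distrib[symmetric] by simp
      thus ?thesis by (simp add: algebra_simps)
    qed
    finally have "ennreal ((1/2)^j) * emeasure P (A j) \<le> ennreal ((4 * C + 1) * (1/4)^j)"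
      using N(2)[of j] unfolding A_def by (rule order_trans[rotated])
    hence "(1/2)^j * measure P (A j) \<le> (4 * C + 1) * (1/4)^j"
      using C0 by (simp add: emeasure_eq_measure flip: ennreal_mult)
    also have "(1/4 :: real)^j = (1/2)^j * (1/2)^j" unfolding power_mult_distrib[symmetric] by simp
    finally have "(1/2)^j * measure P (A j) \<le> (1/2)^j * ((4 * C + 1) * (1/2)^j)" by (simp add: ac_simps)
    thus ?thesis by (simp add: mult_le_cancel_left)
  qed
  have "summable (\<lambda>j. measure P (A j))"
    by (rule summable_comparison_test'[of "\<lambda>j. (4 * C + 1) * (1/2)^j" 0]) (use Ab in \<open>auto intro!: summable_mult summable_geometric\<close>)
  hence "AE \<omega> in P. \<forall>\<^sub>F j in sequentially. \<omega> \<in> space P - A j"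
    by (intro borel_cantelli_AE1) (auto simp: emeasure_eq_measure)
  then obtain Z0 where Z0: "Z0 \<in> null_sets P" "{\<omega>\<in>space P. \<not> (\<forall>\<^sub>F j in sequentially. \<omega> \<in> space P - A j)} \<subseteq> Z0"
    unfolding eventually_ae_filter by blast
  \<comment> \<open>The limit of \<open>Z m\<close> as a telescoping series, replaced by 0 on the
    exceptional null set. Every path becomes continuous, and \<open>J t\<close> stays adapted
    because \<open>Fl t\<close> contains the null sets.\<close>
  define J where "J t \<omega> = (if \<omega> \<in> Z0 then 0 else Z 0 t \<omega> + (\<Sum>j. N j t \<omega>))" for t \<omega>
  have ul: "uniform_limit {0..T} (\<lambda>m t. Z m t \<omega>) (\<lambda>t. J t \<omega>) sequentially" if \<omega>: "\<omega> \<in> space P" "\<omega> \<notin> Z0" for \<omega>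
  proof -
    have "\<forall>\<^sub>F j in sequentially. \<omega> \<in> space P - A j" using Z0 \<omega> by blast
    hence "\<forall>\<^sub>F j in sequentially. \<forall>t\<in>{0..T}. norm (N j t \<omega>) \<le> (1/2)^j"
      by (rule eventually_mono) (auto simp: A_def not_less)
    hence "uniform_limit {0..T} (\<lambda>m t. \<Sum>i<m. N i t \<omega>) (\<lambda>t. \<Sum>i. N i t \<omega>) sequentially"
      by (rule Weierstrass_m_test_ev) (rule summable_geometric, simp)
    hence "uniform_limit {0..T} (\<lambda>m t. Z 0 t \<omega> + (\<Sum>i<m. N i t \<omega>)) (\<lambda>t. Z 0 t \<omega> + (\<Sum>i. N i t \<omega>)) sequentially"
      by (intro uniform_limit_intros)
    moreover have "Z 0 t \<omega> + (\<Sum>i<m. N i t \<omega>) = Z m t \<omega>" for m t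
      unfolding N_def by (subst sum_lessThan_telescope) simp
    ultimately show ?thesis using \<omega>(2) by (simp add: J_def)
  qed
  have lim: "(\<lambda>m. Z m t \<omega>) \<longlonglongrightarrow> J t \<omega>" if "\<omega> \<in> space P" "\<omega> \<notin> Z0" "t \<in> {0..T}" for t \<omega>
    using tendsto_uniform_limitI[OF ul[OF that(1,2)] that(3)] .
  have Jcont: "continuous_on {0..T} (\<lambda>t. J t \<omega>)" if \<omega>: "\<omega> \<in> space P" for \<omega>
  proof (cases "\<omega> \<in> Z0")
    case True
    thus ?thesis by (simp add: J_def)
  next
    case False
    show ?thesis
      by (rule uniform_limit_theorem[OF _ ul[OF \<omega> False]])
         (auto intro!: always_eventually continuous_on_subset[OF Z(1)] \<omega>)
  qed
  have JF: "J t \<in> borel_measurable (Fl t)" if t: "t \<in> {0..T}" for t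
  proof (rule borel_measurable_LIMSEQ_metric)
    fix m
    have "Z0 \<in> sets (Fl t)" using null_set_Fl[OF Z0(1)] t by simp
    hence "space P - Z0 \<in> sets (Fl t)" using sets.compl_sets[of Z0 "Fl t"] by simp
    thus "(\<lambda>\<omega>. indicator (space (Fl t) - Z0) \<omega> *\<^sub>R Z m t \<omega>) \<in> borel_measurable (Fl t)"
      using Z(2)[of t m] t by (intro borel_measurable_scaleR borel_measurable_indicator) auto
    fix \<omega> assume "\<omega> \<in> space (Fl t)"
    thus "(\<lambda>m. indicator (space (Fl t) - Z0) \<omega> *\<^sub>R Z m t \<omega>) \<longlonglongrightarrow> J t \<omega>"
      using lim[of \<omega> t] t by (cases "\<omega> \<in> Z0") (auto simp: J_def[of _ \<omega>])
  qed
  have JP: "J t \<in> borel_measurable P" if "t \<in> {0..T}" for t using measurable_Fl_P[OF JF[OF that]] .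
  \<comment> \<open>The bound in \<open>diff\<close> does not depend on the later index, so Fatou's
    lemma carries it to the limit; the shift by \<open>j\<close> keeps that index at least
    \<open>j\<close>.\<close>
  have J2: "(\<integral>\<^sup>+\<omega>. ennreal ((norm (J t \<omega> - Z j t \<omega>))\<^sup>2) \<partial>P) \<le> ennreal (4 * C * \<epsilon> j)" if t: "t \<in> {0..T}" for t j
  proof (rule nn_integral_le_of_AE_limit[where u="\<lambda>m \<omega>. ennreal ((norm (Z (m + j) t \<omega> - Z j t \<omega>))\<^sup>2)"])
    show "(\<lambda>\<omega>. ennreal ((norm (Z (m + j) t \<omega> - Z j t \<omega>))\<^sup>2)) \<in> borel_measurable P" for m using t by simp
    show "(\<integral>\<^sup>+\<omega>. ennreal ((norm (Z (m + j) t \<omega> - Z j t \<omega>))\<^sup>2) \<partial>P) \<le> ennreal (4 * C * \<epsilon> j)" for m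
      using t by (intro diff) auto
    have "AE \<omega> in P. \<omega> \<in> space P - Z0" using AE_not_in[OF Z0(1)] by auto
    thus "AE \<omega> in P. (\<lambda>m. ennreal ((norm (Z (m + j) t \<omega> - Z j t \<omega>))\<^sup>2)) \<longlonglongrightarrow> ennreal ((norm (J t \<omega> - Z j t \<omega>))\<^sup>2)"
    proof eventually_elim
      case (elim \<omega>)
      hence "(\<lambda>m. Z (m + j) t \<omega>) \<longlonglongrightarrow> J t \<omega>" using lim[of \<omega> t] t by (intro LIMSEQ_ignore_initial_segment) auto
      thus ?case by (intro tendsto_intros)
    qed
  qed
  have \<epsilon>0: "\<epsilon> \<longlonglongrightarrow> 0" unfolding \<epsilon>_def by (rule LIMSEQ_power_zero) simp
  have ito: "ito_integral P Fl w T (\<lambda>s \<omega>. G s) t (J t)" if t: "t \<in> {0..T}" for t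
    unfolding ito_integral_def
  proof (intro conjI JP[OF t] exI[of _ n] exI[of _ tk] exI[of _ "\<lambda>j k _. x j k"] allI)
    show "elementary P Fl T (n j) (tk j) (\<lambda>k _. x j k)" for j by (rule el)
    have z1: "(\<lambda>j. ennreal (\<epsilon> j)) \<longlonglongrightarrow> 0" using tendsto_ennrealI[OF \<epsilon>0] by simp
    show "(\<lambda>j. \<integral>\<^sup>+\<omega>. (\<integral>\<^sup>+s\<in>{0..T}. ennreal ((norm (G s - elem_val (n j) (tk j) (\<lambda>k _. x j k) s \<omega>))\<^sup>2) \<partial>lborel) \<partial>P) \<longlonglongrightarrow> 0"
      by (rule tendsto_sandwich[OF _ _ tendsto_const z1]) (auto intro: always_eventually app')
    have "(\<lambda>j. ennreal (4 * C * \<epsilon> j)) \<longlonglongrightarrow> ennreal (4 * C * 0)" by (intro tendsto_intros \<epsilon>0)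
    hence z2: "(\<lambda>j. ennreal (4 * C * \<epsilon> j)) \<longlonglongrightarrow> 0" by simp
    show "(\<lambda>j. \<integral>\<^sup>+\<omega>. ennreal ((norm (J t \<omega> - elem_int w (n j) (tk j) (\<lambda>k _. x j k) t \<omega>))\<^sup>2) \<partial>P) \<longlonglongrightarrow> 0"
      by (rule tendsto_sandwich[OF _ _ tendsto_const z2]) (auto intro: always_eventually J2[OF t] simp flip: Z_def)
  qed
  \<comment> \<open>\<open>ito_bound\<close> speaks about differences, so the second moment of
    \<open>Z 0\<close> is read as a distance to the zero process. It is finite because both
    processes are at finite L2 distance from \<open>G\<close>.\<close>
  define L where "L = (\<integral>\<^sup>+\<omega>. (\<integral>\<^sup>+s\<in>{0..T}. ennreal ((norm (elem_val (n 0) (tk 0) (\<lambda>k _. x 0 k) s \<omega> - elem_val (n 0) (tk 0) (\<lambda>k (_::'w). 0) s \<omega>))\<^sup>2) \<partial>lborel) \<partial>P)"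
  have Lfin: "L < \<infinity>"
  proof -
    have "L \<le> 2 * (\<integral>\<^sup>+\<omega>. (\<integral>\<^sup>+s\<in>{0..T}. ennreal ((norm (G s - elem_val (n 0) (tk 0) (\<lambda>k _. 0) s \<omega>))\<^sup>2) \<partial>lborel) \<partial>P)
     + 2 * (\<integral>\<^sup>+\<omega>. (\<integral>\<^sup>+s\<in>{0..T}. ennreal ((norm (G s - elem_val (n 0) (tk 0) (\<lambda>k _. x 0 k) s \<omega>))\<^sup>2) \<partial>lborel) \<partial>P)"
      unfolding L_def by (rule nn_integral_elem_val_diff_le[OF G el el])
    also have "\<dots> \<le> 2 * (\<integral>\<^sup>+s\<in>{0..T}. ennreal ((norm (G s))\<^sup>2) \<partial>lborel) + 2 * ennreal (\<epsilon> 0)"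
      using app'[of 0] by (intro add_mono mult_left_mono) (auto simp: elem_val_def emeasure_space_1)
    also have "\<dots> < \<infinity>" using fin by (simp add: ennreal_mult_less_top ennreal_add_eq_top less_top)
    finally show ?thesis .
  qed
  define K where "K = 2 * ennreal (4 * C * \<epsilon> 0) + 2 * (ennreal C * L)"
  have "(\<integral>\<^sup>+\<omega>. ennreal ((norm (J t \<omega>))\<^sup>2) \<partial>P) \<le> K" if t: "t \<in> {0..T}" for t
  proof -
    note [measurable] = JP[OF t]
    have [measurable]: "Z 0 t \<in> borel_measurable P" using t by simp
    have z: "(\<integral>\<^sup>+\<omega>. ennreal ((norm (Z 0 t \<omega>))\<^sup>2) \<partial>P) \<le> ennreal C * L"
      using ito_boundD[OF C el[of 0 "x 0"] el[of 0 "\<lambda>_. 0"], of t] t unfolding L_def Z_def by (simp add: elem_int_def)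
    have "(\<integral>\<^sup>+\<omega>. ennreal ((norm (J t \<omega>))\<^sup>2) \<partial>P) = (\<integral>\<^sup>+\<omega>. ennreal ((norm ((J t \<omega> - Z 0 t \<omega>) - (- Z 0 t \<omega>)))\<^sup>2) \<partial>P)" by simp
    also have "\<dots> \<le> 2 * (\<integral>\<^sup>+\<omega>. ennreal ((norm (J t \<omega> - Z 0 t \<omega>))\<^sup>2) \<partial>P) + 2 * (\<integral>\<^sup>+\<omega>. ennreal ((norm (- Z 0 t \<omega>))\<^sup>2) \<partial>P)"
      by (rule nn_integral_norm_diff_sq_le) simp_all
    also have "\<dots> \<le> K" unfolding K_def using z by (intro add_mono mult_left_mono J2[OF t]) auto
    finally show ?thesis .
  qed
  moreover have "K < \<infinity>" unfolding K_def using Lfin by (simp add: ennreal_mult_less_top ennreal_add_eq_top less_top ennreal_mult_eq_top_iff)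
  ultimately show ?thesis using Jcont JF ito by (intro exI[of _ J]) blast
qed

end

section \<open>Linear Volterra equations\<close>

abbreviation integral_to :: "real \<Rightarrow> (real \<Rightarrow> 'e) \<Rightarrow> 'e::{banach,second_countable_topology}" where
  "integral_to t f \<equiv> set_lebesgue_integral lborel {0..t} f"

section \<open>Integrals with variable upper limit\<close>

lemma continuous_on_set_integrable:
  fixes f :: "real \<Rightarrow> 'e::{banach,second_countable_topology}"
  assumes "continuous_on {0..T} f" "t \<le> T"
  shows "set_integrable lborel {0..t} f"
  unfolding set_integrable_def
  by (intro borel_integrable_compact continuous_on_subset[OF assms(1)]) (use assms(2) in auto)

lemma norm_integral_to_le:
  fixes f :: "real \<Rightarrow> 'e::{banach,second_countable_topology}"
  assumes "set_integrable lborel {0..t} f" "set_integrable lborel {0..t} g"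
    and "\<And>s. s \<in> {0..t} \<Longrightarrow> norm (f s) \<le> g s"
  shows "norm (integral_to t f) \<le> integral_to t g"
  by (rule order_trans[OF set_integral_norm_bound[OF assms(1)] set_integral_mono])
     (use assms in \<open>auto intro: set_integrable_norm\<close>)

lemma integral_to_mono:
  fixes g :: "real \<Rightarrow> real"
  assumes "set_integrable lborel {0..T} g" "t \<le> T" "\<And>s. s \<in> {0..T} \<Longrightarrow> 0 \<le> g s"
  shows "integral_to t g \<le> integral_to T g"
  unfolding set_lebesgue_integral_def
proof (rule integral_mono)
  have "set_integrable lborel {0..t} g" by (rule set_integrable_subset[OF assms(1)]) (use assms(2) in auto)
  thus "integrable lborel (\<lambda>s. indicat_real {0..t} s *\<^sub>R g s)" "integrable lborel (\<lambda>s. indicat_real {0..T} s *\<^sub>R g s)"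
    using assms(1) by (auto simp: set_integrable_def)
  show "indicat_real {0..t} s *\<^sub>R g s \<le> indicat_real {0..T} s *\<^sub>R g s" for s
    using assms(2,3) by (auto split: split_indicator)
qed

text \<open>The weight e^(2Ks) is chosen so that the integral of K times it is less than half of its
  final value. This 1/2 drives both the Picard iteration and Gronwall's argument.\<close>

lemma integral_to_exp:
  assumes "K > 0" "0 \<le> t"
  shows "integral_to t (\<lambda>s. K * exp (2 * K * s)) = (exp (2 * K * t) - 1) / 2"
proof -
  have "(\<integral>s. (K * exp (2 * K * s)) * indicator {0..t} s \<partial>lborel) = exp (2 * K * t) / 2 - exp (2 * K * 0) / 2"
  proof (rule integral_FTC_Icc_real)
    show "DERIV (\<lambda>s. exp (2 * K * s) / 2) s :> K * exp (2 * K * s)" for s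
      using assms by (auto intro!: derivative_eq_intros)
    show "isCont (\<lambda>s. K * exp (2 * K * s)) s" for s by (intro continuous_intros)
  qed (rule assms)
  moreover have "integral_to t (\<lambda>s. K * exp (2 * K * s)) = (\<integral>s. (K * exp (2 * K * s)) * indicator {0..t} s \<partial>lborel)"
    unfolding set_lebesgue_integral_def by (intro Bochner_Integration.integral_cong) auto
  ultimately show ?thesis by (simp only: mult_zero_right exp_zero diff_divide_distrib)
qed

text \<open>Dominated convergence: the indicators of {0..u n} converge off the single point
  \<open>a\<close>. Resting on integrability, it also covers a drift that is singular at 0.\<close>

lemma continuous_on_integral_to:
  fixes f :: "real \<Rightarrow> 'e::{banach,second_countable_topology}"
  assumes f: "set_integrable lborel {0..T} f"
  shows "continuous_on {0..T} (\<lambda>t. integral_to t f)"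
proof (rule continuous_on_sequentiallyI)
  fix u a assume u: "\<forall>n. u n \<in> {0..T}" and a: "a \<in> {0..T}" and lim: "u \<longlonglongrightarrow> a"
  define g where "g s = indicator {0..T} s *\<^sub>R f s" for s
  have g: "integrable lborel g" using f by (simp add: g_def[abs_def] set_integrable_def)
  have eq: "integral_to t f = (\<integral>s. indicator {0..t} s *\<^sub>R g s \<partial>lborel)" if "t \<in> {0..T}" for t
    unfolding set_lebesgue_integral_def g_def using that
    by (intro Bochner_Integration.integral_cong) (auto split: split_indicator)
  have "(\<lambda>n. \<integral>s. indicator {0..u n} s *\<^sub>R g s \<partial>lborel) \<longlonglongrightarrow> (\<integral>s. indicator {0..a} s *\<^sub>R g s \<partial>lborel)"
  proof (rule integral_dominated_convergence[where w="\<lambda>s. norm (g s)"])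
    show "integrable lborel (\<lambda>s. norm (g s))" by (rule integrable_norm[OF g])
    show "AE s in lborel. norm (indicator {0..u n} s *\<^sub>R g s) \<le> norm (g s)" for n
      by (intro AE_I2) (auto split: split_indicator)
    show "AE s in lborel. (\<lambda>n. indicator {0..u n} s *\<^sub>R g s) \<longlonglongrightarrow> indicator {0..a} s *\<^sub>R g s"
      using AE_lborel_singleton[of a]
    proof eventually_elim
      case (elim s)
      have "\<forall>\<^sub>F n in sequentially. indicator {0..u n} s = (indicator {0..a} s :: real)"
      proof (cases "s < a")
        case True
        from order_tendstoD(1)[OF lim True] show ?thesis
          by (rule eventually_mono) (use True in \<open>auto split: split_indicator\<close>)
      next
        case False
        hence "a < s" using elim by simp
        from order_tendstoD(2)[OF lim this] show ?thesis
          by (rule eventually_mono) (use \<open>a < s\<close> in \<open>auto split: split_indicator\<close>)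
      qed
      thus ?case by (intro tendsto_eventually) (auto elim!: eventually_mono)
    qed
  qed (use g in \<open>auto intro!: borel_measurable_scaleR borel_measurable_integrable\<close>)
  thus "(\<lambda>n. integral_to (u n) f) \<longlonglongrightarrow> integral_to a f" using u a by (simp add: eq)
qed

primrec picard :: "('e \<Rightarrow> 'e) \<Rightarrow> (real \<Rightarrow> 'e) \<Rightarrow> nat \<Rightarrow> real \<Rightarrow> 'e::{banach,second_countable_topology}" where
  "picard A Z 0 = Z"
| "picard A Z (Suc n) = (\<lambda>t. Z t - integral_to t (\<lambda>s. A (picard A Z n s)))"

text \<open>The solution is taken as the pointwise limit of explicit iterates, so that measurability
  in the outcome is inherited from them.\<close>

definition volterra :: "('e \<Rightarrow> 'e) \<Rightarrow> (real \<Rightarrow> 'e) \<Rightarrow> real \<Rightarrow> 'e::{banach,second_countable_topology}" where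
  "volterra A Z t = lim (\<lambda>n. picard A Z n t)"

section \<open>Picard iteration along one path\<close>

locale bounded_op =
  fixes A :: "'e::{banach,second_countable_topology} \<Rightarrow> 'e" and K :: real
  assumes bounded_linear_A: "bounded_linear A" and K_pos: "K > 0" and A_bound: "\<And>x. norm (A x) \<le> K * norm x"
begin

sublocale A: bounded_linear A by (rule bounded_linear_A)

lemma picard_continuous: "continuous_on {0..T} Z \<Longrightarrow> continuous_on {0..T} (picard A Z n)"
proof (induction n)
  case (Suc n)
  hence "continuous_on {0..T} (\<lambda>s. A (picard A Z n s))" by (intro A.continuous_on)
  thus ?case using Suc.prems by (auto intro!: continuous_on_diff continuous_on_integral_to continuous_on_set_integrable)
qed simp

lemma continuous_on_A: "continuous_on S f \<Longrightarrow> continuous_on S (\<lambda>s. A (f s))"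
  by (rule A.continuous_on)

context
  fixes T :: real and Z :: "real \<Rightarrow> 'e" and c :: real
  assumes T: "T > 0" and Z: "continuous_on {0..T} Z"
  defines "c \<equiv> K * integral_to T (\<lambda>s. norm (Z s))"
begin

lemma c_nonneg: "0 \<le> c"
  unfolding c_def set_lebesgue_integral_def using K_pos by (auto intro!: mult_nonneg_nonneg integral_nonneg_AE)

text \<open>\<open>c\<close> bounds the first difference, the integral of \<open>A\<close> applied
  to \<open>Z\<close>. Every further step integrates K times the weight e^(2Ks) and so gains a
  factor 1/2.\<close>

lemma picard_step:
  "t \<in> {0..T} \<Longrightarrow> norm (picard A Z (Suc n) t - picard A Z n t) \<le> c * (1/2) ^ n * exp (2 * K * t)"
proof (induction n arbitrary: t)
  case 0
  have i: "set_integrable lborel {0..t} (\<lambda>s. A (Z s))" "set_integrable lborel {0..t} (\<lambda>s. K * norm (Z s))"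
    using 0 Z by (auto intro!: continuous_on_set_integrable[of T] continuous_intros continuous_on_A)
  have "norm (picard A Z (Suc 0) t - picard A Z 0 t) = norm (integral_to t (\<lambda>s. A (Z s)))" by simp
  also have "\<dots> \<le> integral_to t (\<lambda>s. K * norm (Z s))"
    by (rule norm_integral_to_le[OF i]) (rule A_bound)
  also have "\<dots> = K * integral_to t (\<lambda>s. norm (Z s))" by simp
  also have "\<dots> \<le> c" unfolding c_def using K_pos 0 Z
    by (intro mult_left_mono integral_to_mono continuous_on_set_integrable[of T] continuous_intros) auto
  also have "\<dots> \<le> c * exp (2 * K * t)"
    using c_nonneg K_pos 0 by (intro mult_le_cancel_left1[THEN iffD2]) auto
  finally show ?case by simp
next
  case (Suc n)
  define g where "g s = picard A Z (Suc n) s - picard A Z n s" for s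
  have cg: "continuous_on {0..T} g" unfolding g_def by (intro continuous_on_diff picard_continuous Z)
  have t: "0 \<le> t" "t \<le> T" using Suc.prems by auto
  have ip: "set_integrable lborel {0..t} (\<lambda>s. A (picard A Z m s))" for m
    using t by (intro continuous_on_set_integrable[of T] continuous_on_A picard_continuous Z)
  have "picard A Z (Suc (Suc n)) t - picard A Z (Suc n) t
      = integral_to t (\<lambda>s. A (picard A Z n s)) - integral_to t (\<lambda>s. A (picard A Z (Suc n) s))"
    by (simp only: picard.simps(2)[of A Z "Suc n"] picard.simps(2)[of A Z n]) simp
  also have "\<dots> = integral_to t (\<lambda>s. A (picard A Z n s) - A (picard A Z (Suc n) s))"
    by (rule set_integral_diff(2)[OF ip ip, symmetric])
  also have "norm \<dots> \<le> integral_to t (\<lambda>s. c * (1/2) ^ n * (K * exp (2 * K * s)))"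
  proof (rule norm_integral_to_le)
    show "set_integrable lborel {0..t} (\<lambda>s. A (picard A Z n s) - A (picard A Z (Suc n) s))"
      by (rule set_integral_diff(1)[OF ip ip])
    show "set_integrable lborel {0..t} (\<lambda>s. c * (1/2) ^ n * (K * exp (2 * K * s)))"
      by (intro continuous_on_set_integrable[of t] continuous_intros) simp
    fix s assume s: "s \<in> {0..t}"
    have "norm (A (picard A Z n s) - A (picard A Z (Suc n) s)) = norm (A (g s))"
      by (simp only: g_def A.diff norm_minus_commute)
    also have "\<dots> \<le> K * norm (g s)" by (rule A_bound)
    also have "\<dots> \<le> K * (c * (1/2) ^ n * exp (2 * K * s))"
      unfolding g_def using Suc.IH[of s] s t K_pos by (intro mult_left_mono) auto
    finally show "norm (A (picard A Z n s) - A (picard A Z (Suc n) s)) \<le> c * (1/2) ^ n * (K * exp (2 * K * s))"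
      by (simp add: ac_simps)
  qed
  also have "\<dots> = c * (1/2) ^ n * integral_to t (\<lambda>s. K * exp (2 * K * s))" by (rule set_integral_mult_right)
  also have "\<dots> = c * (1/2) ^ n * ((exp (2 * K * t) - 1) / 2)" using integral_to_exp[OF K_pos t(1)] by simp
  also have "\<dots> \<le> c * (1/2) ^ n * (exp (2 * K * t) / 2)" using c_nonneg by (intro mult_left_mono) auto
  finally show ?case by simp
qed

text \<open>The geometric series gives the factor 2. The bound is uniform in \<open>n\<close>, for
  dominated convergence, and linear in the integral of the norm of \<open>Z\<close>, for the later
  second moment estimate.\<close>

lemma picard_bound:
  assumes "t \<in> {0..T}"
  shows "norm (picard A Z n t - Z t) \<le> 2 * c * exp (2 * K * T)"
proof -
  have "picard A Z n t - Z t = (\<Sum>i<n. picard A Z (Suc i) t - picard A Z i t)"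
    by (subst sum_lessThan_telescope) simp
  also have "norm \<dots> \<le> (\<Sum>i<n. c * exp (2 * K * T) * (1/2) ^ i)"
  proof (rule sum_norm_le)
    fix i
    have "norm (picard A Z (Suc i) t - picard A Z i t) \<le> c * (1/2) ^ i * exp (2 * K * t)" by (rule picard_step[OF assms])
    also have "\<dots> \<le> c * (1/2) ^ i * exp (2 * K * T)" using c_nonneg K_pos assms by (intro mult_left_mono) auto
    finally show "norm (picard A Z (Suc i) t - picard A Z i t) \<le> c * exp (2 * K * T) * (1/2) ^ i" by (simp add: ac_simps)
  qed
  also have "\<dots> = c * exp (2 * K * T) * (\<Sum>i<n. (1/2) ^ i)" by (simp add: sum_distrib_left)
  also have "\<dots> \<le> c * exp (2 * K * T) * 2"
    using c_nonneg sum_le_suminf[OF summable_geometric[of "1/2::real"], of "{..<n}"] suminf_geometric[of "1/2::real"]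
    by (intro mult_left_mono) auto
  finally show ?thesis by (simp add: ac_simps)
qed

lemma picard_uniform_limit: "uniform_limit {0..T} (picard A Z) (volterra A Z) sequentially"
proof -
  define S where "S t = Z t + (\<Sum>i. picard A Z (Suc i) t - picard A Z i t)" for t
  have "uniform_limit {0..T} (\<lambda>n t. \<Sum>i<n. picard A Z (Suc i) t - picard A Z i t) (\<lambda>t. \<Sum>i. picard A Z (Suc i) t - picard A Z i t) sequentially"
  proof (rule Weierstrass_m_test_ev[where M="\<lambda>i. c * exp (2 * K * T) * (1/2) ^ i"])
    show "summable (\<lambda>i. c * exp (2 * K * T) * (1/2) ^ i)" by (intro summable_mult summable_geometric) simp
    have "norm (picard A Z (Suc i) t - picard A Z i t) \<le> c * exp (2 * K * T) * (1/2) ^ i" if t: "t \<in> {0..T}" for t i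
    proof -
      have "norm (picard A Z (Suc i) t - picard A Z i t) \<le> c * (1/2) ^ i * exp (2 * K * t)" by (rule picard_step[OF t])
      also have "\<dots> \<le> c * (1/2) ^ i * exp (2 * K * T)" using c_nonneg K_pos t by (intro mult_left_mono) auto
      finally show ?thesis by (simp add: ac_simps)
    qed
    thus "\<forall>\<^sub>F i in sequentially. \<forall>t\<in>{0..T}. norm (picard A Z (Suc i) t - picard A Z i t) \<le> c * exp (2 * K * T) * (1/2) ^ i"
      by (intro always_eventually) blast
  qed
  hence "uniform_limit {0..T} (\<lambda>n t. Z t + (\<Sum>i<n. picard A Z (Suc i) t - picard A Z i t)) S sequentially"
    unfolding S_def by (intro uniform_limit_intros)
  moreover have "Z t + (\<Sum>i<n. picard A Z (Suc i) t - picard A Z i t) = picard A Z n t" for n t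
    by (subst sum_lessThan_telescope) simp
  ultimately have ul: "uniform_limit {0..T} (picard A Z) S sequentially" by simp
  have "S t = volterra A Z t" if "t \<in> {0..T}" for t
    unfolding volterra_def using limI[OF tendsto_uniform_limitI[OF ul that]] by simp
  thus ?thesis using ul uniform_limit_cong'[of "{0..T}" "picard A Z" "picard A Z" S "volterra A Z"] by simp
qed

lemma picard_tendsto: "t \<in> {0..T} \<Longrightarrow> (\<lambda>n. picard A Z n t) \<longlonglongrightarrow> volterra A Z t"
  by (rule tendsto_uniform_limitI[OF picard_uniform_limit])

lemma volterra_continuous: "continuous_on {0..T} (volterra A Z)"
  by (rule uniform_limit_theorem[OF _ picard_uniform_limit]) (auto intro!: always_eventually picard_continuous Z)

lemma volterra_bound: "t \<in> {0..T} \<Longrightarrow> norm (volterra A Z t - Z t) \<le> 2 * c * exp (2 * K * T)"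
  by (rule LIMSEQ_le_const2[OF tendsto_norm[OF tendsto_diff[OF picard_tendsto tendsto_const]]])
     (auto intro!: exI[of _ 0] picard_bound)

text \<open>The recursion is passed to the limit under the integral; \<open>B\<close> is a majorant
  for all iterates because \<open>picard_bound\<close> is uniform in \<open>n\<close>.\<close>

lemma volterra_equation:
  assumes t: "t \<in> {0..T}"
  shows "volterra A Z t = Z t - integral_to t (\<lambda>s. A (volterra A Z s))"
proof -
  define B where "B s = K * (norm (Z s) + 2 * c * exp (2 * K * T))" for s
  have contB: "continuous_on {0..T} B" unfolding B_def by (intro continuous_intros Z)
  have pm: "(\<lambda>s. indicator {0..t} s *\<^sub>R A (picard A Z n s)) \<in> borel_measurable lborel" for n
    using continuous_on_set_integrable[OF continuous_on_A[OF picard_continuous[OF Z, of n]], of t] t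
    by (auto simp: set_integrable_def)
  have vm: "(\<lambda>s. indicator {0..t} s *\<^sub>R A (volterra A Z s)) \<in> borel_measurable lborel"
    using continuous_on_set_integrable[OF continuous_on_A[OF volterra_continuous], of t] t
    by (auto simp: set_integrable_def)
  have "(\<lambda>n. \<integral>s. indicator {0..t} s *\<^sub>R A (picard A Z n s) \<partial>lborel) \<longlonglongrightarrow> (\<integral>s. indicator {0..t} s *\<^sub>R A (volterra A Z s) \<partial>lborel)"
  proof (rule integral_dominated_convergence[OF vm pm, where w="\<lambda>s. indicator {0..t} s *\<^sub>R B s"])
    show "integrable lborel (\<lambda>s. indicator {0..t} s *\<^sub>R B s)"
      using continuous_on_set_integrable[OF contB, of t] t by (simp add: set_integrable_def)
    show "AE s in lborel. (\<lambda>n. indicator {0..t} s *\<^sub>R A (picard A Z n s)) \<longlonglongrightarrow> indicator {0..t} s *\<^sub>R A (volterra A Z s)"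
    proof (rule AE_I2)
      fix s show "(\<lambda>n. indicator {0..t} s *\<^sub>R A (picard A Z n s)) \<longlonglongrightarrow> indicator {0..t} s *\<^sub>R A (volterra A Z s)"
      proof (cases "s \<in> {0..t}")
        case True
        thus ?thesis using picard_tendsto[of s] t by (intro tendsto_intros A.tendsto) auto
      qed simp
    qed
    show "AE s in lborel. norm (indicator {0..t} s *\<^sub>R A (picard A Z n s)) \<le> indicator {0..t} s *\<^sub>R B s" for n
    proof (rule AE_I2)
      fix s
      have "norm (A (picard A Z n s)) \<le> B s" if s: "s \<in> {0..t}"
      proof -
        have "norm (A (picard A Z n s)) \<le> K * norm (picard A Z n s)" by (rule A_bound)
        also have "\<dots> \<le> B s" unfolding B_def
          using picard_bound[of s n] s t K_pos norm_triangle_ineq2[of "picard A Z n s" "Z s"] by (intro mult_left_mono) auto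
        finally show ?thesis .
      qed
      thus "norm (indicator {0..t} s *\<^sub>R A (picard A Z n s)) \<le> indicator {0..t} s *\<^sub>R B s"
        by (auto split: split_indicator)
    qed
  qed
  hence "(\<lambda>n. Z t - integral_to t (\<lambda>s. A (picard A Z n s))) \<longlonglongrightarrow> Z t - integral_to t (\<lambda>s. A (volterra A Z s))"
    unfolding set_lebesgue_integral_def by (intro tendsto_intros)
  hence "(\<lambda>n. picard A Z (Suc n) t) \<longlonglongrightarrow> Z t - integral_to t (\<lambda>s. A (volterra A Z s))" by simp
  moreover have "(\<lambda>n. picard A Z (Suc n) t) \<longlonglongrightarrow> volterra A Z t" by (rule LIMSEQ_Suc[OF picard_tendsto[OF t]])
  ultimately show ?thesis by (rule LIMSEQ_unique[rotated])
qed

end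

end

text \<open>At the point \<open>r\<close> where e^(-2Ks)|f(s)| attains its maximum m, the hypothesis
  yields m e^(2Kr) \<le> m (e^(2Kr) - 1)/2, which forces m = 0.\<close>

lemma gronwall_zero:
  fixes f :: "real \<Rightarrow> 'e::{banach,second_countable_topology}"
  assumes K: "K > 0" and T: "T > 0" and cont: "continuous_on {0..T} f"
    and le: "\<And>t. t \<in> {0..T} \<Longrightarrow> norm (f t) \<le> K * integral_to t (\<lambda>s. norm (f s))"
    and t: "t \<in> {0..T}"
  shows "f t = 0"
proof -
  define g where "g s = exp (- (2 * K * s)) * norm (f s)" for s
  have "continuous_on {0..T} g" unfolding g_def by (intro continuous_intros cont)
  then obtain r where r: "r \<in> {0..T}" "\<And>s. s \<in> {0..T} \<Longrightarrow> g s \<le> g r"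
    using continuous_attains_sup[of "{0..T}" g] T by auto
  have bd: "norm (f s) \<le> g r * exp (2 * K * s)" if "s \<in> {0..T}" for s
    using r(2)[OF that] by (simp add: g_def exp_minus field_simps)
  have "norm (f r) \<le> K * integral_to r (\<lambda>s. norm (f s))" by (rule le[OF r(1)])
  also have "\<dots> \<le> K * integral_to r (\<lambda>s. g r * exp (2 * K * s))"
  proof (intro mult_left_mono set_integral_mono)
    show "set_integrable lborel {0..r} (\<lambda>s. norm (f s))" "set_integrable lborel {0..r} (\<lambda>s. g r * exp (2 * K * s))"
      using r(1) by (auto intro!: continuous_on_set_integrable[of T] continuous_intros cont)
  qed (use bd r(1) K in auto)
  also have "\<dots> = g r * integral_to r (\<lambda>s. K * exp (2 * K * s))" by simp
  also have "integral_to r (\<lambda>s. K * exp (2 * K * s)) = (exp (2 * K * r) - 1) / 2"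
    using r(1) by (intro integral_to_exp[OF K]) auto
  finally have "g r * exp (2 * K * r) \<le> g r * ((exp (2 * K * r) - 1) / 2)" by (simp add: g_def exp_minus field_simps)
  moreover have "0 \<le> g r" by (simp add: g_def)
  moreover have "(exp (2 * K * r) - 1) / 2 < exp (2 * K * r)" by (simp add: field_simps) (smt (verit) exp_gt_zero)
  ultimately have "g r = 0" by (smt (verit) mult_less_cancel_left_pos)
  thus ?thesis using bd[OF t] by simp
qed

section \<open>Measurability of continuous adapted processes\<close>

text \<open>With time rounded down to the grid of mesh 1/(m+1), the process is pieced together from
  countably many measurable variables, and path continuity recovers it in the limit. For
  \<open>M\<close> the sigma-algebra of time \<open>t\<close> this is progressive
  measurability.\<close>

lemma continuous_process_jointly_measurable:
  fixes f :: "real \<Rightarrow> 'w \<Rightarrow> 'e::{banach,second_countable_topology}"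
  assumes t: "0 \<le> t" and meas: "\<And>s. s \<in> {0..t} \<Longrightarrow> f s \<in> borel_measurable M"
    and cont: "\<And>\<omega>. \<omega> \<in> space M \<Longrightarrow> continuous_on {0..t} (\<lambda>s. f s \<omega>)"
  shows "(\<lambda>(\<omega>, s). indicator {0..t} s *\<^sub>R f s \<omega>) \<in> borel_measurable (M \<Otimes>\<^sub>M lborel)"
proof (rule borel_measurable_LIMSEQ_metric)
  \<comment> \<open>Clamping keeps the sampled times in [0,t], where \<open>f\<close> is measurable
    and continuous, and can only bring them closer to a point of that interval.\<close>
  define r where "r m i = max 0 (min t (real_of_int i / real (Suc m)))" for m :: nat and i :: int
  have r: "r m i \<in> {0..t}" for m i using t by (auto simp: r_def)
  fix m
  have "(\<lambda>z. f (r m \<lfloor>snd z * real (Suc m)\<rfloor>) (fst z)) \<in> borel_measurable (M \<Otimes>\<^sub>M lborel)"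
  proof (rule measurable_compose_countable[where f="\<lambda>i z. f (r m i) (fst z)"])
    show "(\<lambda>z. f (r m i) (fst z)) \<in> borel_measurable (M \<Otimes>\<^sub>M lborel)" for i
      using meas[OF r] by measurable
    show "(\<lambda>z. \<lfloor>snd z * real (Suc m)\<rfloor>) \<in> measurable (M \<Otimes>\<^sub>M lborel) (count_space UNIV)" by measurable
  qed
  thus "(\<lambda>z. indicator {0..t} (snd z) *\<^sub>R f (r m \<lfloor>snd z * real (Suc m)\<rfloor>) (fst z)) \<in> borel_measurable (M \<Otimes>\<^sub>M lborel)"
    by measurable
  fix z :: "'w \<times> real" assume "z \<in> space (M \<Otimes>\<^sub>M lborel)"
  then obtain \<omega> s where z: "z = (\<omega>, s)" "\<omega> \<in> space M" by (auto simp: space_pair_measure)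
  show "(\<lambda>m. indicator {0..t} (snd z) *\<^sub>R f (r m \<lfloor>snd z * real (Suc m)\<rfloor>) (fst z)) \<longlonglongrightarrow> (case z of (\<omega>, s) \<Rightarrow> indicator {0..t} s *\<^sub>R f s \<omega>)"
  proof (cases "s \<in> {0..t}")
    case True
    have "(\<lambda>m. r m \<lfloor>s * real (Suc m)\<rfloor>) \<longlonglongrightarrow> s"
    proof (rule Lim_transform_bound[of _ "\<lambda>m. inverse (real (Suc m))", THEN Lim_null[THEN iffD2]])
      show "\<forall>\<^sub>F m in sequentially. norm (r m \<lfloor>s * real (Suc m)\<rfloor> - s) \<le> norm (inverse (real (Suc m)))"
      proof (rule always_eventually, rule allI)
        fix m
        define q where "q = real_of_int \<lfloor>s * real (Suc m)\<rfloor> / real (Suc m)"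
        have "real_of_int \<lfloor>s * real (Suc m)\<rfloor> \<le> s * real (Suc m)" "s * real (Suc m) < real_of_int \<lfloor>s * real (Suc m)\<rfloor> + 1" by linarith+
        hence q: "q \<le> s" "s \<le> q + inverse (real (Suc m))" unfolding q_def by (auto simp: field_simps)
        have "r m \<lfloor>s * real (Suc m)\<rfloor> = max 0 (min t q)" by (simp add: r_def q_def)
        thus "norm (r m \<lfloor>s * real (Suc m)\<rfloor> - s) \<le> norm (inverse (real (Suc m)))"
          using q True by (auto simp: max_def min_def)
      qed
      show "(\<lambda>m. inverse (real (Suc m))) \<longlonglongrightarrow> 0" by (rule LIMSEQ_inverse_real_of_nat)
    qed
    hence "(\<lambda>m. f (r m \<lfloor>s * real (Suc m)\<rfloor>) \<omega>) \<longlonglongrightarrow> f s \<omega>"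
      by (rule continuous_on_tendsto_compose[OF cont[OF z(2)] _ True]) (rule always_eventually, rule allI, rule r)
    thus ?thesis using True by (simp add: z)
  qed (simp add: z)
qed

section \<open>Adaptedness of the pathwise solution, and predictability\<close>

context brownian_basis
begin

text \<open>An iterate at time \<open>t\<close> involves the path up to \<open>t\<close> only. Joint
  measurability over \<open>Fl t\<close> makes its time integral measurable for \<open>Fl t\<close>,
  and the pointwise limit inherits this.\<close>

lemma volterra_adapted:
  fixes Z :: "real \<Rightarrow> 'w \<Rightarrow> 'e::{banach,second_countable_topology}"
  assumes A: "bounded_op A K" and T: "T > 0"
    and Zc: "\<And>\<omega>. \<omega> \<in> space P \<Longrightarrow> continuous_on {0..T} (\<lambda>t. Z t \<omega>)"
    and Zm: "\<And>t. t \<in> {0..T} \<Longrightarrow> Z t \<in> borel_measurable (Fl t)"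
    and t: "t \<in> {0..T}"
  shows "(\<lambda>\<omega>. volterra A (\<lambda>t. Z t \<omega>) t) \<in> borel_measurable (Fl t)"
proof -
  interpret bounded_op A K by (rule A)
  have Am: "A \<in> borel_measurable borel"
    by (intro borel_measurable_continuous_onI A.continuous_on continuous_on_id)
  have pm: "(\<lambda>\<omega>. picard A (\<lambda>t. Z t \<omega>) n t) \<in> borel_measurable (Fl t)" if "t \<in> {0..T}" for n t
    using that
  proof (induction n arbitrary: t)
    case (Suc n)
    have "(\<lambda>(\<omega>, s). indicator {0..t} s *\<^sub>R A (picard A (\<lambda>t. Z t \<omega>) n s)) \<in> borel_measurable (Fl t \<Otimes>\<^sub>M lborel)"
    proof (rule continuous_process_jointly_measurable)
      show "0 \<le> t" using Suc.prems by simp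
      show "(\<lambda>\<omega>. A (picard A (\<lambda>t. Z t \<omega>) n s)) \<in> borel_measurable (Fl t)" if "s \<in> {0..t}" for s
        using measurable_compose[OF measurable_Fl_mono[OF Suc.IH[of s]] Am, of t] that Suc.prems by simp
      show "continuous_on {0..t} (\<lambda>s. A (picard A (\<lambda>t. Z t \<omega>) n s))" if "\<omega> \<in> space (Fl t)" for \<omega>
        using continuous_on_subset[OF continuous_on_A[OF picard_continuous[OF Zc]], of \<omega> "{0..t}"] that Suc.prems by simp
    qed
    hence "(\<lambda>\<omega>. integral_to t (\<lambda>s. A (picard A (\<lambda>t. Z t \<omega>) n s))) \<in> borel_measurable (Fl t)"
      unfolding set_lebesgue_integral_def by (rule lborel.borel_measurable_lebesgue_integral)
    thus ?case using Zm[OF Suc.prems] by simp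
  qed (simp add: Zm)
  show ?thesis
    by (rule borel_measurable_LIMSEQ_metric[OF pm[OF t]]) (rule picard_tendsto[OF T _ t], simp add: Zc)
qed

text \<open>The base \<open>R\<close> is left general to cover both kinds of generators, the instant
  0 and the left-open intervals. If the target set contains 0, its preimage also picks up everything
  outside the strip over \<open>R\<close>.\<close>

lemma predictable_rectangle:
  fixes Y :: "'w \<Rightarrow> 'e::{banach,second_countable_topology}"
  assumes R: "\<And>B. B \<in> sets (Fl a) \<Longrightarrow> R \<times> B \<in> sets (predictable_sigma P Fl T)"
    and Y: "Y \<in> borel_measurable (Fl a)"
  shows "(\<lambda>(s, \<omega>). indicator R s *\<^sub>R Y \<omega>) \<in> borel_measurable (predictable_sigma P Fl T)"
proof (rule measurableI)
  let ?Q = "predictable_sigma P Fl T"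
  have sp: "space ?Q = {0..T} \<times> space P"
    unfolding predictable_sigma_def by (rule space_measure_of_conv)
  have Rs: "R \<times> space P \<in> sets ?Q" using R[of "space P"] sets.top[of "Fl a"] by simp
  fix U :: "'e set" assume U: "U \<in> sets borel"
  have B: "Y -` U \<inter> space P \<in> sets (Fl a)" using measurable_sets[OF Y U] by simp
  have "(\<lambda>(s, \<omega>). indicator R s *\<^sub>R Y \<omega>) -` U \<inter> space ?Q
      = R \<times> (Y -` U \<inter> space P) \<union> (if 0 \<in> U then space ?Q - R \<times> space P else {})"
    using sets.sets_into_space[OF R[OF B]] sets.sets_into_space[OF Rs]
    by (auto simp: sp split: split_indicator_asm if_splits)
  thus "(\<lambda>(s, \<omega>). indicator R s *\<^sub>R Y \<omega>) -` U \<inter> space ?Q \<in> sets ?Q"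
    using R[OF B] Rs by auto
qed auto

text \<open>On a dyadic cell the process is replaced by its value at the left end, known when the
  cell begins; by continuity these predictable processes converge. The instant 0 lies in no
  left-open cell and gets a term of its own.\<close>

lemma predictable_continuous_adapted:
  fixes X :: "real \<Rightarrow> 'w \<Rightarrow> 'e::{banach,second_countable_topology}"
  assumes T: "T > 0" and Xc: "\<And>\<omega>. \<omega> \<in> space P \<Longrightarrow> continuous_on {0..T} (\<lambda>t. X t \<omega>)"
    and Xm: "\<And>t. t \<in> {0..T} \<Longrightarrow> X t \<in> borel_measurable (Fl t)"
  shows "predictable P Fl T X"
  unfolding predictable_def
proof (rule borel_measurable_LIMSEQ_metric)
  let ?Q = "predictable_sigma P Fl T"
  define G where "G = {{0} \<times> A | A. A \<in> sets (Fl 0)} \<union>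
      {{s<..t} \<times> A | s t A. 0 \<le> s \<and> s < t \<and> t \<le> T \<and> A \<in> sets (Fl s)}"
  have "G \<subseteq> Pow ({0..T} \<times> space P)"
    using T sets.sets_into_space[of _ "Fl _"] by (fastforce simp: G_def)
  hence sQ: "sets ?Q = sigma_sets ({0..T} \<times> space P) G" and sp: "space ?Q = {0..T} \<times> space P"
    unfolding predictable_sigma_def G_def[symmetric] by (auto simp: sets_measure_of space_measure_of)
  have R0: "{0} \<times> B \<in> sets ?Q" if "B \<in> sets (Fl 0)" for B
    unfolding sQ using that by (intro sigma_sets.Basic) (auto simp: G_def)
  have R1: "{a<..b} \<times> B \<in> sets ?Q" if "0 \<le> a" "a < b" "b \<le> T" "B \<in> sets (Fl a)" for a b B
    unfolding sQ using that by (intro sigma_sets.Basic) (auto simp: G_def)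
  define tk where "tk m k = real k * T / 2 ^ m" for m k :: nat
  have tk: "tk m 0 = 0" "tk m (2 ^ m) = T" "\<forall>k<2^m. tk m k < tk m (Suc k)" for m
    using T by (auto simp: tk_def divide_strict_right_mono)
  have tkr: "0 \<le> tk m k" "tk m k \<le> T" if "k \<le> 2 ^ m" for m k
    using strict_steps_le[OF tk(3), of 0 k m] strict_steps_le[OF tk(3), of k "2^m" m] that tk by auto
  fix m
  have "(\<lambda>z. (case z of (s, \<omega>) \<Rightarrow> indicator {0} s *\<^sub>R X 0 \<omega>) + (\<Sum>k<2^m. case z of (s, \<omega>) \<Rightarrow> indicator {tk m k<..tk m (Suc k)} s *\<^sub>R X (tk m k) \<omega>)) \<in> borel_measurable ?Q"
  proof (intro borel_measurable_add borel_measurable_sum predictable_rectangle)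
    show "{0} \<times> B \<in> sets ?Q" if "B \<in> sets (Fl 0)" for B by (rule R0[OF that])
    show "X 0 \<in> borel_measurable (Fl 0)" using Xm[of 0] T by simp
    fix k assume "k \<in> {..<(2::nat)^m}"
    hence k: "k < 2^m" by simp
    show "X (tk m k) \<in> borel_measurable (Fl (tk m k))" using Xm tkr[of k m] k by simp
    show "{tk m k<..tk m (Suc k)} \<times> B \<in> sets ?Q" if "B \<in> sets (Fl (tk m k))" for B
      using R1[OF _ _ _ that, of "tk m (Suc k)"] tkr[of k m] tkr[of "Suc k" m] k tk(3) by auto
  qed
  thus "(\<lambda>(s, \<omega>). indicator {0} s *\<^sub>R X 0 \<omega> + elem_val (2^m) (tk m) (\<lambda>k. X (tk m k)) s \<omega>) \<in> borel_measurable ?Q"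
    by (simp add: elem_val_def case_prod_beta)
  fix z assume "z \<in> space ?Q"
  then obtain s \<omega> where z: "z = (s, \<omega>)" "s \<in> {0..T}" "\<omega> \<in> space P" by (auto simp: sp)
  show "(\<lambda>m. case z of (s, \<omega>) \<Rightarrow> indicator {0} s *\<^sub>R X 0 \<omega> + elem_val (2^m) (tk m) (\<lambda>k. X (tk m k)) s \<omega>) \<longlonglongrightarrow> (case z of (s, \<omega>) \<Rightarrow> X s \<omega>)"
  proof (cases "s = 0")
    case True
    hence "elem_val (2^m) (tk m) (\<lambda>k. X (tk m k)) s \<omega> = 0" for m
      using elem_val_outside[OF tk(3), of s m "\<lambda>k. X (tk m k)" \<omega>] tk(1) by simp
    thus ?thesis using True by (simp add: z)
  next
    case False
    have "\<exists>k<2^m. s \<in> {tk m k<..tk m (Suc k)}" for m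
      using step_interval_exists[of "tk m" s "2^m"] False z(2) tk(1,2) by auto
    then obtain k where k: "\<And>m. k m < 2^m" "\<And>m. s \<in> {tk m (k m)<..tk m (Suc (k m))}" by metis
    have "(\<lambda>m. tk m (k m)) \<longlonglongrightarrow> s"
    proof (rule Lim_transform_bound[of _ "\<lambda>m. T * (1/2) ^ m", THEN Lim_null[THEN iffD2]])
      have "norm (tk m (k m) - s) \<le> norm (T * (1/2) ^ m)" for m
      proof -
        have "tk m (Suc (k m)) = tk m (k m) + T * (1/2) ^ m" by (simp add: tk_def field_simps power_one_over)
        thus ?thesis using k(2)[of m] T by simp
      qed
      thus "\<forall>\<^sub>F m in sequentially. norm (tk m (k m) - s) \<le> norm (T * (1/2) ^ m)" by simp
      show "(\<lambda>m. T * (1/2) ^ m) \<longlonglongrightarrow> 0" by (intro tendsto_mult_right_zero LIMSEQ_power_zero) simp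
    qed
    hence "(\<lambda>m. X (tk m (k m)) \<omega>) \<longlonglongrightarrow> X s \<omega>"
      by (rule continuous_on_tendsto_compose[OF Xc[OF z(3)] _ z(2)]) (use tkr k(1) in \<open>simp add: less_imp_le\<close>)
    moreover have "elem_val (2^m) (tk m) (\<lambda>k. X (tk m k)) s \<omega> = X (tk m (k m)) \<omega>" for m
      by (rule elem_val_eq[OF tk(3) k])
    ultimately show ?thesis using False by (simp add: z)
  qed
qed

text \<open>Time itself is a continuous adapted process, hence predictable, and so is every Borel
  function of it.\<close>

lemma predictable_deterministic:
  fixes G :: "real \<Rightarrow> 'e::{banach,second_countable_topology}"
  assumes T: "T > 0" and G: "(\<lambda>s. indicator {0..T} s *\<^sub>R G s) \<in> borel_measurable borel"
  shows "predictable P Fl T (\<lambda>s \<omega>. G s)"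
proof -
  have "predictable P Fl T (\<lambda>s \<omega>. s)"
    by (rule predictable_continuous_adapted[OF T]) (auto intro: continuous_intros)
  moreover have "(\<lambda>(s :: real, \<omega> :: 'w). s) = fst" by auto
  ultimately have "fst \<in> borel_measurable (predictable_sigma P Fl T)" by (simp add: predictable_def)
  from measurable_compose[OF this G]
  have "(\<lambda>z. indicator {0..T} (fst z) *\<^sub>R G (fst z)) \<in> borel_measurable (predictable_sigma P Fl T)" .
  moreover have "space (predictable_sigma P Fl T) = {0..T} \<times> space P"
    unfolding predictable_sigma_def by (rule space_measure_of_conv)
  ultimately show ?thesis
    unfolding predictable_def by (subst measurable_cong[where g="\<lambda>z. indicator {0..T} (fst z) *\<^sub>R G (fst z)"]) auto
qed

end

section \<open>Integrability of weighted Hoelder functions\<close>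

text \<open>Near 0 the weighted limit bounds t^(1-\<gamma>)|f(t)|, and away from 0 compactness does.
  For \<gamma> = 1 the weight is trivial and \<open>f\<close> is continuous up to 0.\<close>

lemma F_space_bound:
  assumes f: "F_space \<gamma> \<sigma> T f" and \<gamma>: "\<gamma> \<le> 1"
  shows "continuous_on {0<..T} f" "\<exists>C\<ge>0. \<forall>t\<in>{0<..T}. norm (f t) \<le> C * t powr (\<gamma> - 1)"
proof -
  have sub: "{0<..T} \<subseteq> {0..T}" by auto
  show cont: "continuous_on {0<..T} f"
    using f continuous_on_subset[OF _ sub, of f] by (auto simp: F_space_def split: if_splits)
  show "\<exists>C\<ge>0. \<forall>t\<in>{0<..T}. norm (f t) \<le> C * t powr (\<gamma> - 1)"
  proof (cases "\<gamma> = 1")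
    case True
    hence "continuous_on {0..T} f" using f by (simp add: F_space_def)
    hence "bounded (f ` {0..T})" by (intro compact_imp_bounded compact_continuous_image) auto
    then obtain C where "\<forall>t\<in>{0..T}. norm (f t) \<le> C" by (auto simp: bounded_iff)
    thus ?thesis using True by (intro exI[of _ "max C 0"]) (auto simp: max.coboundedI1)
  next
    case False
    define g where "g t = t powr (1 - \<gamma>) *\<^sub>R f t" for t
    obtain L where "(g \<longlongrightarrow> L) (at_right 0)" using f False \<gamma> by (auto simp: F_space_def g_def[abs_def])
    hence "((\<lambda>t. norm (g t)) \<longlongrightarrow> norm L) (at_right 0)" by (rule tendsto_norm)
    hence "\<forall>\<^sub>F t in at_right 0. norm (g t) < norm L + 1" by (rule order_tendstoD) simp
    then obtain b where b: "b > 0" "\<And>t. 0 < t \<Longrightarrow> t < b \<Longrightarrow> norm (g t) < norm L + 1"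
      unfolding eventually_at_right[OF zero_less_one] by auto
    have "continuous_on {b / 2..T} g" unfolding g_def
      using b(1) by (intro continuous_intros continuous_on_subset[OF cont]) auto
    hence "bounded (g ` {b / 2..T})" by (intro compact_imp_bounded compact_continuous_image) auto
    then obtain M where M: "\<forall>t\<in>{b / 2..T}. norm (g t) \<le> M" by (auto simp: bounded_iff)
    have "norm (f t) \<le> max (norm L + 1) M * t powr (\<gamma> - 1)" if t: "t \<in> {0<..T}" for t
    proof -
      have "norm (g t) \<le> max (norm L + 1) M"
      proof (cases "t < b")
        case True
        thus ?thesis using b(2)[of t] t by auto
      next
        case False
        hence "t \<in> {b / 2..T}" using t b(1) by auto
        hence "norm (g t) \<le> M" using M by blast
        thus ?thesis by simp
      qed
      hence "norm (g t) * t powr (\<gamma> - 1) \<le> max (norm L + 1) M * t powr (\<gamma> - 1)" by (intro mult_right_mono) auto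
      moreover have "norm (g t) * t powr (\<gamma> - 1) = norm (f t) * (t powr (1 - \<gamma>) * t powr (\<gamma> - 1))" by (simp add: g_def)
      moreover have "t powr (1 - \<gamma>) * t powr (\<gamma> - 1) = 1" using t by (simp flip: powr_add)
      ultimately show ?thesis by simp
    qed
    thus ?thesis by (intro exI[of _ "max (norm L + 1) M"]) (auto simp: max.coboundedI1)
  qed
qed

lemma F_space_measurable:
  fixes f :: "real \<Rightarrow> 'e::{banach,second_countable_topology}"
  assumes "F_space \<gamma> \<sigma> T f" "\<gamma> \<le> 1" "T > 0"
  shows "(\<lambda>s. indicator {0..T} s *\<^sub>R f s) \<in> borel_measurable borel"
proof -
  have [measurable]: "(\<lambda>s. indicator {0<..T} s *\<^sub>R f s) \<in> borel_measurable borel"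
    by (intro borel_measurable_continuous_on_indicator F_space_bound(1)[OF assms(1,2)]) simp
  \<comment> \<open>The value at 0 is not governed by continuity when \<gamma> < 1, so it enters as
    a separate Borel term.\<close>
  have "(\<lambda>s. indicator {0..T} s *\<^sub>R f s) = (\<lambda>s. indicator {0<..T} s *\<^sub>R f s + indicator {0} s *\<^sub>R f 0)"
    using assms(3) by (auto simp: fun_eq_iff split: split_indicator)
  thus ?thesis by simp
qed

text \<open>A power of t is integrable at 0 when its exponent exceeds -1. For the drift this is
  applied with p = 1 and \<gamma> = \<beta>, for the noise with p = 2 and \<gamma> = \<beta> + 1/2,
  where the exponent is 2\<beta> - 1.\<close>

lemma F_space_nn_integral_power:
  fixes f :: "real \<Rightarrow> 'e::{banach,second_countable_topology}"
  assumes f: "F_space \<gamma> \<sigma> T f" "\<gamma> \<le> 1" and T: "T > 0" and p: "(\<gamma> - 1) * real p > -1" "p > 0"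
  shows "(\<integral>\<^sup>+s\<in>{0..T}. ennreal (norm (f s) ^ p) \<partial>lborel) < \<infinity>"
proof -
  obtain C where C: "C \<ge> 0" "\<And>t. t \<in> {0<..T} \<Longrightarrow> norm (f t) \<le> C * t powr (\<gamma> - 1)" using F_space_bound(2)[OF f] by blast
  define a where "a = (\<gamma> - 1) * real p"
  have "(\<integral>\<^sup>+s\<in>{0..T}. ennreal (norm (f s) ^ p) \<partial>lborel) \<le> (\<integral>\<^sup>+s. ennreal (C ^ p) * (ennreal (s powr a) * indicator {0..T} s) \<partial>lborel)"
  proof (rule nn_integral_mono_AE)
    show "AE s in lborel. ennreal (norm (f s) ^ p) * indicator {0..T} s \<le> ennreal (C ^ p) * (ennreal (s powr a) * indicator {0..T} s)"
      using AE_lborel_singleton[of "0::real"]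
    proof eventually_elim
      case (elim s)
      show ?case
      proof (cases "s \<in> {0..T}")
        case True
        have "norm (f s) ^ p \<le> (C * s powr (\<gamma> - 1)) ^ p" using C(2)[of s] True elim by (intro power_mono) auto
        also have "\<dots> = C ^ p * s powr a" using True elim by (simp add: power_mult_distrib a_def powr_power p(2) mult.commute)
        finally have "ennreal (norm (f s) ^ p) \<le> ennreal (C ^ p * s powr a)" by (rule ennreal_leI)
        thus ?thesis using True C(1) by (simp add: ennreal_mult)
      qed simp
    qed
  qed
  also have "\<dots> = ennreal (C ^ p) * (\<integral>\<^sup>+s\<in>{0..T}. ennreal (s powr a) \<partial>lborel)" by (rule nn_integral_cmult) simp
  also have "(\<integral>\<^sup>+s\<in>{0..T}. ennreal (s powr a) \<partial>lborel) = ennreal (T powr (a + 1) / (a + 1))"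
    using has_integral_powr_from_0[of a T] p T by (intro nn_integral_has_integral_lebesgue') (auto simp: a_def)
  finally show ?thesis by (rule le_less_trans) (simp add: ennreal_mult_less_top)
qed

lemma F_space_set_integrable:
  fixes f :: "real \<Rightarrow> 'e::{banach,second_countable_topology}"
  assumes "F_space \<gamma> \<sigma> T f" "0 < \<gamma>" "\<gamma> \<le> 1" "T > 0"
  shows "set_integrable lborel {0..T} f"
  unfolding set_integrable_def
proof (rule integrableI_bounded)
  show "(\<lambda>s. indicator {0..T} s *\<^sub>R f s) \<in> borel_measurable lborel" using F_space_measurable[OF assms(1,3,4)] by simp
  have "(\<integral>\<^sup>+s. ennreal (norm (indicator {0..T} s *\<^sub>R f s)) \<partial>lborel) = (\<integral>\<^sup>+s\<in>{0..T}. ennreal (norm (f s) ^ 1) \<partial>lborel)"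
    by (intro nn_integral_cong) (auto split: split_indicator)
  also have "\<dots> < \<infinity>" by (rule F_space_nn_integral_power[OF assms(1,3,4)]) (use assms(2) in auto)
  finally show "(\<integral>\<^sup>+s. ennreal (norm (indicator {0..T} s *\<^sub>R f s)) \<partial>lborel) < \<infinity>" .
qed

section \<open>Strict solutions for a bounded operator\<close>

text \<open>\<open>strict_solution\<close> integrates against the completed Lebesgue measure, the
  estimates against \<open>lborel\<close>; this is the passage between the two.\<close>

lemma lebesgue_on_Icc:
  fixes f :: "real \<Rightarrow> 'e::{banach,second_countable_topology}"
  assumes "set_integrable lborel {0..t} f"
  shows "integrable (lebesgue_on {0..t}) f" "integral\<^sup>L (lebesgue_on {0..t}) f = integral_to t f"
proof -
  have i: "integrable lborel (\<lambda>s. indicator {0..t} s *\<^sub>R f s)" using assms by (simp add: set_integrable_def)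
  show "integrable (lebesgue_on {0..t}) f"
    using i by (subst integrable_restrict_space) (auto simp: integrable_completion)
  show "integral\<^sup>L (lebesgue_on {0..t}) f = integral_to t f"
    unfolding set_lebesgue_integral_def using i
    by (subst integral_restrict_space) (auto intro!: integral_completion)
qed

text \<open>The Cauchy-Schwarz inequality against the constant 1, read off from the nonnegativity of
  the integral of (z - a)^2, where \<open>a\<close> is the mean of \<open>z\<close>.\<close>

lemma integral_to_sq_le:
  fixes z :: "real \<Rightarrow> real"
  assumes T: "T > 0" and z: "continuous_on {0..T} z"
  shows "(integral_to T z)\<^sup>2 \<le> T * integral_to T (\<lambda>s. (z s)\<^sup>2)"
proof -
  define a where "a = integral_to T z / T"
  have i: "set_integrable lborel {0..T} (\<lambda>s. (z s)\<^sup>2)" "set_integrable lborel {0..T} (\<lambda>s. 2 * a * z s)" "set_integrable lborel {0..T} (\<lambda>s. a\<^sup>2)"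
    using z by (auto intro!: continuous_on_set_integrable[of T] continuous_intros)
  have "0 \<le> integral_to T (\<lambda>s. (z s - a)\<^sup>2)"
    unfolding set_lebesgue_integral_def by (intro integral_nonneg_AE) auto
  also have "(\<lambda>s. (z s - a)\<^sup>2) = (\<lambda>s. ((z s)\<^sup>2 - 2 * a * z s) + a\<^sup>2)" by (auto simp: power2_diff)
  also have "integral_to T \<dots> = integral_to T (\<lambda>s. (z s)\<^sup>2) - integral_to T (\<lambda>s. 2 * a * z s) + integral_to T (\<lambda>s. a\<^sup>2)"
    using i by (simp only: set_integral_add(2) set_integral_diff)
  also have "\<dots> = integral_to T (\<lambda>s. (z s)\<^sup>2) - 2 * a * (a * T) + T * a\<^sup>2"
    using T by (simp add: a_def set_lebesgue_integral_def)
  finally have "T * a\<^sup>2 \<le> integral_to T (\<lambda>s. (z s)\<^sup>2)" by (simp add: power2_eq_square algebra_simps)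
  hence "T * (T * a\<^sup>2) \<le> T * integral_to T (\<lambda>s. (z s)\<^sup>2)" using T by (intro mult_left_mono) auto
  moreover have "T * (T * a\<^sup>2) = (integral_to T z)\<^sup>2" using T by (simp add: a_def power2_eq_square)
  ultimately show ?thesis by simp
qed

text \<open>Permits replacing \<open>G\<close> by its cut-off to [0,T], which is Borel on the whole
  line.\<close>

lemma ito_integral_cong:
  assumes "\<And>s. s \<in> {0..T} \<Longrightarrow> G s = H s"
  shows "ito_integral P Fl w T (\<lambda>s \<omega>. G s) t I = ito_integral P Fl w T (\<lambda>s \<omega>. H s) t I"
proof -
  have "(\<integral>\<^sup>+s\<in>{0..T}. ennreal ((norm (G s - v s))\<^sup>2) \<partial>lborel) = (\<integral>\<^sup>+s\<in>{0..T}. ennreal ((norm (H s - v s))\<^sup>2) \<partial>lborel)" for v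
    using assms by (intro nn_integral_cong) (auto split: split_indicator)
  thus ?thesis unfolding ito_integral_def by (simp only:)
qed

text \<open>The equation of a strict solution holds almost surely at each time separately, so a
  common exceptional set is available for countably many times only; continuity supplies the
  others.\<close>

lemma le_on_Icc_of_rational:
  fixes f g :: "real \<Rightarrow> real"
  assumes T: "T > 0" and cont: "continuous_on {0..T} f" "continuous_on {0..T} g"
    and le: "\<And>q. q \<in> \<rat> \<inter> {0<..T} \<Longrightarrow> f q \<le> g q" and t: "t \<in> {0..T}"
  shows "f t \<le> g t"
proof (rule ccontr)
  assume "\<not> f t \<le> g t"
  hence pos: "f t - g t > 0" by simp
  have "continuous_on {0..T} (\<lambda>s. f s - g s)" using cont by (rule continuous_on_diff)
  then obtain d where d: "d > 0" "\<And>s. s \<in> {0..T} \<Longrightarrow> dist s t < d \<Longrightarrow> dist (f s - g s) (f t - g t) < f t - g t"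
    using t pos unfolding continuous_on_iff by blast
  have "max 0 (t - d) < min T (t + d)" using T t d(1) by auto
  then obtain q where q: "q \<in> \<rat>" "max 0 (t - d) < q" "q < min T (t + d)" using Rats_dense_in_real by blast
  hence "dist (f q - g q) (f t - g t) < f t - g t" by (intro d(2)) (auto simp: dist_real_def)
  hence "f q > g q" by (auto simp: dist_real_def)
  thus False using le[of q] q by auto
qed

context brownian_basis
begin

text \<open>For each outcome \<open>volterra\<close> solves the equation with forcing
  \<open>Z\<close>. What remains is probabilistic: predictability follows from continuity and
  adaptedness, and the mean square of the graph norm is bounded through a pathwise estimate of
  \<open>X\<close> by \<open>Z\<close>.\<close>

lemma strict_solution_exists:
  fixes A :: "'e::{banach,second_countable_topology} \<Rightarrow> 'e" and F G :: "real \<Rightarrow> 'e"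
  assumes M2: "M_type_2 TYPE('e)" and T: "T > 0" and A: "bounded_op A K"
    and F: "set_integrable lborel {0..T} F"
    and G: "(\<lambda>s. indicator {0..T} s *\<^sub>R G s) \<in> borel_measurable borel"
    and Gfin: "(\<integral>\<^sup>+s\<in>{0..T}. ennreal ((norm (G s))\<^sup>2) \<partial>lborel) < \<infinity>"
    and \<xi>: "\<xi> \<in> borel_measurable (Fl 0)" and \<xi>2: "(\<integral>\<^sup>+\<omega>. ennreal ((norm (\<xi> \<omega>))\<^sup>2) \<partial>P) < \<infinity>"
  shows "\<exists>X. strict_solution P Fl w T UNIV A F G \<xi> X"
proof -
  interpret bounded_op A K by (rule A)
  define h where "h s = indicator {0..T} s *\<^sub>R G s" for s
  have h: "h \<in> borel_measurable borel" using G by (simp add: h_def[abs_def])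
  have hG: "h s = G s" if "s \<in> {0..T}" for s using that by (simp add: h_def)
  have "(\<integral>\<^sup>+s\<in>{0..T}. ennreal ((norm (h s))\<^sup>2) \<partial>lborel) = (\<integral>\<^sup>+s\<in>{0..T}. ennreal ((norm (G s))\<^sup>2) \<partial>lborel)"
    using hG by (intro nn_integral_cong) (auto split: split_indicator)
  hence "(\<integral>\<^sup>+s\<in>{0..T}. ennreal ((norm (h s))\<^sup>2) \<partial>lborel) < \<infinity>" using Gfin by simp
  from ito_integral_continuous_version[OF M2 T h this]
  obtain J KJ where J: "\<And>\<omega>. \<omega> \<in> space P \<Longrightarrow> continuous_on {0..T} (\<lambda>t. J t \<omega>)"
    "\<And>t. t \<in> {0..T} \<Longrightarrow> J t \<in> borel_measurable (Fl t)"
    "\<And>t. t \<in> {0..T} \<Longrightarrow> ito_integral P Fl w T (\<lambda>s \<omega>. h s) t (J t)"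
    "KJ < \<infinity>" "\<And>t. t \<in> {0..T} \<Longrightarrow> (\<integral>\<^sup>+\<omega>. ennreal ((norm (J t \<omega>))\<^sup>2) \<partial>P) \<le> KJ"
    by blast
  have Fi: "set_integrable lborel {0..t} F" if "t \<in> {0..T}" for t
    by (rule set_integrable_subset[OF F]) (use that in auto)
  define Z where "Z t \<omega> = \<xi> \<omega> + integral_to t F + J t \<omega>" for t \<omega>
  have Zc: "continuous_on {0..T} (\<lambda>t. Z t \<omega>)" if "\<omega> \<in> space P" for \<omega>
    unfolding Z_def by (intro continuous_intros continuous_on_integral_to F J(1) that)
  have Zm: "Z t \<in> borel_measurable (Fl t)" if t: "t \<in> {0..T}" for t
    unfolding Z_def using measurable_Fl_mono[OF \<xi>, of t] J(2)[OF t] t by (intro borel_measurable_add) auto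
  have ZP: "Z t \<in> borel_measurable P" if "t \<in> {0..T}" for t using measurable_Fl_P[OF Zm[OF that]] .
  define f0 where "f0 = integral_to T (\<lambda>s. norm (F s))"
  define KZ where "KZ = 2 * (2 * (\<integral>\<^sup>+\<omega>. ennreal ((norm (\<xi> \<omega>))\<^sup>2) \<partial>P) + 2 * KJ) + 2 * ennreal (f0\<^sup>2)"
  have KZ: "KZ < \<infinity>" using \<xi>2 J(4) unfolding KZ_def
    by (simp add: ennreal_mult_less_top ennreal_add_eq_top less_top ennreal_mult_eq_top_iff)
  have Z2: "(\<integral>\<^sup>+\<omega>. ennreal ((norm (Z t \<omega>))\<^sup>2) \<partial>P) \<le> KZ" if t: "t \<in> {0..T}" for t
  proof -
    have [measurable]: "\<xi> \<in> borel_measurable P" "J t \<in> borel_measurable P"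
      using measurable_Fl_P[OF \<xi>] measurable_Fl_P[OF J(2)[OF t]] by auto
    have "norm (integral_to t F) \<le> f0" unfolding f0_def
      using set_integral_norm_bound[OF Fi[OF t]] integral_to_mono[OF set_integrable_norm[OF F], of t] t by force
    hence f0: "(norm (- integral_to t F))\<^sup>2 \<le> f0\<^sup>2" by (intro power_mono) auto
    have "(\<integral>\<^sup>+\<omega>. ennreal ((norm (Z t \<omega>))\<^sup>2) \<partial>P) = (\<integral>\<^sup>+\<omega>. ennreal ((norm ((\<xi> \<omega> - (- J t \<omega>)) - (- integral_to t F)))\<^sup>2) \<partial>P)"
      by (simp add: Z_def algebra_simps)
    also have "\<dots> \<le> 2 * (\<integral>\<^sup>+\<omega>. ennreal ((norm (\<xi> \<omega> - (- J t \<omega>)))\<^sup>2) \<partial>P) + 2 * (\<integral>\<^sup>+\<omega>. ennreal ((norm (- integral_to t F))\<^sup>2) \<partial>P)"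
      by (rule nn_integral_norm_diff_sq_le) simp_all
    also have "(\<integral>\<^sup>+\<omega>. ennreal ((norm (\<xi> \<omega> - (- J t \<omega>)))\<^sup>2) \<partial>P) \<le> 2 * (\<integral>\<^sup>+\<omega>. ennreal ((norm (\<xi> \<omega>))\<^sup>2) \<partial>P) + 2 * (\<integral>\<^sup>+\<omega>. ennreal ((norm (- J t \<omega>))\<^sup>2) \<partial>P)"
      by (rule nn_integral_norm_diff_sq_le) simp_all
    also have "(\<integral>\<^sup>+\<omega>. ennreal ((norm (- J t \<omega>))\<^sup>2) \<partial>P) \<le> KJ" using J(5)[OF t] by simp
    also have "(\<integral>\<^sup>+\<omega>. ennreal ((norm (- integral_to t F))\<^sup>2) \<partial>P) \<le> ennreal (f0\<^sup>2)"
      using f0 by (simp add: emeasure_space_1 ennreal_leI)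
    finally show ?thesis unfolding KZ_def by (simp add: add_mono mult_left_mono)
  qed
  define X where "X t \<omega> = volterra A (\<lambda>t. Z t \<omega>) t" for t \<omega>
  have Xc: "continuous_on {0..T} (\<lambda>t. X t \<omega>)" if "\<omega> \<in> space P" for \<omega>
    unfolding X_def by (rule volterra_continuous[OF T Zc[OF that]])
  have Xm: "X t \<in> borel_measurable (Fl t)" if "t \<in> {0..T}" for t
    unfolding X_def by (rule volterra_adapted[OF A T Zc Zm that])
  have XA: "set_integrable lborel {0..t} (\<lambda>s. A (X s \<omega>))" if "\<omega> \<in> space P" "t \<in> {0..T}" for \<omega> t
    using that by (intro continuous_on_set_integrable[of T] continuous_on_A Xc) auto
  have Xeq: "X t \<omega> = Z t \<omega> - integral_to t (\<lambda>s. A (X s \<omega>))" if "\<omega> \<in> space P" "t \<in> {0..T}" for t \<omega>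
    unfolding X_def by (rule volterra_equation[OF T Zc[OF that(1)] that(2)])
  \<comment> \<open>The time integral of |Z|^2 along a path: up to a constant it dominates the
    square of the memory term in the Volterra equation, and Fubini's theorem bounds its
    mean.\<close>
  define W where "W \<omega> = (\<integral>\<^sup>+s. ennreal ((norm (indicator {0..T} s *\<^sub>R Z s \<omega>))\<^sup>2) \<partial>lborel)" for \<omega>
  note ZJ[measurable] = continuous_process_jointly_measurable[OF less_imp_le[OF T] ZP Zc]
  have Wm[measurable]: "W \<in> borel_measurable P" unfolding W_def by measurable
  have W: "(\<integral>\<^sup>+\<omega>. W \<omega> \<partial>P) \<le> KZ * ennreal T"
  proof -
    interpret ps: pair_sigma_finite P lborel ..
    have "(\<integral>\<^sup>+\<omega>. W \<omega> \<partial>P) = (\<integral>\<^sup>+s. (\<integral>\<^sup>+\<omega>. ennreal ((norm (indicator {0..T} s *\<^sub>R Z s \<omega>))\<^sup>2) \<partial>P) \<partial>lborel)"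
      unfolding W_def by (rule ps.Fubini'[symmetric]) measurable
    also have "\<dots> \<le> (\<integral>\<^sup>+s. KZ * indicator {0..T} s \<partial>lborel)"
      using Z2 by (intro nn_integral_mono) (auto split: split_indicator)
    also have "\<dots> = KZ * ennreal T" using T by (subst nn_integral_cmult_indicator) auto
    finally show ?thesis .
  qed
  \<comment> \<open>\<open>c1\<close> collects |x| + |A x| \<le> (1 + K)|x| and the doubling in the
    square of a sum; \<open>c2\<close> adds the squared constant of \<open>volterra_bound\<close>
    and the length \<open>T\<close> from the Cauchy-Schwarz inequality.\<close>
  define c1 where "c1 = 2 * (1 + K)\<^sup>2"
  define c2 where "c2 = c1 * (2 * K * exp (2 * K * T))\<^sup>2 * T"
  have c: "c1 \<ge> 0" "c2 \<ge> 0" using T by (auto simp: c1_def c2_def)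
  have Xsq: "ennreal ((norm (X t \<omega>) + norm (A (X t \<omega>)))\<^sup>2) \<le> ennreal c1 * ennreal ((norm (Z t \<omega>))\<^sup>2) + ennreal c2 * W \<omega>"
    if \<omega>: "\<omega> \<in> space P" and t: "t \<in> {0..T}" for \<omega> t
  proof -
    define z where "z s = norm (Z s \<omega>)" for s
    have zc: "continuous_on {0..T} z" unfolding z_def by (intro continuous_on_norm Zc[OF \<omega>])
    have i2: "set_integrable lborel {0..T} (\<lambda>s. (z s)\<^sup>2)" using zc by (intro continuous_on_set_integrable[of T] continuous_intros) auto
    have "W \<omega> = (\<integral>\<^sup>+s. ennreal (indicator {0..T} s *\<^sub>R (z s)\<^sup>2) \<partial>lborel)"
      unfolding W_def z_def by (intro nn_integral_cong) (auto split: split_indicator)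
    also have "\<dots> = ennreal (integral_to T (\<lambda>s. (z s)\<^sup>2))"
      unfolding set_lebesgue_integral_def using i2 by (intro nn_integral_eq_integral) (auto simp: set_integrable_def)
    finally have W: "W \<omega> = ennreal (integral_to T (\<lambda>s. (z s)\<^sup>2))" .
    define q where "q = 2 * K * exp (2 * K * T) * integral_to T z"
    have "norm (X t \<omega> - Z t \<omega>) \<le> q"
      using volterra_bound[OF T Zc[OF \<omega>] t] by (simp add: X_def q_def z_def[abs_def] ac_simps)
    hence nX: "norm (X t \<omega>) \<le> z t + q" using norm_triangle_sub[of "X t \<omega>" "Z t \<omega>"] by (simp add: z_def)
    have "norm (X t \<omega>) + norm (A (X t \<omega>)) \<le> (1 + K) * norm (X t \<omega>)" using A_bound[of "X t \<omega>"] by (simp add: distrib_right)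
    also have "\<dots> \<le> (1 + K) * (z t + q)" using nX K_pos by (intro mult_left_mono) auto
    finally have "(norm (X t \<omega>) + norm (A (X t \<omega>)))\<^sup>2 \<le> ((1 + K) * (z t + q))\<^sup>2" by (intro power_mono) auto
    also have "\<dots> = (1 + K)\<^sup>2 * (z t + q)\<^sup>2" by (rule power_mult_distrib)
    also have "\<dots> \<le> (1 + K)\<^sup>2 * (2 * (z t)\<^sup>2 + 2 * q\<^sup>2)"
    proof (rule mult_left_mono)
      show "(z t + q)\<^sup>2 \<le> 2 * (z t)\<^sup>2 + 2 * q\<^sup>2"
        using sum_squares_bound[of "z t" q] by (simp add: power2_eq_square algebra_simps)
    qed simp
    also have "\<dots> = c1 * (z t)\<^sup>2 + c1 * (2 * K * exp (2 * K * T))\<^sup>2 * (integral_to T z)\<^sup>2"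
      by (simp add: c1_def q_def power_mult_distrib algebra_simps)
    also have "\<dots> \<le> c1 * (z t)\<^sup>2 + c1 * (2 * K * exp (2 * K * T))\<^sup>2 * (T * integral_to T (\<lambda>s. (z s)\<^sup>2))"
      using integral_to_sq_le[OF T zc] c by (intro add_left_mono mult_left_mono) auto
    also have "\<dots> = c1 * (z t)\<^sup>2 + c2 * integral_to T (\<lambda>s. (z s)\<^sup>2)" by (simp add: c2_def)
    finally have le: "(norm (X t \<omega>) + norm (A (X t \<omega>)))\<^sup>2 \<le> c1 * (z t)\<^sup>2 + c2 * integral_to T (\<lambda>s. (z s)\<^sup>2)" .
    have "0 \<le> integral_to T (\<lambda>s. (z s)\<^sup>2)" unfolding set_lebesgue_integral_def by (intro integral_nonneg_AE) auto
    thus ?thesis using ennreal_leI[OF le] c by (simp add: W z_def ennreal_plus ennreal_mult)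
  qed
  define KX where "KX = ennreal c1 * KZ + ennreal c2 * (KZ * ennreal T)"
  have KX: "KX < \<infinity>" using KZ unfolding KX_def
    by (simp add: ennreal_mult_less_top ennreal_add_eq_top less_top ennreal_mult_eq_top_iff)
  have X2: "(\<integral>\<^sup>+\<omega>. ennreal ((norm (X t \<omega>) + norm (A (X t \<omega>)))\<^sup>2) \<partial>P) \<le> KX" if t: "t \<in> {0..T}" for t
  proof -
    note [measurable] = ZP[OF t]
    have "(\<integral>\<^sup>+\<omega>. ennreal ((norm (X t \<omega>) + norm (A (X t \<omega>)))\<^sup>2) \<partial>P) \<le> (\<integral>\<^sup>+\<omega>. ennreal c1 * ennreal ((norm (Z t \<omega>))\<^sup>2) + ennreal c2 * W \<omega> \<partial>P)"
      by (intro nn_integral_mono Xsq t)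
    also have "\<dots> = ennreal c1 * (\<integral>\<^sup>+\<omega>. ennreal ((norm (Z t \<omega>))\<^sup>2) \<partial>P) + ennreal c2 * (\<integral>\<^sup>+\<omega>. W \<omega> \<partial>P)"
      by (subst nn_integral_add) (auto simp: nn_integral_cmult)
    also have "\<dots> \<le> KX" unfolding KX_def by (intro add_mono mult_left_mono Z2[OF t] W) auto
    finally show ?thesis .
  qed
  have "strict_solution P Fl w T UNIV A F G \<xi> X"
    unfolding strict_solution_def
  proof (intro conjI ballI)
    show "predictable P Fl T X" by (rule predictable_continuous_adapted[OF T Xc Xm])
    show "N2 P Fl T (\<lambda>t \<omega>. G t)"
      unfolding N2_def using predictable_deterministic[OF T G] Gfin by (simp add: emeasure_space_1)
    show "continuous_on {0..T} (\<lambda>t. X t \<omega>)" if "\<omega> \<in> space P" for \<omega> by (rule Xc[OF that])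
    show "integrable (lebesgue_on {0..t}) F" if "t \<in> {0..T}" for t by (rule lebesgue_on_Icc(1)[OF Fi[OF that]])
    fix t assume "t \<in> {0<..T}"
    hence t: "t \<in> {0..T}" by simp
    have "(\<integral>\<^sup>+s\<in>{0<..t}. (\<integral>\<^sup>+\<omega>. ennreal ((norm (X s \<omega>) + norm (A (X s \<omega>)))\<^sup>2) \<partial>P) \<partial>lborel) \<le> (\<integral>\<^sup>+s. KX * indicator {0<..t} s \<partial>lborel)"
      using t X2 by (intro nn_integral_mono) (auto split: split_indicator)
    also have "\<dots> = KX * ennreal t" using t by (subst nn_integral_cmult_indicator) auto
    also have "\<dots> < \<infinity>" using KX by (simp add: ennreal_mult_less_top)
    finally show "(\<integral>\<^sup>+s\<in>{0<..t}. (\<integral>\<^sup>+\<omega>. ennreal ((norm (X s \<omega>) + norm (A (X s \<omega>)))\<^sup>2) \<partial>P) \<partial>lborel) < \<infinity>" .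
    have "ito_integral P Fl w T (\<lambda>s \<omega>. G s) t (J t)" using J(3)[OF t] ito_integral_cong[of T h G P Fl w t "J t"] hG by simp
    moreover have "AE \<omega> in P. integrable (lebesgue_on {0..t}) (\<lambda>s. A (X s \<omega>)) \<and>
        X t \<omega> = \<xi> \<omega> - integral\<^sup>L (lebesgue_on {0..t}) (\<lambda>s. A (X s \<omega>)) + integral\<^sup>L (lebesgue_on {0..t}) F + J t \<omega>"
      using Xeq[OF _ t] by (intro AE_I2)
        (simp add: lebesgue_on_Icc[OF XA[OF _ t]] lebesgue_on_Icc[OF Fi[OF t]] Z_def)
    ultimately show "\<exists>I. ito_integral P Fl w T (\<lambda>s \<omega>. G s) t I \<and> (AE \<omega> in P. integrable (lebesgue_on {0..t}) (\<lambda>s. A (X s \<omega>)) \<and>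
        X t \<omega> = \<xi> \<omega> - integral\<^sup>L (lebesgue_on {0..t}) (\<lambda>s. A (X s \<omega>)) + integral\<^sup>L (lebesgue_on {0..t}) F + I \<omega>)"
      by blast
  qed auto
  thus ?thesis by blast
qed

lemma strict_solution_unique:
  fixes A :: "'e::{banach,second_countable_topology} \<Rightarrow> 'e" and F G :: "real \<Rightarrow> 'e"
  assumes M2: "M_type_2 TYPE('e)" and T: "T > 0" and A: "bounded_op A K"
    and G: "(\<lambda>s. indicator {0..T} s *\<^sub>R G s) \<in> borel_measurable borel"
    and X: "strict_solution P Fl w T D A F G \<xi> X" and Y: "strict_solution P Fl w T D A F G \<xi> Y"
  shows "AE \<omega> in P. \<forall>t\<in>{0..T}. X t \<omega> = Y t \<omega>"
proof -
  interpret bounded_op A K by (rule A)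
  define h where "h s = indicator {0..T} s *\<^sub>R G s" for s
  have h: "h \<in> borel_measurable borel" using G by (simp add: h_def[abs_def])
  have hG: "G s = h s" if "s \<in> {0..T}" for s using that by (simp add: h_def)
  have cX: "continuous_on {0..T} (\<lambda>t. X t \<omega>)" and cY: "continuous_on {0..T} (\<lambda>t. Y t \<omega>)" if "\<omega> \<in> space P" for \<omega>
    using X Y that by (auto simp: strict_solution_def)
  have iX: "set_integrable lborel {0..t} (\<lambda>s. A (X s \<omega>))" and iY: "set_integrable lborel {0..t} (\<lambda>s. A (Y s \<omega>))"
    if "\<omega> \<in> space P" "t \<le> T" for t \<omega>
    using cX[OF that(1)] cY[OF that(1)] that(2) by (auto intro!: continuous_on_set_integrable[of T] continuous_on_A)
  \<comment> \<open>Only rational times are treated: the null sets off which the equations hold and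
    the two stochastic integrals agree depend on \<open>t\<close>.\<close>
  have step: "AE \<omega> in P. norm (X t \<omega> - Y t \<omega>) \<le> K * integral_to t (\<lambda>s. norm (X s \<omega> - Y s \<omega>))" if t: "t \<in> \<rat> \<inter> {0<..T}" for t
  proof -
    have t': "t \<in> {0<..T}" using t by simp
    have sol: "\<exists>I. ito_integral P Fl w T (\<lambda>s \<omega>. G s) t I \<and> (AE \<omega> in P. V t \<omega> = \<xi> \<omega> -
      integral\<^sup>L (lebesgue_on {0..t}) (\<lambda>s. A (V s \<omega>)) + integral\<^sup>L (lebesgue_on {0..t}) F + I \<omega>)"
      if "strict_solution P Fl w T D A F G \<xi> V" for V
      using that t' unfolding strict_solution_def AE_conj_iff by blast
    obtain I where I: "ito_integral P Fl w T (\<lambda>s \<omega>. G s) t I"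
      "AE \<omega> in P. X t \<omega> = \<xi> \<omega> - integral\<^sup>L (lebesgue_on {0..t}) (\<lambda>s. A (X s \<omega>)) + integral\<^sup>L (lebesgue_on {0..t}) F + I \<omega>"
      using sol[OF X] by blast
    obtain I' where I': "ito_integral P Fl w T (\<lambda>s \<omega>. G s) t I'"
      "AE \<omega> in P. Y t \<omega> = \<xi> \<omega> - integral\<^sup>L (lebesgue_on {0..t}) (\<lambda>s. A (Y s \<omega>)) + integral\<^sup>L (lebesgue_on {0..t}) F + I' \<omega>"
      using sol[OF Y] by blast
    have "ito_integral P Fl w T (\<lambda>s \<omega>. G s) t J = ito_integral P Fl w T (\<lambda>s \<omega>. h s) t J" for J
      by (rule ito_integral_cong) (rule hG)
    hence "AE \<omega> in P. I \<omega> = I' \<omega>"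
      using I(1) I'(1) t' by (intro ito_integral_unique[OF M2 h, of t T]) auto
    with I(2) I'(2) AE_space show ?thesis
    proof eventually_elim
      case (elim \<omega>)
      have tT: "t \<le> T" using t by simp
      have "X t \<omega> - Y t \<omega> = integral_to t (\<lambda>s. A (Y s \<omega>)) - integral_to t (\<lambda>s. A (X s \<omega>))"
        using elim by (simp add: lebesgue_on_Icc[OF iX[OF _ tT]] lebesgue_on_Icc[OF iY[OF _ tT]])
      also have "\<dots> = integral_to t (\<lambda>s. A (Y s \<omega>) - A (X s \<omega>))"
        by (rule set_integral_diff(2)[symmetric, OF iY iX]) (use elim tT in auto)
      also have "norm \<dots> \<le> integral_to t (\<lambda>s. K * norm (X s \<omega> - Y s \<omega>))"
      proof (rule norm_integral_to_le)
        show "set_integrable lborel {0..t} (\<lambda>s. A (Y s \<omega>) - A (X s \<omega>))"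
          by (rule set_integral_diff(1)[OF iY iX]) (use elim tT in auto)
        show "set_integrable lborel {0..t} (\<lambda>s. K * norm (X s \<omega> - Y s \<omega>))"
          using cX[of \<omega>] cY[of \<omega>] elim tT by (intro continuous_on_set_integrable[of T] continuous_intros) auto
        show "norm (A (Y s \<omega>) - A (X s \<omega>)) \<le> K * norm (X s \<omega> - Y s \<omega>)" for s
          using A_bound[of "Y s \<omega> - X s \<omega>"] by (simp add: A.diff norm_minus_commute)
      qed
      finally show ?case by simp
    qed
  qed
  have "AE \<omega> in P. \<forall>t\<in>\<rat> \<inter> {0<..T}. norm (X t \<omega> - Y t \<omega>) \<le> K * integral_to t (\<lambda>s. norm (X s \<omega> - Y s \<omega>))"
    by (subst AE_ball_countable) (auto intro!: countable_Int1 countable_rat step)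
  thus ?thesis using AE_space
  proof eventually_elim
    case (elim \<omega>)
    have cD: "continuous_on {0..T} (\<lambda>t. X t \<omega> - Y t \<omega>)" using cX cY elim by (intro continuous_on_diff) auto
    have "norm (X t \<omega> - Y t \<omega>) \<le> K * integral_to t (\<lambda>s. norm (X s \<omega> - Y s \<omega>))" if "t \<in> {0..T}" for t
      by (rule le_on_Icc_of_rational[OF T _ _ _ that])
         (use elim in \<open>auto intro!: cD continuous_on_norm continuous_on_mult_left continuous_on_integral_to continuous_on_set_integrable[of T]\<close>)
    hence "X t \<omega> - Y t \<omega> = 0" if "t \<in> {0..T}" for t
      using gronwall_zero[OF K_pos T cD _ that] by blast
    thus ?case by simp
  qed
qed

end
theorem theorem4p2:
  fixes P :: "'w measure" and Fl :: "real \<Rightarrow> 'w measure" and w :: "real \<Rightarrow> 'w \<Rightarrow> real"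
    and T :: real and D :: "'e::{banach,second_countable_topology} set" and A :: "'e \<Rightarrow> 'e"
    and S :: "real \<Rightarrow> 'e \<Rightarrow> 'e" and F G :: "real \<Rightarrow> 'e" and \<xi> :: "'w \<Rightarrow> 'e"
  assumes mtype: "M_type_2 TYPE('e)"
    and T_pos: "T > 0"
    and A_op: "closed_dense_linear_op D A"
    and A_sect: "\<exists>\<omega> M. 0 < \<omega> \<and> \<omega> < pi / 2 \<and> sectorial D A \<omega> M"
    and S_gen: "generates_neg S D A"
    and FG: "(\<exists>\<beta> \<sigma>. 0 < \<sigma> \<and> \<sigma> < \<beta> \<and> \<beta> \<le> 1/2 \<and> F_space \<beta> \<sigma> T F \<and> F_space (\<beta> + 1/2) \<sigma> T G)
           \<or> (\<exists>\<beta> \<sigma>. 0 < \<sigma> \<and> \<sigma> < \<beta> \<and> \<beta> \<le> 1 \<and> F_space \<beta> \<sigma> T F \<and> B_space T G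
                 \<and> G \<in> borel_measurable borel)"
    and AS: "\<exists>\<delta> c. 0 < \<delta> \<and> \<delta> < 1/2 \<and> c > 0 \<and>
               (\<forall>t\<in>{0<..T}. (\<forall>x. S t x \<in> D) \<and> onorm (\<lambda>x. A (S t x)) < c * t powr (- \<delta>))"
    and basis: "usual_basis P Fl"
    and bm: "brownian_motion P Fl w"
    and xi_meas: "\<xi> \<in> borel_measurable (Fl 0)"
    and xi_L2: "(\<integral>\<^sup>+\<omega>. ennreal ((norm (\<xi> \<omega>))\<^sup>2) \<partial>P) < \<infinity>"
  shows "\<exists>X. strict_solution P Fl w T D A F G \<xi> X \<and> in_C_DA P T D A X \<and>
           (\<forall>Y. strict_solution P Fl w T D A F G \<xi> Y \<and> in_C_DA P T D A Y \<longrightarrow>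
                (AE \<omega> in P. \<forall>t\<in>{0..T}. X t \<omega> = Y t \<omega>))"
proof -
  obtain \<delta> c where \<delta>: "\<delta> < 1/2" "c > 0"
    and AS': "\<And>t x. t \<in> {0<..T} \<Longrightarrow> S t x \<in> D"
      "\<And>t. t \<in> {0<..T} \<Longrightarrow> onorm (\<lambda>x. A (S t x)) < c * t powr (- \<delta>)"
    using AS by blast
  have "\<delta> < 1" using \<delta>(1) by simp
  \<comment> \<open>From here on \<open>D\<close> is the whole space and the graph norm is
    equivalent to the norm.\<close>
  note bounded = integrable_singularity_imp_bounded_generator[OF A_op S_gen T_pos this \<delta>(2) AS']
  obtain K where K: "K > 0" "\<And>x. norm (A x) \<le> norm x * K"
    using bounded_linear.pos_bounded[OF bounded(2)] by blast
  have A: "bounded_op A K"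
    by (rule bounded_op.intro) (use bounded(2) K in \<open>auto simp: mult.commute\<close>)
  interpret brownian_basis P Fl w by (unfold_locales; fact)
  \<comment> \<open>Both alternatives give some \<beta> with 0 < \<beta> \<le> 1 for the
    drift.\<close>
  have F: "set_integrable lborel {0..T} F"
    using FG F_space_set_integrable[OF _ _ _ T_pos, of _ _ F] by force
  have G: "(\<lambda>s. indicator {0..T} s *\<^sub>R G s) \<in> borel_measurable borel \<and>
    (\<integral>\<^sup>+s\<in>{0..T}. ennreal ((norm (G s))\<^sup>2) \<partial>lborel) < \<infinity>"
    using FG
  proof (elim disjE exE conjE)
    fix \<beta> \<sigma> :: real assume \<beta>: "0 < \<sigma>" "\<sigma> < \<beta>" "\<beta> \<le> 1/2" and G: "F_space (\<beta> + 1/2) \<sigma> T G"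
    have le: "\<beta> + 1/2 \<le> 1" using \<beta> by simp
    \<comment> \<open>With p = 2 the exponent at 0 is 2(\<beta> + 1/2 - 1) = 2\<beta> - 1, which
      exceeds -1 because \<beta> is positive.\<close>
    have "(\<integral>\<^sup>+s\<in>{0..T}. ennreal ((norm (G s))\<^sup>2) \<partial>lborel) < \<infinity>"
      using F_space_nn_integral_power[OF G le T_pos, of 2] \<beta> by simp
    thus ?thesis using F_space_measurable[OF G le T_pos] by blast
  next
    assume bd: "B_space T G" and [measurable]: "G \<in> borel_measurable borel"
    obtain B where "\<forall>y\<in>G ` {0..T}. norm y \<le> B" using bd unfolding B_space_def bounded_iff by blast
    hence B: "norm (G s) \<le> B" if "s \<in> {0..T}" for s using that by blast
    have "(\<integral>\<^sup>+s\<in>{0..T}. ennreal ((norm (G s))\<^sup>2) \<partial>lborel) \<le> (\<integral>\<^sup>+s. ennreal (B\<^sup>2) * indicator {0..T} s \<partial>lborel)"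
      using B by (intro nn_integral_mono) (auto split: split_indicator intro!: ennreal_leI power_mono)
    also have "\<dots> = ennreal (B\<^sup>2) * ennreal T" using T_pos by (subst nn_integral_cmult_indicator) auto
    also have "\<dots> < \<infinity>" by (simp add: ennreal_mult_less_top)
    finally show ?thesis by simp
  qed
  obtain X where X: "strict_solution P Fl w T UNIV A F G \<xi> X"
    using strict_solution_exists[OF mtype T_pos A F _ _ xi_meas xi_L2] G by blast
  have C: "in_C_DA P T UNIV A X"
    unfolding in_C_DA_def
  proof (intro ballI conjI UNIV_I)
    fix \<omega> assume "\<omega> \<in> space P"
    hence "continuous_on {0..T} (\<lambda>t. X t \<omega>)" using X by (simp add: strict_solution_def)
    thus c: "continuous_on {0<..T} (\<lambda>t. X t \<omega>)" by (rule continuous_on_subset) auto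
    show "continuous_on {0<..T} (\<lambda>t. A (X t \<omega>))" by (rule bounded_linear.continuous_on[OF bounded(2) c])
  qed
  show ?thesis
  proof (intro exI[of _ X] conjI allI impI)
    show "strict_solution P Fl w T D A F G \<xi> X" "in_C_DA P T D A X" using X C bounded(1) by auto
    fix Y assume "strict_solution P Fl w T D A F G \<xi> Y \<and> in_C_DA P T D A Y"
    thus "AE \<omega> in P. \<forall>t\<in>{0..T}. X t \<omega> = Y t \<omega>"
      using strict_solution_unique[OF mtype T_pos A conjunct1[OF G] X] bounded(1) by auto
  qed
qed

end
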